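(* Let $(\mathcal{C},R)$ be an optimization domain such that $\mathrm{Lin}(\mathcal{C})$ has finite limits. Then there is a hypergraph category $\mathbf{Opt}_{\mathcal{C}}^R$ defined by the following data. (i) Objects are the objects of $\mathcal{C}$. (ii) Morphisms $X\to Y$ are isomorphism classes of open objectives with domain boundary $X$ and codomain boundary $Y$. (iii) The composite of $(X\xleftarrow{l_1}N\xrightarrow{r_1}Y,\ f\in O(N))$ and $(Y\xleftarrow{l_2}M\xrightarrow{r_2}Z,\ g\in O(M))$ is the span $X\xleftarrow{l_1\circ b_0}N\times_Y M\xrightarrow{r_2\circ b_1}Z$, where $N\xleftarrow{b_0}N\times_YM\xrightarrow{b_1}M$ is the pullback of $r_1$ and $l_2$ in $\mathrm{Lin}(\mathcal{C})$, together with the objective given by $$\{*\}\cong\{*\}\times\{*\}\xrightarrow{f\times g}O(N)\times O(M)\xrightarrow{\varphi_{N,M}}O(N\times M)\xrightarrow{O(\langle b_0,b_1\rangle)}O(N\times_YM),$$ where $\langle b_0,b_1\rangle\colon N\times_YM\to N\times M$ is the pairing. (iv) The identity on $X$ is the span $X=X=X$ with decoration $\{*\}\xrightarrow{\varphi_0}O( * )\xrightarrow{O(!)}O(X)$. (v) The monoidal product on objects is their product in $\mathcal{C}$, and the monoidal product of $(X\leftarrow N\to Y,f)$ and $(W\leftarrow M\to Z,g)$ is $(X\times W\leftarrow N\times M\to Y\times Z,\ \varphi_{N,M}(f,g))$. (vi) The hypergraph (Frobenius) maps are those of $\mathrm{Span}(\mathrm{Lin}(\mathcal{C}))$, decorated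 with the identity decoration.
   Context: Composition is written in classical order: $(g\circ f)(x)=g(f(x))$. A Cartesian left-additive category is a category $\mathcal{C}$ with finite products ($\times$, terminal object $*$, unique maps $!_X\colon X\to *$) in which every hom-set $\mathcal{C}(X,Y)$ is a commutative monoid with operation $+$ and identity $0_{X,Y}$, such that (LA.1) $(f+g)\circ h=f\circ h+g\circ h$ and $0_{Y,Z}\circ h=0_{X,Z}$ for all $h\colon X\to Y$, $f,g\colon Y\to Z$; (LA.2) for every projection $\pi_i\colon Y\to Z$ and $f,g\colon X\to Y$, $\pi_i\circ(f+g)=\pi_i\circ f+\pi_i\circ g$ and $\pi_i\circ 0_{X,Y}=0_{X,Z}$. Write $0_X$ for the additive identity of $\mathcal{C}( *,X)$, and $\iota_0:=\langle\mathrm{id},0\rangle$, $\iota_1:=\langle 0,\mathrm{id}\rangle$ for the injections into a product. A Cartesian reverse derivative category (CRDC) is a Cartesian left-additive category with a combinator $\mathbf{R}$ sending each $f\colon X\to Y$ to $\mathbf{R}[f]\colon X\times Y\to X$ such that, writing $\mathbf{D}[f]:=\pi_1\circ\mathbf{R}[\mathbf{R}[f]]\circ(\langle\mathrm{id}_X,0_{X,Y}\rangle\times\mathrm{id}_X)\colon X\times X\to Y$: (RD.1) $\mathbf{R}[f+g]=\mathbf{R}[f]+\mathbf{R}[g]$, $\mathbf{R}[0]=0$; (RD.2) $\mathbf{R}[f]\circ\langle a,b+c\rangle=\mathbf{R}[f]\circ\langle a,b\rangle+\mathbf{R}[f]\circ\langle a,c\rangle$ and $\mathbf{R}[f]\circ\langle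 a,0\rangle=0$; (RD.3) $\mathbf{R}[\mathrm{id}]=\pi_1$, $\mathbf{R}[\pi_0]=\iota_0\circ\pi_1$, $\mathbf{R}[\pi_1]=\iota_1\circ\pi_1$; (RD.4) $\mathbf{R}[\langle f,g\rangle]=\mathbf{R}[f]\circ(\mathrm{id}\times\pi_0)+\mathbf{R}[g]\circ(\mathrm{id}\times\pi_1)$ and $\mathbf{R}[!_X]=0$; (RD.5) $\mathbf{R}[g\circ f]=\mathbf{R}[f]\circ(\mathrm{id}\times\mathbf{R}[g])\circ\langle\pi_0,\langle f\circ\pi_0,\pi_1\rangle\rangle$; (RD.6) $\mathbf{D}[\mathbf{R}[f]]\circ\langle\mathrm{id}\times\pi_0,0\times\pi_1\rangle=\mathbf{R}[f]\circ(\mathrm{id}\times\pi_1)$ as maps $X\times(Y\times Y)\to X$; (RD.7) $\mathbf{D}[\mathbf{D}[f]]=\mathbf{D}[\mathbf{D}[f]]\circ\langle\pi_0\times\pi_0,\pi_1\times\pi_1\rangle$. A morphism $f$ of a CRDC is a linear map if $\mathbf{D}[f]=f\circ\pi_1$. $\mathrm{Lin}(\mathcal{C})$ is the subcategory with the same objects as $\mathcal{C}$ and the linear maps as morphisms; its monoidal product $\times$ is the product of $\mathcal{C}$. An optimization domain $(\mathcal{C},R)$ is a CRDC $\mathcal{C}$ with an object $R$ such that: every morphism $f$ of $\mathcal{C}$ has an additive inverse $-f$; each $\mathcal{C}( *,X)$ is equipped with a multiplication and a multiplicative identity $1_X\colon *\to X$ making it, with the left-additive structure, a commutative ring; and $\mathcal{C}(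 *,R)$ is equipped with a total order making it an ordered commutative ring. The lax symmetric monoidal functor $O=O_{\mathcal{C}}^R\colon(\mathrm{Lin}(\mathcal{C})^{\mathrm{op}},\times)\to(\mathbf{Set},\times)$ is: $O(X)=\mathcal{C}(X,R)$; $O(\phi)(f)=f\circ\phi$ for $\phi\colon X\to Y$ linear and $f\colon Y\to R$; $\varphi_{X,Y}(f,g)=f\circ\pi_0+g\circ\pi_1$; $\varphi_0\colon\{*\}\to O( * )$ selects $0_R$. An open objective with domain boundary $X$ and codomain boundary $Y$ is a span $X\xleftarrow{l}N\xrightarrow{r}Y$ in $\mathrm{Lin}(\mathcal{C})$ together with a morphism $f\colon N\to R$ in $\mathcal{C}$. An isomorphism from $(X\leftarrow N\to Y,f)$ to $(X\leftarrow N'\to Y,f')$ is an isomorphism $n\colon N\to N'$ in $\mathrm{Lin}(\mathcal{C})$ commuting with the legs and with $O(n)(f')=f$. A hypergraph category is a symmetric monoidal category in which every object is equipped with a special commutative Frobenius monoid structure (commutative monoid $(\mu,\eta)$ and cocommutative comonoid $(\delta,\epsilon)$ satisfying the Frobenius law and $\mu\circ\delta=\mathrm{id}$), compatibly with the monoidal product. In $\mathrm{Span}(\mathrm{Lin}(\mathcal{C}))$ the structure on $X$ is: $\mu=(X\times X\xleftarrow{\Delta}X=X)$, $\eta=( *\xleftarrow{!}X=X)$, $\delta=(X=X\xrightarrow{\Delta}X\times X)$, $\epsilon=(X=X\xrightarrow{!}* )$, with $\Delta=\langle\mathrm{id},\mathrm{id}\rangle$. The identity decoration on an apex $N$ is the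 element $\{*\}\xrightarrow{\varphi_0}O( * )\xrightarrow{O(!)}O(N)$. *)

theory Defs
  imports "HOL-Algebra.Ring"
begin

section \<open>Categories\<close>

text \<open>Composition is in classical order: \<open>g \<bullet> f\<close> is ``first \<open>f\<close>, then \<open>g\<close>''.\<close>

record ('o, 'm) category =
  Obj :: "'o set"
  Arr :: "'m set"
  Dom :: "'m \<Rightarrow> 'o"
  Cod :: "'m \<Rightarrow> 'o"
  Ident :: "'o \<Rightarrow> 'm"
  Comp :: "'m \<Rightarrow> 'm \<Rightarrow> 'm"  (infixr "\<bullet>\<index>" 75)

definition Hom :: "('o, 'm, 'z) category_scheme \<Rightarrow> 'o \<Rightarrow> 'o \<Rightarrow> 'm set" where
  "Hom C X Y = {f \<in> Arr C. Dom C f = X \<and> Cod C f = Y}"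

locale category =
  fixes C (structure)
  assumes Dom_in_Obj: "f \<in> Arr C \<Longrightarrow> Dom C f \<in> Obj C"
    and Cod_in_Obj: "f \<in> Arr C \<Longrightarrow> Cod C f \<in> Obj C"
    and Ident_in_Hom: "X \<in> Obj C \<Longrightarrow> Ident C X \<in> Hom C X X"
    and Comp_in_Hom: "\<lbrakk>f \<in> Hom C X Y; g \<in> Hom C Y Z\<rbrakk> \<Longrightarrow> g \<bullet> f \<in> Hom C X Z"
    and Comp_assoc: "\<lbrakk>f \<in> Hom C W X; g \<in> Hom C X Y; h \<in> Hom C Y Z\<rbrakk>
          \<Longrightarrow> (h \<bullet> g) \<bullet> f = h \<bullet> (g \<bullet> f)"
    and Ident_Comp: "f \<in> Hom C X Y \<Longrightarrow> Ident C Y \<bullet> f = f"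
    and Comp_Ident: "f \<in> Hom C X Y \<Longrightarrow> f \<bullet> Ident C X = f"

definition inverse_arrows :: "('o, 'm, 'z) category_scheme \<Rightarrow> 'o \<Rightarrow> 'o \<Rightarrow> 'm \<Rightarrow> 'm \<Rightarrow> bool" where
  "inverse_arrows C X Y f g \<longleftrightarrow> f \<in> Hom C X Y \<and> g \<in> Hom C Y X \<and>
     g \<bullet>\<^bsub>C\<^esub> f = Ident C X \<and> f \<bullet>\<^bsub>C\<^esub> g = Ident C Y"

definition iso_arrow :: "('o, 'm, 'z) category_scheme \<Rightarrow> 'o \<Rightarrow> 'o \<Rightarrow> 'm \<Rightarrow> bool" where
  "iso_arrow C X Y f \<longleftrightarrow> (\<exists>g. inverse_arrows C X Y f g)"

definition Inverse :: "('o, 'm, 'z) category_scheme \<Rightarrow> 'm \<Rightarrow> 'm" where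
  "Inverse C f = (THE g. inverse_arrows C (Dom C f) (Cod C f) f g)"

subsection \<open>Limits\<close>

definition is_functor :: "('j, 'k, 'y) category_scheme \<Rightarrow> ('o, 'm, 'z) category_scheme
    \<Rightarrow> ('j \<Rightarrow> 'o) \<Rightarrow> ('k \<Rightarrow> 'm) \<Rightarrow> bool" where
  "is_functor J C Fo Fa \<longleftrightarrow>
     (\<forall>j \<in> Obj J. Fo j \<in> Obj C \<and> Fa (Ident J j) = Ident C (Fo j)) \<and>
     (\<forall>u \<in> Arr J. Fa u \<in> Hom C (Fo (Dom J u)) (Fo (Cod J u))) \<and>
     (\<forall>u \<in> Arr J. \<forall>v \<in> Arr J. Dom J v = Cod J u \<longrightarrow> Fa (v \<bullet>\<^bsub>J\<^esub> u) = Fa v \<bullet>\<^bsub>C\<^esub> Fa u)"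

definition cone :: "('j, 'k, 'y) category_scheme \<Rightarrow> ('o, 'm, 'z) category_scheme
    \<Rightarrow> ('j \<Rightarrow> 'o) \<Rightarrow> ('k \<Rightarrow> 'm) \<Rightarrow> 'o \<Rightarrow> ('j \<Rightarrow> 'm) \<Rightarrow> bool" where
  "cone J C Fo Fa L p \<longleftrightarrow> L \<in> Obj C \<and> (\<forall>j \<in> Obj J. p j \<in> Hom C L (Fo j)) \<and>
     (\<forall>u \<in> Arr J. Fa u \<bullet>\<^bsub>C\<^esub> p (Dom J u) = p (Cod J u))"

definition limit_cone :: "('j, 'k, 'y) category_scheme \<Rightarrow> ('o, 'm, 'z) category_scheme
    \<Rightarrow> ('j \<Rightarrow> 'o) \<Rightarrow> ('k \<Rightarrow> 'm) \<Rightarrow> 'o \<Rightarrow> ('j \<Rightarrow> 'm) \<Rightarrow> bool" where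
  "limit_cone J C Fo Fa L p \<longleftrightarrow> cone J C Fo Fa L p \<and>
     (\<forall>L' p'. cone J C Fo Fa L' p' \<longrightarrow>
        (\<exists>!h. h \<in> Hom C L' L \<and> (\<forall>j \<in> Obj J. p j \<bullet>\<^bsub>C\<^esub> h = p' j)))"

text \<open>Every finite category is isomorphic to one whose objects and arrows are natural numbers,
  so it suffices to let the diagram shapes range over these.\<close>

definition has_finite_limits :: "('o, 'm, 'z) category_scheme \<Rightarrow> bool" where
  "has_finite_limits C \<longleftrightarrow>
     (\<forall>(J :: (nat, nat) category) Fo Fa.
        category J \<and> finite (Obj J) \<and> finite (Arr J) \<and> is_functor J C Fo Fa \<longrightarrow>
        (\<exists>L p. limit_cone J C Fo Fa L p))"

definition is_pullback :: "('o, 'm, 'z) category_scheme \<Rightarrow> 'm \<Rightarrow> 'm \<Rightarrow> 'o \<Rightarrow> 'm \<Rightarrow> 'm \<Rightarrow> bool" where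
  "is_pullback C f g P b0 b1 \<longleftrightarrow>
     f \<in> Arr C \<and> g \<in> Arr C \<and> Cod C f = Cod C g \<and>
     b0 \<in> Hom C P (Dom C f) \<and> b1 \<in> Hom C P (Dom C g) \<and> f \<bullet>\<^bsub>C\<^esub> b0 = g \<bullet>\<^bsub>C\<^esub> b1 \<and>
     (\<forall>Q c0 c1. c0 \<in> Hom C Q (Dom C f) \<and> c1 \<in> Hom C Q (Dom C g) \<and> f \<bullet>\<^bsub>C\<^esub> c0 = g \<bullet>\<^bsub>C\<^esub> c1 \<longrightarrow>
        (\<exists>!h. h \<in> Hom C Q P \<and> b0 \<bullet>\<^bsub>C\<^esub> h = c0 \<and> b1 \<bullet>\<^bsub>C\<^esub> h = c1))"

section \<open>Cartesian left-additive categories\<close>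

record ('o, 'm) cartesian_category = "('o, 'm) category" +
  Term :: 'o
  Prod :: "'o \<Rightarrow> 'o \<Rightarrow> 'o"  (infixr "\<times>\<^sub>o\<index>" 80)
  Proj0 :: "'o \<Rightarrow> 'o \<Rightarrow> 'm"
  Proj1 :: "'o \<Rightarrow> 'o \<Rightarrow> 'm"

locale cartesian_category = category C for C (structure) +
  assumes Term_in_Obj: "Term C \<in> Obj C"
    and Term_universal: "X \<in> Obj C \<Longrightarrow> \<exists>!h. h \<in> Hom C X (Term C)"
    and Prod_in_Obj: "\<lbrakk>X \<in> Obj C; Y \<in> Obj C\<rbrakk> \<Longrightarrow> X \<times>\<^sub>o Y \<in> Obj C"
    and Proj0_in_Hom: "\<lbrakk>X \<in> Obj C; Y \<in> Obj C\<rbrakk> \<Longrightarrow> Proj0 C X Y \<in> Hom C (X \<times>\<^sub>o Y) X"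
    and Proj1_in_Hom: "\<lbrakk>X \<in> Obj C; Y \<in> Obj C\<rbrakk> \<Longrightarrow> Proj1 C X Y \<in> Hom C (X \<times>\<^sub>o Y) Y"
    and Prod_universal: "\<lbrakk>f \<in> Hom C W X; g \<in> Hom C W Y\<rbrakk>
          \<Longrightarrow> \<exists>!h. h \<in> Hom C W (X \<times>\<^sub>o Y) \<and> Proj0 C X Y \<bullet> h = f \<and> Proj1 C X Y \<bullet> h = g"

definition Bang :: "('o, 'm, 'z) cartesian_category_scheme \<Rightarrow> 'o \<Rightarrow> 'm" where
  "Bang C X = (THE h. h \<in> Hom C X (Term C))"

definition Pairing :: "('o, 'm, 'z) cartesian_category_scheme \<Rightarrow> 'm \<Rightarrow> 'm \<Rightarrow> 'm"
    ("\<langle>_, _\<rangle>\<index>") where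
  "\<langle>f, g\<rangle>\<^bsub>C\<^esub> = (THE h. h \<in> Hom C (Dom C f) (Cod C f \<times>\<^sub>o\<^bsub>C\<^esub> Cod C g) \<and>
     Proj0 C (Cod C f) (Cod C g) \<bullet>\<^bsub>C\<^esub> h = f \<and> Proj1 C (Cod C f) (Cod C g) \<bullet>\<^bsub>C\<^esub> h = g)"

definition Cross :: "('o, 'm, 'z) cartesian_category_scheme \<Rightarrow> 'm \<Rightarrow> 'm \<Rightarrow> 'm"
    (infixr "\<times>\<^sub>a\<index>" 80) where
  "f \<times>\<^sub>a\<^bsub>C\<^esub> g = \<langle>f \<bullet>\<^bsub>C\<^esub> Proj0 C (Dom C f) (Dom C g), g \<bullet>\<^bsub>C\<^esub> Proj1 C (Dom C f) (Dom C g)\<rangle>\<^bsub>C\<^esub>"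

definition Diag :: "('o, 'm, 'z) cartesian_category_scheme \<Rightarrow> 'o \<Rightarrow> 'm" where
  "Diag C X = \<langle>Ident C X, Ident C X\<rangle>\<^bsub>C\<^esub>"

definition prod_assoc :: "('o, 'm, 'z) cartesian_category_scheme \<Rightarrow> 'o \<Rightarrow> 'o \<Rightarrow> 'o \<Rightarrow> 'm" where
  "prod_assoc C X Y Z =
     \<langle>Proj0 C X Y \<bullet>\<^bsub>C\<^esub> Proj0 C (X \<times>\<^sub>o\<^bsub>C\<^esub> Y) Z,
      \<langle>Proj1 C X Y \<bullet>\<^bsub>C\<^esub> Proj0 C (X \<times>\<^sub>o\<^bsub>C\<^esub> Y) Z, Proj1 C (X \<times>\<^sub>o\<^bsub>C\<^esub> Y) Z\<rangle>\<^bsub>C\<^esub>\<rangle>\<^bsub>C\<^esub>"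

definition prod_swap :: "('o, 'm, 'z) cartesian_category_scheme \<Rightarrow> 'o \<Rightarrow> 'o \<Rightarrow> 'm" where
  "prod_swap C X Y = \<langle>Proj1 C X Y, Proj0 C X Y\<rangle>\<^bsub>C\<^esub>"

record ('o, 'm) left_additive_category = "('o, 'm) cartesian_category" +
  Add :: "'m \<Rightarrow> 'm \<Rightarrow> 'm"  (infixl "\<^bold>+\<index>" 65)
  Zero :: "'o \<Rightarrow> 'o \<Rightarrow> 'm"

definition inj0 :: "('o, 'm, 'z) left_additive_category_scheme \<Rightarrow> 'o \<Rightarrow> 'o \<Rightarrow> 'm" where
  "inj0 C X Y = \<langle>Ident C X, Zero C X Y\<rangle>\<^bsub>C\<^esub>"

definition inj1 :: "('o, 'm, 'z) left_additive_category_scheme \<Rightarrow> 'o \<Rightarrow> 'o \<Rightarrow> 'm" where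
  "inj1 C X Y = \<langle>Zero C Y X, Ident C Y\<rangle>\<^bsub>C\<^esub>"

locale cartesian_left_additive_category = cartesian_category C for C (structure) +
  assumes Hom_comm_monoid: "\<lbrakk>X \<in> Obj C; Y \<in> Obj C\<rbrakk>
          \<Longrightarrow> comm_monoid \<lparr>carrier = Hom C X Y, mult = Add C, one = Zero C X Y\<rparr>"
    and LA1_Add: "\<lbrakk>h \<in> Hom C X Y; f \<in> Hom C Y Z; g \<in> Hom C Y Z\<rbrakk>
          \<Longrightarrow> (f \<^bold>+ g) \<bullet> h = f \<bullet> h \<^bold>+ g \<bullet> h"
    and LA1_Zero: "\<lbrakk>h \<in> Hom C X Y; Z \<in> Obj C\<rbrakk> \<Longrightarrow> Zero C Y Z \<bullet> h = Zero C X Z"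
    and LA2_Add0: "\<lbrakk>f \<in> Hom C X (Y \<times>\<^sub>o Z); g \<in> Hom C X (Y \<times>\<^sub>o Z); Y \<in> Obj C; Z \<in> Obj C\<rbrakk>
          \<Longrightarrow> Proj0 C Y Z \<bullet> (f \<^bold>+ g) = Proj0 C Y Z \<bullet> f \<^bold>+ Proj0 C Y Z \<bullet> g"
    and LA2_Add1: "\<lbrakk>f \<in> Hom C X (Y \<times>\<^sub>o Z); g \<in> Hom C X (Y \<times>\<^sub>o Z); Y \<in> Obj C; Z \<in> Obj C\<rbrakk>
          \<Longrightarrow> Proj1 C Y Z \<bullet> (f \<^bold>+ g) = Proj1 C Y Z \<bullet> f \<^bold>+ Proj1 C Y Z \<bullet> g"
    and LA2_Zero0: "\<lbrakk>X \<in> Obj C; Y \<in> Obj C; Z \<in> Obj C\<rbrakk>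
          \<Longrightarrow> Proj0 C Y Z \<bullet> Zero C X (Y \<times>\<^sub>o Z) = Zero C X Y"
    and LA2_Zero1: "\<lbrakk>X \<in> Obj C; Y \<in> Obj C; Z \<in> Obj C\<rbrakk>
          \<Longrightarrow> Proj1 C Y Z \<bullet> Zero C X (Y \<times>\<^sub>o Z) = Zero C X Z"

section \<open>Cartesian reverse derivative categories\<close>

record ('o, 'm) reverse_derivative_category = "('o, 'm) left_additive_category" +
  Rev :: "'m \<Rightarrow> 'm"

definition Deriv :: "('o, 'm, 'z) reverse_derivative_category_scheme \<Rightarrow> 'm \<Rightarrow> 'm" where
  "Deriv C f = Proj1 C (Dom C f) (Cod C f) \<bullet>\<^bsub>C\<^esub> Rev C (Rev C f) \<bullet>\<^bsub>C\<^esub>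
     (\<langle>Ident C (Dom C f), Zero C (Dom C f) (Cod C f)\<rangle>\<^bsub>C\<^esub> \<times>\<^sub>a\<^bsub>C\<^esub> Ident C (Dom C f))"

locale cartesian_reverse_derivative_category =
  cartesian_left_additive_category C for C (structure) +
  assumes Rev_in_Hom: "f \<in> Hom C X Y \<Longrightarrow> Rev C f \<in> Hom C (X \<times>\<^sub>o Y) X"
    and RD1_Add: "\<lbrakk>f \<in> Hom C X Y; g \<in> Hom C X Y\<rbrakk> \<Longrightarrow> Rev C (f \<^bold>+ g) = Rev C f \<^bold>+ Rev C g"
    and RD1_Zero: "\<lbrakk>X \<in> Obj C; Y \<in> Obj C\<rbrakk> \<Longrightarrow> Rev C (Zero C X Y) = Zero C (X \<times>\<^sub>o Y) X"
    and RD2_Add: "\<lbrakk>f \<in> Hom C X Y; a \<in> Hom C W X; b \<in> Hom C W Y; c \<in> Hom C W Y\<rbrakk>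
          \<Longrightarrow> Rev C f \<bullet> \<langle>a, b \<^bold>+ c\<rangle> = Rev C f \<bullet> \<langle>a, b\<rangle> \<^bold>+ Rev C f \<bullet> \<langle>a, c\<rangle>"
    and RD2_Zero: "\<lbrakk>f \<in> Hom C X Y; a \<in> Hom C W X\<rbrakk> \<Longrightarrow> Rev C f \<bullet> \<langle>a, Zero C W Y\<rangle> = Zero C W X"
    and RD3_Ident: "X \<in> Obj C \<Longrightarrow> Rev C (Ident C X) = Proj1 C X X"
    and RD3_Proj0: "\<lbrakk>X \<in> Obj C; Y \<in> Obj C\<rbrakk>
          \<Longrightarrow> Rev C (Proj0 C X Y) = inj0 C X Y \<bullet> Proj1 C (X \<times>\<^sub>o Y) X"
    and RD3_Proj1: "\<lbrakk>X \<in> Obj C; Y \<in> Obj C\<rbrakk>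
          \<Longrightarrow> Rev C (Proj1 C X Y) = inj1 C X Y \<bullet> Proj1 C (X \<times>\<^sub>o Y) Y"
    and RD4_Pairing: "\<lbrakk>f \<in> Hom C X Y; g \<in> Hom C X Z\<rbrakk>
          \<Longrightarrow> Rev C \<langle>f, g\<rangle> = Rev C f \<bullet> (Ident C X \<times>\<^sub>a Proj0 C Y Z) \<^bold>+ Rev C g \<bullet> (Ident C X \<times>\<^sub>a Proj1 C Y Z)"
    and RD4_Bang: "X \<in> Obj C \<Longrightarrow> Rev C (Bang C X) = Zero C (X \<times>\<^sub>o Term C) X"
    and RD5: "\<lbrakk>f \<in> Hom C X Y; g \<in> Hom C Y Z\<rbrakk>
          \<Longrightarrow> Rev C (g \<bullet> f) =
              Rev C f \<bullet> (Ident C X \<times>\<^sub>a Rev C g) \<bullet> \<langle>Proj0 C X Z, \<langle>f \<bullet> Proj0 C X Z, Proj1 C X Z\<rangle>\<rangle>"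
    and RD6: "f \<in> Hom C X Y
          \<Longrightarrow> Deriv C (Rev C f) \<bullet> \<langle>Ident C X \<times>\<^sub>a Proj0 C Y Y, Zero C X X \<times>\<^sub>a Proj1 C Y Y\<rangle> =
              Rev C f \<bullet> (Ident C X \<times>\<^sub>a Proj1 C Y Y)"
    and RD7: "f \<in> Hom C X Y
          \<Longrightarrow> Deriv C (Deriv C f) =
              Deriv C (Deriv C f) \<bullet>
                \<langle>Proj0 C X X \<times>\<^sub>a Proj0 C X X, Proj1 C X X \<times>\<^sub>a Proj1 C X X\<rangle>"

definition linear_map :: "('o, 'm, 'z) reverse_derivative_category_scheme \<Rightarrow> 'm \<Rightarrow> bool" where
  "linear_map C f \<longleftrightarrow> f \<in> Arr C \<and> Deriv C f = f \<bullet>\<^bsub>C\<^esub> Proj1 C (Dom C f) (Dom C f)"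

definition Lin :: "('o, 'm, 'z) reverse_derivative_category_scheme \<Rightarrow> ('o, 'm) category" where
  "Lin C = \<lparr>Obj = Obj C, Arr = {f. linear_map C f}, Dom = Dom C, Cod = Cod C,
            Ident = Ident C, Comp = Comp C\<rparr>"

section \<open>Optimization domains\<close>

text \<open>Only the values of \<open>PMult\<close> and \<open>POne\<close> on points, i.e. arrows out of the terminal object,
  are relevant; \<open>PLe\<close> is the order relation on the points of the distinguished object.\<close>

record ('o, 'm) optimization_domain = "('o, 'm) reverse_derivative_category" +
  PMult :: "'m \<Rightarrow> 'm \<Rightarrow> 'm"
  POne :: "'o \<Rightarrow> 'm"
  PLe :: "('m \<times> 'm) set"

definition point_ring :: "('o, 'm, 'z) optimization_domain_scheme \<Rightarrow> 'o \<Rightarrow> 'm ring" where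
  "point_ring C X = \<lparr>carrier = Hom C (Term C) X, mult = PMult C, one = POne C X,
                     zero = Zero C (Term C) X, add = Add C\<rparr>"

locale optimization_domain = cartesian_reverse_derivative_category C for C (structure) +
  fixes R
  assumes R_in_Obj: "R \<in> Obj C"
    and additive_inverse: "f \<in> Hom C X Y \<Longrightarrow> \<exists>g \<in> Hom C X Y. f \<^bold>+ g = Zero C X Y"
    and point_ring_cring: "X \<in> Obj C \<Longrightarrow> cring (point_ring C X)"
    and PLe_linear_order: "linear_order_on (Hom C (Term C) R) (PLe C)"
    and PLe_Add: "\<lbrakk>(a, b) \<in> PLe C; c \<in> Hom C (Term C) R\<rbrakk> \<Longrightarrow> (a \<^bold>+ c, b \<^bold>+ c) \<in> PLe C"
    and PLe_PMult: "\<lbrakk>(Zero C (Term C) R, a) \<in> PLe C; (Zero C (Term C) R, b) \<in> PLe C\<rbrakk>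
          \<Longrightarrow> (Zero C (Term C) R, PMult C a b) \<in> PLe C"

section \<open>The lax monoidal functor of objectives\<close>

text \<open>The functor \<open>O\<close> to sets, its action on linear maps, its laxator and its unit. Maps
  from a one-point set are identified with the elements they select.\<close>

definition O_obj :: "('o, 'm, 'z) optimization_domain_scheme \<Rightarrow> 'o \<Rightarrow> 'o \<Rightarrow> 'm set" where
  "O_obj C R X = Hom C X R"

definition O_map :: "('o, 'm, 'z) optimization_domain_scheme \<Rightarrow> 'm \<Rightarrow> 'm \<Rightarrow> 'm" where
  "O_map C \<phi> f = f \<bullet>\<^bsub>C\<^esub> \<phi>"

definition O_lax :: "('o, 'm, 'z) optimization_domain_scheme \<Rightarrow> 'o \<Rightarrow> 'o \<Rightarrow> 'm \<times> 'm \<Rightarrow> 'm" where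
  "O_lax C X Y = (\<lambda>(f, g). f \<bullet>\<^bsub>C\<^esub> Proj0 C X Y \<^bold>+\<^bsub>C\<^esub> g \<bullet>\<^bsub>C\<^esub> Proj1 C X Y)"

definition O_unit :: "('o, 'm, 'z) optimization_domain_scheme \<Rightarrow> 'o \<Rightarrow> 'm" where
  "O_unit C R = Zero C (Term C) R"

definition id_decoration :: "('o, 'm, 'z) optimization_domain_scheme \<Rightarrow> 'o \<Rightarrow> 'o \<Rightarrow> 'm" where
  "id_decoration C R N = O_map C (Bang C N) (O_unit C R)"

section \<open>Open objectives\<close>

record ('o, 'm) open_objective =
  apex :: 'o
  lleg :: 'm
  rleg :: 'm
  objective :: 'm

definition open_objectives :: "('o, 'm, 'z) optimization_domain_scheme \<Rightarrow> 'o \<Rightarrow> 'o \<Rightarrow> 'o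
    \<Rightarrow> ('o, 'm) open_objective set" where
  "open_objectives C R X Y = {s. apex s \<in> Obj C \<and>
     lleg s \<in> Hom (Lin C) (apex s) X \<and> rleg s \<in> Hom (Lin C) (apex s) Y \<and>
     objective s \<in> O_obj C R (apex s)}"

definition objective_iso :: "('o, 'm, 'z) optimization_domain_scheme \<Rightarrow> 'o \<Rightarrow> 'o \<Rightarrow> 'o
    \<Rightarrow> (('o, 'm) open_objective \<times> ('o, 'm) open_objective) set" where
  "objective_iso C R X Y = {(s, t). s \<in> open_objectives C R X Y \<and> t \<in> open_objectives C R X Y \<and>
     (\<exists>n. iso_arrow (Lin C) (apex s) (apex t) n \<and>
          lleg t \<bullet>\<^bsub>C\<^esub> n = lleg s \<and> rleg t \<bullet>\<^bsub>C\<^esub> n = rleg s \<and>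
          O_map C n (objective t) = objective s)}"

definition objective_class :: "('o, 'm, 'z) optimization_domain_scheme \<Rightarrow> 'o \<Rightarrow> 'o \<Rightarrow> 'o
    \<Rightarrow> ('o, 'm) open_objective \<Rightarrow> ('o, 'm) open_objective set" where
  "objective_class C R X Y s = objective_iso C R X Y `` {s}"

text \<open>The composite of \<open>s\<close> followed by \<open>t\<close> along a pullback \<open>(P, b0, b1)\<close> of the right leg of
  \<open>s\<close> and the left leg of \<open>t\<close>.\<close>

definition objective_comp :: "('o, 'm, 'z) optimization_domain_scheme
    \<Rightarrow> ('o, 'm) open_objective \<Rightarrow> ('o, 'm) open_objective \<Rightarrow> 'o \<Rightarrow> 'm \<Rightarrow> 'm
    \<Rightarrow> ('o, 'm) open_objective" where
  "objective_comp C s t P b0 b1 =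
     \<lparr>apex = P, lleg = lleg s \<bullet>\<^bsub>C\<^esub> b0, rleg = rleg t \<bullet>\<^bsub>C\<^esub> b1,
      objective = O_map C \<langle>b0, b1\<rangle>\<^bsub>C\<^esub> (O_lax C (apex s) (apex t) (objective s, objective t))\<rparr>"

definition objective_tensor :: "('o, 'm, 'z) optimization_domain_scheme
    \<Rightarrow> ('o, 'm) open_objective \<Rightarrow> ('o, 'm) open_objective \<Rightarrow> ('o, 'm) open_objective" where
  "objective_tensor C s t =
     \<lparr>apex = apex s \<times>\<^sub>o\<^bsub>C\<^esub> apex t, lleg = lleg s \<times>\<^sub>a\<^bsub>C\<^esub> lleg t, rleg = rleg s \<times>\<^sub>a\<^bsub>C\<^esub> rleg t,
      objective = O_lax C (apex s) (apex t) (objective s, objective t)\<rparr>"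

text \<open>The span \<open>X \<leftarrow> N \<rightarrow> Y\<close> with legs \<open>l\<close>, \<open>r\<close> and the identity decoration, up to isomorphism.\<close>

definition span_class :: "('o, 'm, 'z) optimization_domain_scheme \<Rightarrow> 'o \<Rightarrow> 'o \<Rightarrow> 'o
    \<Rightarrow> 'o \<Rightarrow> 'm \<Rightarrow> 'm \<Rightarrow> ('o, 'm) open_objective set" where
  "span_class C R X Y N l r =
     objective_class C R X Y \<lparr>apex = N, lleg = l, rleg = r, objective = id_decoration C R N\<rparr>"

section \<open>Hypergraph categories\<close>

record ('o, 'm) symmetric_monoidal_category = "('o, 'm) category" +
  MUnit :: 'o
  TObj :: "'o \<Rightarrow> 'o \<Rightarrow> 'o"  (infixr "\<otimes>\<^sub>o\<index>" 80)
  TArr :: "'m \<Rightarrow> 'm \<Rightarrow> 'm"  (infixr "\<otimes>\<^sub>a\<index>" 80)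
  Assoc :: "'o \<Rightarrow> 'o \<Rightarrow> 'o \<Rightarrow> 'm"
  LUnit :: "'o \<Rightarrow> 'm"
  RUnit :: "'o \<Rightarrow> 'm"
  Braid :: "'o \<Rightarrow> 'o \<Rightarrow> 'm"

locale symmetric_monoidal_category = category C for C (structure) +
  assumes MUnit_in_Obj: "MUnit C \<in> Obj C"
    and TObj_in_Obj: "\<lbrakk>X \<in> Obj C; Y \<in> Obj C\<rbrakk> \<Longrightarrow> X \<otimes>\<^sub>o Y \<in> Obj C"
    and TArr_in_Hom: "\<lbrakk>f \<in> Hom C X X'; g \<in> Hom C Y Y'\<rbrakk>
          \<Longrightarrow> f \<otimes>\<^sub>a g \<in> Hom C (X \<otimes>\<^sub>o Y) (X' \<otimes>\<^sub>o Y')"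
    and TArr_Ident: "\<lbrakk>X \<in> Obj C; Y \<in> Obj C\<rbrakk> \<Longrightarrow> Ident C X \<otimes>\<^sub>a Ident C Y = Ident C (X \<otimes>\<^sub>o Y)"
    and TArr_Comp: "\<lbrakk>f \<in> Hom C X X'; f' \<in> Hom C X' X''; g \<in> Hom C Y Y'; g' \<in> Hom C Y' Y''\<rbrakk>
          \<Longrightarrow> (f' \<bullet> f) \<otimes>\<^sub>a (g' \<bullet> g) = (f' \<otimes>\<^sub>a g') \<bullet> (f \<otimes>\<^sub>a g)"
    and Assoc_iso: "\<lbrakk>X \<in> Obj C; Y \<in> Obj C; Z \<in> Obj C\<rbrakk>
          \<Longrightarrow> iso_arrow C ((X \<otimes>\<^sub>o Y) \<otimes>\<^sub>o Z) (X \<otimes>\<^sub>o (Y \<otimes>\<^sub>o Z)) (Assoc C X Y Z)"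
    and Assoc_natural: "\<lbrakk>f \<in> Hom C X X'; g \<in> Hom C Y Y'; h \<in> Hom C Z Z'\<rbrakk>
          \<Longrightarrow> Assoc C X' Y' Z' \<bullet> ((f \<otimes>\<^sub>a g) \<otimes>\<^sub>a h) = (f \<otimes>\<^sub>a (g \<otimes>\<^sub>a h)) \<bullet> Assoc C X Y Z"
    and LUnit_iso: "X \<in> Obj C \<Longrightarrow> iso_arrow C (MUnit C \<otimes>\<^sub>o X) X (LUnit C X)"
    and LUnit_natural: "f \<in> Hom C X Y
          \<Longrightarrow> LUnit C Y \<bullet> (Ident C (MUnit C) \<otimes>\<^sub>a f) = f \<bullet> LUnit C X"
    and RUnit_iso: "X \<in> Obj C \<Longrightarrow> iso_arrow C (X \<otimes>\<^sub>o MUnit C) X (RUnit C X)"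
    and RUnit_natural: "f \<in> Hom C X Y
          \<Longrightarrow> RUnit C Y \<bullet> (f \<otimes>\<^sub>a Ident C (MUnit C)) = f \<bullet> RUnit C X"
    and pentagon: "\<lbrakk>W \<in> Obj C; X \<in> Obj C; Y \<in> Obj C; Z \<in> Obj C\<rbrakk>
          \<Longrightarrow> Assoc C W X (Y \<otimes>\<^sub>o Z) \<bullet> Assoc C (W \<otimes>\<^sub>o X) Y Z =
              (Ident C W \<otimes>\<^sub>a Assoc C X Y Z) \<bullet> Assoc C W (X \<otimes>\<^sub>o Y) Z \<bullet> (Assoc C W X Y \<otimes>\<^sub>a Ident C Z)"
    and triangle: "\<lbrakk>X \<in> Obj C; Y \<in> Obj C\<rbrakk>
          \<Longrightarrow> (Ident C X \<otimes>\<^sub>a LUnit C Y) \<bullet> Assoc C X (MUnit C) Y = RUnit C X \<otimes>\<^sub>a Ident C Y"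
    and Braid_in_Hom: "\<lbrakk>X \<in> Obj C; Y \<in> Obj C\<rbrakk> \<Longrightarrow> Braid C X Y \<in> Hom C (X \<otimes>\<^sub>o Y) (Y \<otimes>\<^sub>o X)"
    and Braid_natural: "\<lbrakk>f \<in> Hom C X X'; g \<in> Hom C Y Y'\<rbrakk>
          \<Longrightarrow> Braid C X' Y' \<bullet> (f \<otimes>\<^sub>a g) = (g \<otimes>\<^sub>a f) \<bullet> Braid C X Y"
    and Braid_Braid: "\<lbrakk>X \<in> Obj C; Y \<in> Obj C\<rbrakk>
          \<Longrightarrow> Braid C Y X \<bullet> Braid C X Y = Ident C (X \<otimes>\<^sub>o Y)"
    and hexagon: "\<lbrakk>X \<in> Obj C; Y \<in> Obj C; Z \<in> Obj C\<rbrakk>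
          \<Longrightarrow> Assoc C Y Z X \<bullet> Braid C X (Y \<otimes>\<^sub>o Z) \<bullet> Assoc C X Y Z =
              (Ident C Y \<otimes>\<^sub>a Braid C X Z) \<bullet> Assoc C Y X Z \<bullet> (Braid C X Y \<otimes>\<^sub>a Ident C Z)"

text \<open>The middle-four interchange \<open>(W \<otimes> X) \<otimes> (Y \<otimes> Z) \<rightarrow> (W \<otimes> Y) \<otimes> (X \<otimes> Z)\<close>.\<close>

definition interchange :: "('o, 'm, 'z) symmetric_monoidal_category_scheme
    \<Rightarrow> 'o \<Rightarrow> 'o \<Rightarrow> 'o \<Rightarrow> 'o \<Rightarrow> 'm" where
  "interchange C W X Y Z =
     Inverse C (Assoc C W Y (X \<otimes>\<^sub>o\<^bsub>C\<^esub> Z)) \<bullet>\<^bsub>C\<^esub>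
     (Ident C W \<otimes>\<^sub>a\<^bsub>C\<^esub>
        (Assoc C Y X Z \<bullet>\<^bsub>C\<^esub> (Braid C X Y \<otimes>\<^sub>a\<^bsub>C\<^esub> Ident C Z) \<bullet>\<^bsub>C\<^esub> Inverse C (Assoc C X Y Z))) \<bullet>\<^bsub>C\<^esub>
     Assoc C W X (Y \<otimes>\<^sub>o\<^bsub>C\<^esub> Z)"

record ('o, 'm) hypergraph_category = "('o, 'm) symmetric_monoidal_category" +
  Mu :: "'o \<Rightarrow> 'm"
  Eta :: "'o \<Rightarrow> 'm"
  Delta :: "'o \<Rightarrow> 'm"
  Epsilon :: "'o \<Rightarrow> 'm"

text \<open>Compatibility with the monoidal product covers both the binary product and the monoidal
  unit, whose Frobenius structure has to be the canonical one.\<close>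

locale hypergraph_category = symmetric_monoidal_category C for C (structure) +
  assumes Mu_in_Hom: "X \<in> Obj C \<Longrightarrow> Mu C X \<in> Hom C (X \<otimes>\<^sub>o X) X"
    and Eta_in_Hom: "X \<in> Obj C \<Longrightarrow> Eta C X \<in> Hom C (MUnit C) X"
    and Delta_in_Hom: "X \<in> Obj C \<Longrightarrow> Delta C X \<in> Hom C X (X \<otimes>\<^sub>o X)"
    and Epsilon_in_Hom: "X \<in> Obj C \<Longrightarrow> Epsilon C X \<in> Hom C X (MUnit C)"
    and Mu_assoc: "X \<in> Obj C \<Longrightarrow>
          Mu C X \<bullet> (Mu C X \<otimes>\<^sub>a Ident C X) = Mu C X \<bullet> (Ident C X \<otimes>\<^sub>a Mu C X) \<bullet> Assoc C X X X"
    and Mu_unit_left: "X \<in> Obj C \<Longrightarrow> Mu C X \<bullet> (Eta C X \<otimes>\<^sub>a Ident C X) = LUnit C X"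
    and Mu_unit_right: "X \<in> Obj C \<Longrightarrow> Mu C X \<bullet> (Ident C X \<otimes>\<^sub>a Eta C X) = RUnit C X"
    and Mu_comm: "X \<in> Obj C \<Longrightarrow> Mu C X \<bullet> Braid C X X = Mu C X"
    and Delta_coassoc: "X \<in> Obj C \<Longrightarrow>
          Assoc C X X X \<bullet> (Delta C X \<otimes>\<^sub>a Ident C X) \<bullet> Delta C X = (Ident C X \<otimes>\<^sub>a Delta C X) \<bullet> Delta C X"
    and Delta_counit_left: "X \<in> Obj C \<Longrightarrow>
          LUnit C X \<bullet> (Epsilon C X \<otimes>\<^sub>a Ident C X) \<bullet> Delta C X = Ident C X"
    and Delta_counit_right: "X \<in> Obj C \<Longrightarrow>
          RUnit C X \<bullet> (Ident C X \<otimes>\<^sub>a Epsilon C X) \<bullet> Delta C X = Ident C X"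
    and Delta_cocomm: "X \<in> Obj C \<Longrightarrow> Braid C X X \<bullet> Delta C X = Delta C X"
    and Frobenius_left: "X \<in> Obj C \<Longrightarrow>
          (Ident C X \<otimes>\<^sub>a Mu C X) \<bullet> Assoc C X X X \<bullet> (Delta C X \<otimes>\<^sub>a Ident C X) = Delta C X \<bullet> Mu C X"
    and Frobenius_right: "X \<in> Obj C \<Longrightarrow>
          (Mu C X \<otimes>\<^sub>a Ident C X) \<bullet> Inverse C (Assoc C X X X) \<bullet> (Ident C X \<otimes>\<^sub>a Delta C X) =
          Delta C X \<bullet> Mu C X"
    and special: "X \<in> Obj C \<Longrightarrow> Mu C X \<bullet> Delta C X = Ident C X"
    and Mu_tensor: "\<lbrakk>X \<in> Obj C; Y \<in> Obj C\<rbrakk> \<Longrightarrow>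
          Mu C (X \<otimes>\<^sub>o Y) = (Mu C X \<otimes>\<^sub>a Mu C Y) \<bullet> interchange C X Y X Y"
    and Eta_tensor: "\<lbrakk>X \<in> Obj C; Y \<in> Obj C\<rbrakk> \<Longrightarrow>
          Eta C (X \<otimes>\<^sub>o Y) = (Eta C X \<otimes>\<^sub>a Eta C Y) \<bullet> Inverse C (LUnit C (MUnit C))"
    and Delta_tensor: "\<lbrakk>X \<in> Obj C; Y \<in> Obj C\<rbrakk> \<Longrightarrow>
          Delta C (X \<otimes>\<^sub>o Y) = interchange C X X Y Y \<bullet> (Delta C X \<otimes>\<^sub>a Delta C Y)"
    and Epsilon_tensor: "\<lbrakk>X \<in> Obj C; Y \<in> Obj C\<rbrakk> \<Longrightarrow>
          Epsilon C (X \<otimes>\<^sub>o Y) = LUnit C (MUnit C) \<bullet> (Epsilon C X \<otimes>\<^sub>a Epsilon C Y)"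
    and Mu_MUnit: "Mu C (MUnit C) = LUnit C (MUnit C)"
    and Eta_MUnit: "Eta C (MUnit C) = Ident C (MUnit C)"
    and Delta_MUnit: "Delta C (MUnit C) = Inverse C (LUnit C (MUnit C))"
    and Epsilon_MUnit: "Epsilon C (MUnit C) = Ident C (MUnit C)"

end

theory Submission
  imports Defs
begin

text \<open>
  \<open>Opt\<close> is the category of isomorphism classes of spans of linear maps, each carrying an objective
  on its apex. That it is a hypergraph category has three sources.

  First, the products of \<open>C\<close> must restrict to \<open>Lin C\<close>. Projections are linear, and linear maps are
  closed under composition and pairing, because the derivative \<open>D\<close> defined from \<open>R\<close> satisfies the
  chain rule \<open>D[g \<bullet> f] = D[g] \<bullet> \<langle>f \<bullet> \<pi>\<^sub>0, D[f]\<rangle>\<close> (lemma \<open>Deriv_Comp_at\<close>) and the rule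
  \<open>D[\<langle>f, g\<rangle>] = \<langle>D[f], D[g]\<rangle>\<close> (lemma \<open>Deriv_Pairing_at\<close>). Both come out of the axioms RD.1 to RD.5
  by evaluating \<open>R[R[f]]\<close> at points whose covector component vanishes.

  Second, spans compose by pullback. The composite is independent of all choices because pullbacks
  are unique up to isomorphism (\<open>lin_pullback_unique\<close>), it is associative because pullback squares
  paste (\<open>lin_pullback_paste\<close>), and it commutes with the monoidal product because a product of
  pullback squares is a pullback square (\<open>lin_pullback_Cross\<close>). On objectives the composite is
  \<open>f \<bullet> b\<^sub>0 + g \<bullet> b\<^sub>1\<close>; since precomposition distributes over sums, these laws reduce on objectives
  to the laws of a commutative monoid.

  Third, every structure map of \<open>Opt\<close> has objective zero and an identity as one of its legs: it is
  the graph \<open>X = X \<rightarrow> Y\<close> or the cograph \<open>Y \<leftarrow> X = X\<close> of a linear map \<open>a : X \<rightarrow> Y\<close>. Following a span by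
  a graph, or preceding it by a cograph, only composes \<open>a\<close> with a leg (\<open>graph_comp\<close>,
  \<open>comp_cograph\<close>), and the graph of an isomorphism is the cograph of its inverse
  (\<open>graph_eq_cograph_inverse\<close>). So the coherence axioms become equations between arrows of a
  Cartesian category, and each naturality axiom asks for a linear isomorphism of apexes compatible
  with the legs and the objectives (\<open>span_natural\<close>). Between structure maps a genuine pullback
  appears only when a graph is followed by the cograph of a map that is not invertible. This happens
  in the special law, where the diagonal is pulled back along itself (\<open>lin_pullback_Diag\<close>), and in
  the two Frobenius laws, where the two ways of doubling one of two elements agree exactly on the
  diagonal (\<open>lin_pullback_Frobenius\<close>).
\<close>

section \<open>Equational reasoning in categories with finite products\<close>

text \<open>
  The laws are restated with \<open>Dom\<close> and \<open>Cod\<close> in place of \<open>Hom\<close>, so that rewriting computes the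
  domains and codomains in its own side conditions. Associating composites to the right, pushing
  composition into pairings and cancelling projections then decides the equations between
  composites of projections and pairings that occur below.
\<close>

lemma Hom_iff: "f \<in> Hom C X Y \<longleftrightarrow> f \<in> Arr C \<and> Dom C f = X \<and> Cod C f = Y"
  by (simp add: Hom_def)

context category
begin

lemma Dom_Obj [simp]: "f \<in> Arr C \<Longrightarrow> Dom C f \<in> Obj C"
  and Cod_Obj [simp]: "f \<in> Arr C \<Longrightarrow> Cod C f \<in> Obj C"
  by (simp_all add: Dom_in_Obj Cod_in_Obj)

lemma Ident_typing [simp]:
  assumes "X \<in> Obj C"
  shows "Ident C X \<in> Arr C" "Dom C (Ident C X) = X" "Cod C (Ident C X) = X"
  using Ident_in_Hom[OF assms] by (simp_all add: Hom_iff)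

lemma Comp_typing [simp]:
  assumes "f \<in> Arr C" "g \<in> Arr C" "Cod C f = Dom C g"
  shows "g \<bullet> f \<in> Arr C" "Dom C (g \<bullet> f) = Dom C f" "Cod C (g \<bullet> f) = Cod C g"
  using Comp_in_Hom[of f "Dom C f" "Cod C f" g "Cod C g"] assms by (simp_all add: Hom_iff)

lemma Comp_assoc_Arr [simp]:
  "\<lbrakk>f \<in> Arr C; g \<in> Arr C; h \<in> Arr C; Cod C f = Dom C g; Cod C g = Dom C h\<rbrakk>
    \<Longrightarrow> (h \<bullet> g) \<bullet> f = h \<bullet> (g \<bullet> f)"
  by (rule Comp_assoc) (auto simp: Hom_iff)

lemma Ident_Comp_Arr [simp]: "\<lbrakk>f \<in> Arr C; Cod C f = Y\<rbrakk> \<Longrightarrow> Ident C Y \<bullet> f = f"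
  by (rule Ident_Comp) (auto simp: Hom_iff)

lemma Comp_Ident_Arr [simp]: "\<lbrakk>f \<in> Arr C; Dom C f = X\<rbrakk> \<Longrightarrow> f \<bullet> Ident C X = f"
  by (rule Comp_Ident) (auto simp: Hom_iff)

lemma Inverse_eq:
  assumes "inverse_arrows C X Y f g"
  shows "Inverse C f = g"
proof -
  have g: "inverse_arrows C (Dom C f) (Cod C f) f g"
    using assms by (simp add: inverse_arrows_def Hom_iff)
  show ?thesis unfolding Inverse_def
  proof (rule the_equality[where P = "inverse_arrows C (Dom C f) (Cod C f) f", OF g])
    fix h assume h: "inverse_arrows C (Dom C f) (Cod C f) f h"
    have "h = h \<bullet> (f \<bullet> g)" using g h by (simp add: inverse_arrows_def Hom_iff)
    also have "\<dots> = (h \<bullet> f) \<bullet> g"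
      using g h by (intro Comp_assoc_Arr[symmetric]) (simp_all add: inverse_arrows_def Hom_iff)
    also have "\<dots> = g" using g h by (simp add: inverse_arrows_def Hom_iff)
    finally show "h = g" .
  qed
qed

end

context cartesian_category
begin

lemma Prod_Obj [simp]: "\<lbrakk>X \<in> Obj C; Y \<in> Obj C\<rbrakk> \<Longrightarrow> X \<times>\<^sub>o Y \<in> Obj C"
  by (rule Prod_in_Obj)

lemma Term_Obj [simp]: "Term C \<in> Obj C"
  by (rule Term_in_Obj)

lemma Proj_typing [simp]:
  assumes "X \<in> Obj C" "Y \<in> Obj C"
  shows "Proj0 C X Y \<in> Arr C" "Dom C (Proj0 C X Y) = X \<times>\<^sub>o Y" "Cod C (Proj0 C X Y) = X"
    and "Proj1 C X Y \<in> Arr C" "Dom C (Proj1 C X Y) = X \<times>\<^sub>o Y" "Cod C (Proj1 C X Y) = Y"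
  using Proj0_in_Hom[OF assms] Proj1_in_Hom[OF assms] by (simp_all add: Hom_iff)

lemma Pairing_universal:
  assumes "f \<in> Arr C" "g \<in> Arr C" "Dom C f = Dom C g"
  shows "\<langle>f, g\<rangle> \<in> Hom C (Dom C g) (Cod C f \<times>\<^sub>o Cod C g) \<and>
         Proj0 C (Cod C f) (Cod C g) \<bullet> \<langle>f, g\<rangle> = f \<and> Proj1 C (Cod C f) (Cod C g) \<bullet> \<langle>f, g\<rangle> = g"
  using theI'[OF Prod_universal[of f "Dom C f" "Cod C f" g "Cod C g"]] assms
  unfolding Pairing_def by (simp add: Hom_iff)

lemma Pairing_typing [simp]:
  assumes "f \<in> Arr C" "g \<in> Arr C" "Dom C f = Dom C g"
  shows "\<langle>f, g\<rangle> \<in> Arr C" "Dom C \<langle>f, g\<rangle> = Dom C g" "Cod C \<langle>f, g\<rangle> = Cod C f \<times>\<^sub>o Cod C g"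
  using Pairing_universal[OF assms] by (simp_all add: Hom_iff)

lemma Proj_Pairing [simp]:
  assumes "f \<in> Arr C" "g \<in> Arr C" "Dom C f = Dom C g" "Cod C f = X" "Cod C g = Y"
  shows "Proj0 C X Y \<bullet> \<langle>f, g\<rangle> = f" "Proj1 C X Y \<bullet> \<langle>f, g\<rangle> = g"
  using Pairing_universal[of f g] assms by simp_all

lemma Prod_ext:
  assumes "f \<in> Hom C W (X \<times>\<^sub>o Y)" "g \<in> Hom C W (X \<times>\<^sub>o Y)" "X \<in> Obj C" "Y \<in> Obj C"
    and "Proj0 C X Y \<bullet> f = Proj0 C X Y \<bullet> g" "Proj1 C X Y \<bullet> f = Proj1 C X Y \<bullet> g"
  shows "f = g"
proof -
  have "Proj0 C X Y \<bullet> f \<in> Hom C W X" "Proj1 C X Y \<bullet> f \<in> Hom C W Y"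
    using assms by (simp_all add: Hom_iff)
  from Prod_universal[OF this] show ?thesis using assms by (auto elim!: ex1E)
qed

lemma Pairing_Proj_Comp [simp]:
  "\<lbrakk>h \<in> Arr C; Cod C h = X \<times>\<^sub>o Y; X \<in> Obj C; Y \<in> Obj C\<rbrakk>
    \<Longrightarrow> \<langle>Proj0 C X Y \<bullet> h, Proj1 C X Y \<bullet> h\<rangle> = h"
  by (rule Prod_ext[of _ "Dom C h" X Y]) (simp_all add: Hom_iff)

lemma Pairing_Proj [simp]:
  "\<lbrakk>X \<in> Obj C; Y \<in> Obj C\<rbrakk> \<Longrightarrow> \<langle>Proj0 C X Y, Proj1 C X Y\<rangle> = Ident C (X \<times>\<^sub>o Y)"
  using Pairing_Proj_Comp[of "Ident C (X \<times>\<^sub>o Y)" X Y] by simp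

lemma Pairing_Comp [simp]:
  assumes "f \<in> Arr C" "g \<in> Arr C" "Dom C f = Dom C g" "h \<in> Arr C" "Cod C h = Dom C g"
  shows "\<langle>f, g\<rangle> \<bullet> h = \<langle>f \<bullet> h, g \<bullet> h\<rangle>"
proof -
  have "Proj0 C (Cod C f) (Cod C g) \<bullet> (\<langle>f, g\<rangle> \<bullet> h) = f \<bullet> h"
    "Proj1 C (Cod C f) (Cod C g) \<bullet> (\<langle>f, g\<rangle> \<bullet> h) = g \<bullet> h"
    by (subst Comp_assoc_Arr[symmetric]; use assms in simp)+
  then show ?thesis
    using assms by (intro Prod_ext[of "\<langle>f, g\<rangle> \<bullet> h" "Dom C h" "Cod C f" "Cod C g"]) (simp_all add: Hom_iff)
qed

lemma Term_ext:
  "\<lbrakk>f \<in> Arr C; g \<in> Arr C; Dom C f = Dom C g; Cod C f = Term C; Cod C g = Term C\<rbrakk> \<Longrightarrow> f = g"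
  using Term_universal[of "Dom C f"] by (auto simp: Hom_iff)

lemma Bang_typing [simp]:
  assumes "X \<in> Obj C"
  shows "Bang C X \<in> Arr C" "Dom C (Bang C X) = X" "Cod C (Bang C X) = Term C"
  using theI'[OF Term_universal[OF assms]] unfolding Bang_def by (simp_all add: Hom_iff)

lemma Bang_Comp [simp]: "\<lbrakk>f \<in> Arr C; Cod C f = Y\<rbrakk> \<Longrightarrow> Bang C Y \<bullet> f = Bang C (Dom C f)"
  by (rule Term_ext) auto

lemma Cross_Pairing:
  "f \<times>\<^sub>a g = \<langle>f \<bullet> Proj0 C (Dom C f) (Dom C g), g \<bullet> Proj1 C (Dom C f) (Dom C g)\<rangle>"
  by (simp add: Cross_def)

end

section \<open>Structural isomorphisms of products\<close>

context cartesian_category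
begin

definition prod_assoc_inv :: "'a \<Rightarrow> 'a \<Rightarrow> 'a \<Rightarrow> 'b" where
  "prod_assoc_inv X Y Z =
     \<langle>\<langle>Proj0 C X (Y \<times>\<^sub>o Z), Proj0 C Y Z \<bullet> Proj1 C X (Y \<times>\<^sub>o Z)\<rangle>, Proj1 C Y Z \<bullet> Proj1 C X (Y \<times>\<^sub>o Z)\<rangle>"

text \<open>The middle-four interchange, written down by its four components; \<open>prod_interchange_eq\<close>
  identifies it with the composite of associators and a swap that defines it in a symmetric
  monoidal category.\<close>

definition prod_interchange :: "'a \<Rightarrow> 'a \<Rightarrow> 'a \<Rightarrow> 'a \<Rightarrow> 'b" where
  "prod_interchange W X Y Z = \<langle>Proj0 C W X \<times>\<^sub>a Proj0 C Y Z, Proj1 C W X \<times>\<^sub>a Proj1 C Y Z\<rangle>"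

lemma Cross_typing [simp]:
  assumes "f \<in> Arr C" "g \<in> Arr C"
  shows "f \<times>\<^sub>a g \<in> Arr C" "Dom C (f \<times>\<^sub>a g) = Dom C f \<times>\<^sub>o Dom C g" "Cod C (f \<times>\<^sub>a g) = Cod C f \<times>\<^sub>o Cod C g"
  using assms by (simp_all add: Cross_Pairing)

lemma Cross_Ident [simp]: "\<lbrakk>X \<in> Obj C; Y \<in> Obj C\<rbrakk> \<Longrightarrow> Ident C X \<times>\<^sub>a Ident C Y = Ident C (X \<times>\<^sub>o Y)"
  by (simp add: Cross_Pairing)

lemma Diag_typing [simp]:
  assumes "X \<in> Obj C"
  shows "Diag C X \<in> Arr C" "Dom C (Diag C X) = X" "Cod C (Diag C X) = X \<times>\<^sub>o X"
  using assms by (simp_all add: Diag_def)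

lemma prod_assoc_typing [simp]:
  assumes "X \<in> Obj C" "Y \<in> Obj C" "Z \<in> Obj C"
  shows "prod_assoc C X Y Z \<in> Arr C" "Dom C (prod_assoc C X Y Z) = (X \<times>\<^sub>o Y) \<times>\<^sub>o Z"
    "Cod C (prod_assoc C X Y Z) = X \<times>\<^sub>o (Y \<times>\<^sub>o Z)"
  using assms by (simp_all add: prod_assoc_def)

lemma prod_assoc_inv_typing [simp]:
  assumes "X \<in> Obj C" "Y \<in> Obj C" "Z \<in> Obj C"
  shows "prod_assoc_inv X Y Z \<in> Arr C" "Dom C (prod_assoc_inv X Y Z) = X \<times>\<^sub>o (Y \<times>\<^sub>o Z)"
    "Cod C (prod_assoc_inv X Y Z) = (X \<times>\<^sub>o Y) \<times>\<^sub>o Z"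
  using assms by (simp_all add: prod_assoc_inv_def)

lemma prod_swap_typing [simp]:
  assumes "X \<in> Obj C" "Y \<in> Obj C"
  shows "prod_swap C X Y \<in> Arr C" "Dom C (prod_swap C X Y) = X \<times>\<^sub>o Y" "Cod C (prod_swap C X Y) = Y \<times>\<^sub>o X"
  using assms by (simp_all add: prod_swap_def)

lemma prod_interchange_typing [simp]:
  assumes "W \<in> Obj C" "X \<in> Obj C" "Y \<in> Obj C" "Z \<in> Obj C"
  shows "prod_interchange W X Y Z \<in> Arr C" "Dom C (prod_interchange W X Y Z) = (W \<times>\<^sub>o X) \<times>\<^sub>o (Y \<times>\<^sub>o Z)"
    "Cod C (prod_interchange W X Y Z) = (W \<times>\<^sub>o Y) \<times>\<^sub>o (X \<times>\<^sub>o Z)"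
  using assms by (simp_all add: prod_interchange_def)

lemma prod_assoc_inverse:
  assumes "X \<in> Obj C" "Y \<in> Obj C" "Z \<in> Obj C"
  shows "prod_assoc_inv X Y Z \<bullet> prod_assoc C X Y Z = Ident C ((X \<times>\<^sub>o Y) \<times>\<^sub>o Z)"
    and "prod_assoc C X Y Z \<bullet> prod_assoc_inv X Y Z = Ident C (X \<times>\<^sub>o (Y \<times>\<^sub>o Z))"
  using assms by (simp_all add: prod_assoc_def prod_assoc_inv_def)

lemma prod_swap_inverse:
  "\<lbrakk>X \<in> Obj C; Y \<in> Obj C\<rbrakk> \<Longrightarrow> prod_swap C Y X \<bullet> prod_swap C X Y = Ident C (X \<times>\<^sub>o Y)"
  by (simp add: prod_swap_def)

lemma prod_interchange_inverse:
  "\<lbrakk>W \<in> Obj C; X \<in> Obj C; Y \<in> Obj C; Z \<in> Obj C\<rbrakk>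
    \<Longrightarrow> prod_interchange W Y X Z \<bullet> prod_interchange W X Y Z = Ident C ((W \<times>\<^sub>o X) \<times>\<^sub>o (Y \<times>\<^sub>o Z))"
  by (simp add: prod_interchange_def Cross_Pairing)

lemma prod_assoc_natural:
  "\<lbrakk>f \<in> Arr C; g \<in> Arr C; h \<in> Arr C\<rbrakk> \<Longrightarrow>
    prod_assoc C (Cod C f) (Cod C g) (Cod C h) \<bullet> ((f \<times>\<^sub>a g) \<times>\<^sub>a h) =
    (f \<times>\<^sub>a (g \<times>\<^sub>a h)) \<bullet> prod_assoc C (Dom C f) (Dom C g) (Dom C h)"
  by (simp add: prod_assoc_def Cross_Pairing)

lemma prod_swap_natural:
  "\<lbrakk>f \<in> Arr C; g \<in> Arr C\<rbrakk> \<Longrightarrow>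
    prod_swap C (Cod C f) (Cod C g) \<bullet> (f \<times>\<^sub>a g) = (g \<times>\<^sub>a f) \<bullet> prod_swap C (Dom C f) (Dom C g)"
  by (simp add: prod_swap_def Cross_Pairing)

lemma prod_pentagon:
  "\<lbrakk>W \<in> Obj C; X \<in> Obj C; Y \<in> Obj C; Z \<in> Obj C\<rbrakk> \<Longrightarrow>
    prod_assoc C W X (Y \<times>\<^sub>o Z) \<bullet> prod_assoc C (W \<times>\<^sub>o X) Y Z =
    (Ident C W \<times>\<^sub>a prod_assoc C X Y Z) \<bullet> prod_assoc C W (X \<times>\<^sub>o Y) Z \<bullet> (prod_assoc C W X Y \<times>\<^sub>a Ident C Z)"
  by (simp add: prod_assoc_def Cross_Pairing)

lemma prod_triangle:
  "\<lbrakk>X \<in> Obj C; Y \<in> Obj C\<rbrakk> \<Longrightarrow>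
    (Ident C X \<times>\<^sub>a Proj1 C (Term C) Y) \<bullet> prod_assoc C X (Term C) Y = Proj0 C X (Term C) \<times>\<^sub>a Ident C Y"
  by (simp add: prod_assoc_def Cross_Pairing)

lemma prod_hexagon:
  "\<lbrakk>X \<in> Obj C; Y \<in> Obj C; Z \<in> Obj C\<rbrakk> \<Longrightarrow>
    prod_assoc C Y Z X \<bullet> prod_swap C X (Y \<times>\<^sub>o Z) \<bullet> prod_assoc C X Y Z =
    (Ident C Y \<times>\<^sub>a prod_swap C X Z) \<bullet> prod_assoc C Y X Z \<bullet> (prod_swap C X Y \<times>\<^sub>a Ident C Z)"
  by (simp add: prod_assoc_def prod_swap_def Cross_Pairing)

lemma prod_interchange_eq:
  "\<lbrakk>W \<in> Obj C; X \<in> Obj C; Y \<in> Obj C; Z \<in> Obj C\<rbrakk> \<Longrightarrow>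
    prod_assoc_inv W Y (X \<times>\<^sub>o Z) \<bullet>
      (Ident C W \<times>\<^sub>a (prod_assoc C Y X Z \<bullet> (prod_swap C X Y \<times>\<^sub>a Ident C Z) \<bullet> prod_assoc_inv X Y Z)) \<bullet>
      prod_assoc C W X (Y \<times>\<^sub>o Z) =
    prod_interchange W X Y Z"
  by (simp add: prod_assoc_def prod_assoc_inv_def prod_swap_def prod_interchange_def Cross_Pairing)

lemma Diag_coassoc:
  "X \<in> Obj C \<Longrightarrow>
    prod_assoc C X X X \<bullet> (Diag C X \<times>\<^sub>a Ident C X) \<bullet> Diag C X = (Ident C X \<times>\<^sub>a Diag C X) \<bullet> Diag C X"
  by (simp add: prod_assoc_def Diag_def Cross_Pairing)

lemma Diag_coassoc_inv:
  "X \<in> Obj C \<Longrightarrow>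
    prod_assoc_inv X X X \<bullet> (Ident C X \<times>\<^sub>a Diag C X) \<bullet> Diag C X = (Diag C X \<times>\<^sub>a Ident C X) \<bullet> Diag C X"
  by (simp add: prod_assoc_inv_def Diag_def Cross_Pairing)

lemma Diag_cocomm: "X \<in> Obj C \<Longrightarrow> prod_swap C X X \<bullet> Diag C X = Diag C X"
  by (simp add: prod_swap_def Diag_def)

lemma Diag_counit:
  assumes "X \<in> Obj C"
  shows "(Bang C X \<times>\<^sub>a Ident C X) \<bullet> Diag C X = \<langle>Bang C X, Ident C X\<rangle>"
    and "(Ident C X \<times>\<^sub>a Bang C X) \<bullet> Diag C X = \<langle>Ident C X, Bang C X\<rangle>"
  using assms by (simp_all add: Diag_def Cross_Pairing)

lemma Diag_Prod:
  "\<lbrakk>X \<in> Obj C; Y \<in> Obj C\<rbrakk> \<Longrightarrow>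
    prod_interchange X X Y Y \<bullet> (Diag C X \<times>\<^sub>a Diag C Y) = Diag C (X \<times>\<^sub>o Y)"
  by (simp add: prod_interchange_def Diag_def Cross_Pairing)

lemma Term_iso:
  assumes "X \<in> Obj C"
  shows "\<langle>Bang C X, Ident C X\<rangle> \<bullet> Proj1 C (Term C) X = Ident C (Term C \<times>\<^sub>o X)"
    and "\<langle>Ident C X, Bang C X\<rangle> \<bullet> Proj0 C X (Term C) = Ident C (X \<times>\<^sub>o Term C)"
proof -
  have "Bang C (Term C \<times>\<^sub>o X) = Proj0 C (Term C) X" "Bang C (X \<times>\<^sub>o Term C) = Proj1 C X (Term C)"
    using assms by (auto intro: Term_ext)
  then show "\<langle>Bang C X, Ident C X\<rangle> \<bullet> Proj1 C (Term C) X = Ident C (Term C \<times>\<^sub>o X)"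
    and "\<langle>Ident C X, Bang C X\<rangle> \<bullet> Proj0 C X (Term C) = Ident C (X \<times>\<^sub>o Term C)"
    using assms by simp_all
qed

end

lemma (in cartesian_category) Pairing_inject:
  assumes "\<langle>f, g\<rangle> = \<langle>f', g'\<rangle>" "f \<in> Arr C" "g \<in> Arr C" "f' \<in> Arr C" "g' \<in> Arr C"
    and "Dom C f = Dom C g" "Dom C f' = Dom C g'" "Cod C f = Cod C f'" "Cod C g = Cod C g'"
  shows "f = f'" "g = g'"
  using assms Proj_Pairing[of f g "Cod C f'" "Cod C g'"] Proj_Pairing[of f' g' "Cod C f'" "Cod C g'"]
  by metis+

section \<open>Addition of arrows\<close>

context cartesian_left_additive_category
begin

lemma Add_typing [simp]:
  assumes "f \<in> Arr C" "g \<in> Arr C" "Dom C f = Dom C g" "Cod C f = Cod C g"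
  shows "f \<^bold>+ g \<in> Arr C" "Dom C (f \<^bold>+ g) = Dom C g" "Cod C (f \<^bold>+ g) = Cod C g"
proof -
  interpret M: comm_monoid "\<lparr>carrier = Hom C (Dom C g) (Cod C g), mult = Add C, one = Zero C (Dom C g) (Cod C g)\<rparr>"
    using assms by (intro Hom_comm_monoid) simp_all
  have "f \<^bold>+ g \<in> Hom C (Dom C g) (Cod C g)"
    using M.m_closed[of f g] assms by (simp add: Hom_iff)
  then show "f \<^bold>+ g \<in> Arr C" "Dom C (f \<^bold>+ g) = Dom C g" "Cod C (f \<^bold>+ g) = Cod C g"
    by (simp_all add: Hom_iff)
qed

lemma Zero_typing [simp]:
  assumes "X \<in> Obj C" "Y \<in> Obj C"
  shows "Zero C X Y \<in> Arr C" "Dom C (Zero C X Y) = X" "Cod C (Zero C X Y) = Y"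
proof -
  interpret M: comm_monoid "\<lparr>carrier = Hom C X Y, mult = Add C, one = Zero C X Y\<rparr>"
    using assms by (rule Hom_comm_monoid)
  show "Zero C X Y \<in> Arr C" "Dom C (Zero C X Y) = X" "Cod C (Zero C X Y) = Y"
    using M.one_closed by (simp_all add: Hom_iff)
qed

lemma Hom_ObjD: "f \<in> Hom C X Y \<Longrightarrow> X \<in> Obj C" "f \<in> Hom C X Y \<Longrightarrow> Y \<in> Obj C"
  by (auto simp: Hom_iff)

lemma Add_Zero_Hom:
  assumes "f \<in> Hom C X Y"
  shows "f \<^bold>+ Zero C X Y = f" "Zero C X Y \<^bold>+ f = f"
proof -
  interpret M: comm_monoid "\<lparr>carrier = Hom C X Y, mult = Add C, one = Zero C X Y\<rparr>"
    using Hom_ObjD[OF assms] by (rule Hom_comm_monoid)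
  show "f \<^bold>+ Zero C X Y = f" "Zero C X Y \<^bold>+ f = f"
    using M.r_one[of f] M.l_one[of f] assms by simp_all
qed

lemma Add_Zero [simp]:
  assumes "f \<in> Arr C" "Dom C f = X" "Cod C f = Y"
  shows "f \<^bold>+ Zero C X Y = f" "Zero C X Y \<^bold>+ f = f"
  using assms by (simp_all add: Add_Zero_Hom Hom_iff)

lemma Add_assoc:
  assumes "f \<in> Hom C X Y" "g \<in> Hom C X Y" "h \<in> Hom C X Y"
  shows "(f \<^bold>+ g) \<^bold>+ h = f \<^bold>+ (g \<^bold>+ h)"
proof -
  interpret M: comm_monoid "\<lparr>carrier = Hom C X Y, mult = Add C, one = Zero C X Y\<rparr>"
    using Hom_ObjD[OF assms(1)] by (rule Hom_comm_monoid)
  show ?thesis using M.m_assoc[of f g h] assms by simp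
qed

lemma Add_commute:
  assumes "f \<in> Hom C X Y" "g \<in> Hom C X Y"
  shows "f \<^bold>+ g = g \<^bold>+ f"
proof -
  interpret M: comm_monoid "\<lparr>carrier = Hom C X Y, mult = Add C, one = Zero C X Y\<rparr>"
    using Hom_ObjD[OF assms(1)] by (rule Hom_comm_monoid)
  show ?thesis using M.m_comm[of f g] assms by simp
qed

lemma Add_Comp [simp]:
  "\<lbrakk>f \<in> Arr C; g \<in> Arr C; h \<in> Arr C; Dom C f = Dom C g; Cod C f = Cod C g; Cod C h = Dom C g\<rbrakk>
    \<Longrightarrow> (f \<^bold>+ g) \<bullet> h = f \<bullet> h \<^bold>+ g \<bullet> h"
  by (rule LA1_Add) (auto simp: Hom_iff)

lemma Zero_Comp [simp]:
  "\<lbrakk>h \<in> Arr C; Cod C h = Y; Z \<in> Obj C\<rbrakk> \<Longrightarrow> Zero C Y Z \<bullet> h = Zero C (Dom C h) Z"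
  by (rule LA1_Zero) (auto simp: Hom_iff)

lemma Proj_Add [simp]:
  assumes "f \<in> Arr C" "g \<in> Arr C" "Dom C f = Dom C g" "Cod C f = Y \<times>\<^sub>o Z" "Cod C g = Y \<times>\<^sub>o Z"
    "Y \<in> Obj C" "Z \<in> Obj C"
  shows "Proj0 C Y Z \<bullet> (f \<^bold>+ g) = Proj0 C Y Z \<bullet> f \<^bold>+ Proj0 C Y Z \<bullet> g"
    and "Proj1 C Y Z \<bullet> (f \<^bold>+ g) = Proj1 C Y Z \<bullet> f \<^bold>+ Proj1 C Y Z \<bullet> g"
  using LA2_Add0[of f "Dom C f" Y Z g] LA2_Add1[of f "Dom C f" Y Z g] assms by (simp_all add: Hom_iff)

lemma Proj_Zero [simp]:
  assumes "X \<in> Obj C" "Y \<in> Obj C" "Z \<in> Obj C"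
  shows "Proj0 C Y Z \<bullet> Zero C X (Y \<times>\<^sub>o Z) = Zero C X Y"
    and "Proj1 C Y Z \<bullet> Zero C X (Y \<times>\<^sub>o Z) = Zero C X Z"
  using assms by (simp_all add: LA2_Zero0 LA2_Zero1)

lemma Pairing_Add:
  assumes "f \<in> Arr C" "g \<in> Arr C" "f' \<in> Arr C" "g' \<in> Arr C"
    "Dom C f = Dom C g" "Dom C f' = Dom C g" "Dom C g' = Dom C g"
    "Cod C f = Cod C f'" "Cod C g = Cod C g'"
  shows "\<langle>f, g\<rangle> \<^bold>+ \<langle>f', g'\<rangle> = \<langle>f \<^bold>+ f', g \<^bold>+ g'\<rangle>"
  by (rule Prod_ext[of _ "Dom C g" "Cod C f'" "Cod C g'"]) (use assms in \<open>simp_all add: Hom_iff\<close>)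

end

lemma (in cartesian_left_additive_category) Add_interchange:
  assumes "x \<in> Hom C W Z" "y \<in> Hom C W Z" "x' \<in> Hom C W Z" "y' \<in> Hom C W Z"
  shows "(x \<^bold>+ x') \<^bold>+ (y \<^bold>+ y') = (x \<^bold>+ y) \<^bold>+ (x' \<^bold>+ y')"
proof -
  interpret M: comm_monoid "\<lparr>carrier = Hom C W Z, mult = Add C, one = Zero C W Z\<rparr>"
    using Hom_ObjD[OF assms(1)] by (rule Hom_comm_monoid)
  show ?thesis
    using M.m_lcomm[of y x' y'] M.m_assoc[of x x' "y \<^bold>+ y'"] M.m_assoc[of x y "x' \<^bold>+ y'"]
      M.m_lcomm[of x' y y'] M.m_closed[of y y'] M.m_closed[of x' y'] assms by simp
qed

section \<open>The derivative and linear maps\<close>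

context cartesian_reverse_derivative_category
begin

lemma Rev_typing [simp]:
  assumes "f \<in> Arr C"
  shows "Rev C f \<in> Arr C" "Dom C (Rev C f) = Dom C f \<times>\<^sub>o Cod C f" "Cod C (Rev C f) = Dom C f"
  using Rev_in_Hom[of f "Dom C f" "Cod C f"] assms by (simp_all add: Hom_iff)

text \<open>The reverse derivative is evaluated on generalised elements: in \<open>Rev C f \<bullet> \<langle>a, p\<rangle>\<close> the arrow
  \<open>a\<close> is a point of the domain of \<open>f\<close> and \<open>p\<close> a covector on its codomain, both depending on a
  parameter. In this form a second reverse derivative can be computed by rewriting.\<close>

lemma Rev_at_Zero [simp]:
  "\<lbrakk>f \<in> Arr C; a \<in> Arr C; Cod C a = Dom C f; W = Dom C a; Y = Cod C f\<rbrakk>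
    \<Longrightarrow> Rev C f \<bullet> \<langle>a, Zero C W Y\<rangle> = Zero C W (Dom C f)"
  by (rule RD2_Zero) (auto simp: Hom_iff)

lemma Rev_Proj0_at [simp]:
  "\<lbrakk>a \<in> Arr C; p \<in> Arr C; Dom C a = Dom C p; Cod C a = X \<times>\<^sub>o Y; Cod C p = X; X \<in> Obj C; Y \<in> Obj C\<rbrakk>
    \<Longrightarrow> Rev C (Proj0 C X Y) \<bullet> \<langle>a, p\<rangle> = \<langle>p, Zero C (Dom C p) Y\<rangle>"
  by (simp add: RD3_Proj0 inj0_def)

lemma Rev_Proj1_at [simp]:
  "\<lbrakk>a \<in> Arr C; p \<in> Arr C; Dom C a = Dom C p; Cod C a = X \<times>\<^sub>o Y; Cod C p = Y; X \<in> Obj C; Y \<in> Obj C\<rbrakk>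
    \<Longrightarrow> Rev C (Proj1 C X Y) \<bullet> \<langle>a, p\<rangle> = \<langle>Zero C (Dom C p) X, p\<rangle>"
  by (simp add: RD3_Proj1 inj1_def)

lemma Rev_Pairing_at:
  "\<lbrakk>f \<in> Arr C; g \<in> Arr C; Dom C f = Dom C g; a \<in> Arr C; Cod C a = Dom C g; p \<in> Arr C;
    Dom C p = Dom C a; Cod C p = Cod C f \<times>\<^sub>o Cod C g\<rbrakk>
    \<Longrightarrow> Rev C \<langle>f, g\<rangle> \<bullet> \<langle>a, p\<rangle> =
        Rev C f \<bullet> \<langle>a, Proj0 C (Cod C f) (Cod C g) \<bullet> p\<rangle> \<^bold>+ Rev C g \<bullet> \<langle>a, Proj1 C (Cod C f) (Cod C g) \<bullet> p\<rangle>"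
  using RD4_Pairing[of f "Dom C g" "Cod C f" g "Cod C g"] by (simp add: Hom_iff Cross_Pairing)

lemma Rev_Comp_at:
  "\<lbrakk>f \<in> Arr C; g \<in> Arr C; Cod C f = Dom C g; a \<in> Arr C; Cod C a = Dom C f; p \<in> Arr C;
    Dom C p = Dom C a; Cod C p = Cod C g\<rbrakk>
    \<Longrightarrow> Rev C (g \<bullet> f) \<bullet> \<langle>a, p\<rangle> = Rev C f \<bullet> \<langle>a, Rev C g \<bullet> \<langle>f \<bullet> a, p\<rangle>\<rangle>"
  using RD5[of f "Dom C f" "Cod C f" g "Cod C g"] by (simp add: Hom_iff Cross_Pairing)

lemma Rev_Zero_at [simp]:
  "\<lbrakk>X \<in> Obj C; Y \<in> Obj C; a \<in> Arr C; Cod C a = X; p \<in> Arr C; Dom C p = Dom C a; Cod C p = Y\<rbrakk>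
    \<Longrightarrow> Rev C (Zero C X Y) \<bullet> \<langle>a, p\<rangle> = Zero C (Dom C a) X"
  by (simp add: RD1_Zero)

lemma Deriv_eq:
  "f \<in> Arr C \<Longrightarrow> Deriv C f = Proj1 C (Dom C f) (Cod C f) \<bullet> Rev C (Rev C f) \<bullet>
     \<langle>\<langle>Proj0 C (Dom C f) (Dom C f), Zero C (Dom C f \<times>\<^sub>o Dom C f) (Cod C f)\<rangle>, Proj1 C (Dom C f) (Dom C f)\<rangle>"
  by (simp add: Deriv_def Cross_Pairing)

lemma Deriv_at:
  "\<lbrakk>f \<in> Arr C; a \<in> Arr C; v \<in> Arr C; Cod C a = Dom C f; Cod C v = Dom C f; Dom C a = Dom C v\<rbrakk> \<Longrightarrow>
   Deriv C f \<bullet> \<langle>a, v\<rangle> = Proj1 C (Dom C f) (Cod C f) \<bullet> Rev C (Rev C f) \<bullet>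
     \<langle>\<langle>a, Zero C (Dom C v) (Cod C f)\<rangle>, v\<rangle>"
  by (simp add: Deriv_eq)

lemma Deriv_typing [simp]:
  assumes "f \<in> Arr C"
  shows "Deriv C f \<in> Arr C" "Dom C (Deriv C f) = Dom C f \<times>\<^sub>o Dom C f" "Cod C (Deriv C f) = Cod C f"
  using assms by (simp_all add: Deriv_eq)

text \<open>The chain rule. By RD.5, \<open>R[g \<bullet> f] = R[f] \<bullet> h\<close> with \<open>h(x, z) = (x, R[g](f x, z))\<close>. At \<open>z = 0\<close> the
  second component of \<open>h\<close> vanishes, so \<open>R[R[g \<bullet> f]]\<close> at \<open>((a, 0), v)\<close> applies \<open>R[h]\<close> to the value
  \<open>Q\<close> of \<open>R[R[f]]\<close> at \<open>((a, 0), v)\<close>, whose second component is \<open>D[f](a, v)\<close>. Differentiating the second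
  component of \<open>h\<close> produces \<open>R[R[g]]\<close> at \<open>((f a, 0), D[f](a, v))\<close>; everything else lands in the first
  component, which \<open>D\<close> discards.\<close>

lemma Deriv_Comp_at:
  assumes "f \<in> Arr C" "g \<in> Arr C" "Cod C f = Dom C g"
    and "a \<in> Arr C" "v \<in> Arr C" "Cod C a = Dom C f" "Cod C v = Dom C f" "Dom C a = Dom C v"
  shows "Deriv C (g \<bullet> f) \<bullet> \<langle>a, v\<rangle> = Deriv C g \<bullet> \<langle>f \<bullet> a, Deriv C f \<bullet> \<langle>a, v\<rangle>\<rangle>"
proof -
  define X Y Z W where "X = Dom C f" and "Y = Dom C g" and "Z = Cod C g" and "W = Dom C v"
  note T = assms X_def[symmetric] Y_def[symmetric] Z_def[symmetric] W_def[symmetric]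
  have O: "X \<in> Obj C" "Y \<in> Obj C" "Z \<in> Obj C" "W \<in> Obj C"
    using assms by (simp_all add: X_def Y_def Z_def W_def)
  define k where "k = \<langle>f \<bullet> Proj0 C X Z, Proj1 C X Z\<rangle>"
  define h where "h = \<langle>Proj0 C X Z, Rev C g \<bullet> k\<rangle>"
  define z where "z = \<langle>a, Zero C W Z\<rangle>"
  define Q where "Q = Rev C (Rev C f) \<bullet> \<langle>\<langle>a, Zero C W Y\<rangle>, v\<rangle>"
  define B where "B = Deriv C f \<bullet> \<langle>a, v\<rangle>"
  define S where "S = Rev C (Rev C g) \<bullet> \<langle>\<langle>f \<bullet> a, Zero C W Z\<rangle>, B\<rangle>"
  have k: "k \<in> Arr C" "Dom C k = X \<times>\<^sub>o Z" "Cod C k = Y \<times>\<^sub>o Z" "k \<bullet> z = \<langle>f \<bullet> a, Zero C W Z\<rangle>"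
    using T O by (simp_all add: k_def z_def)
  have z: "z \<in> Arr C" "Dom C z = W" "Cod C z = X \<times>\<^sub>o Z"
    using T O by (simp_all add: z_def)
  have h: "h \<in> Arr C" "Dom C h = X \<times>\<^sub>o Z" "Cod C h = X \<times>\<^sub>o Y" "h \<bullet> z = \<langle>a, Zero C W Y\<rangle>"
    using T O k z by (simp_all add: h_def) (simp add: z_def)
  have Q: "Q \<in> Arr C" "Dom C Q = W" "Cod C Q = X \<times>\<^sub>o Y"
    using T O by (simp_all add: Q_def)
  have B: "B \<in> Arr C" "Dom C B = W" "Cod C B = Y" "B = Proj1 C X Y \<bullet> Q"
    using T O by (simp_all add: B_def Q_def Deriv_at)
  have S: "S \<in> Arr C" "Dom C S = W" "Cod C S = Y \<times>\<^sub>o Z"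
    using T O B(1-3) by (simp_all add: S_def)
  have "Rev C (g \<bullet> f) = Rev C f \<bullet> h"
    using RD5[of f X Y g Z] T O by (simp add: Hom_iff Cross_Pairing h_def k_def)
  then have "Rev C (Rev C (g \<bullet> f)) \<bullet> \<langle>z, v\<rangle> = Rev C h \<bullet> \<langle>z, Q\<rangle>"
    using T O h z by (simp add: Rev_Comp_at Q_def)
  also have "\<dots> = \<langle>Proj0 C X Y \<bullet> Q, Zero C W Z\<rangle> \<^bold>+ Rev C (Rev C g \<bullet> k) \<bullet> \<langle>z, B\<rangle>"
    using T O k z Q unfolding h_def B(4) by (simp add: Rev_Pairing_at)
  also have "Rev C (Rev C g \<bullet> k) \<bullet> \<langle>z, B\<rangle> = Rev C k \<bullet> \<langle>z, S\<rangle>"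
    using T O k z B(1-3) by (simp add: Rev_Comp_at S_def)
  also have "\<dots> = Rev C (f \<bullet> Proj0 C X Z) \<bullet> \<langle>z, Proj0 C Y Z \<bullet> S\<rangle> \<^bold>+ \<langle>Zero C W X, Proj1 C Y Z \<bullet> S\<rangle>"
    using T O z S unfolding k_def by (simp add: Rev_Pairing_at)
  also have "Rev C (f \<bullet> Proj0 C X Z) \<bullet> \<langle>z, Proj0 C Y Z \<bullet> S\<rangle> =
      \<langle>Rev C f \<bullet> \<langle>a, Proj0 C Y Z \<bullet> S\<rangle>, Zero C W Z\<rangle>"
    using T O z S by (simp add: Rev_Comp_at) (simp add: z_def)
  finally have "Proj1 C X Z \<bullet> Rev C (Rev C (g \<bullet> f)) \<bullet> \<langle>z, v\<rangle> = Proj1 C Y Z \<bullet> S"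
    using T O Q S by simp
  then show ?thesis
    using T O B(1-3) by (simp add: Deriv_at z_def S_def flip: B_def)
qed

text \<open>By RD.4, \<open>R[\<langle>f, g\<rangle>]\<close> is the sum of \<open>R[f] \<bullet> p\<close> and \<open>R[g] \<bullet> q\<close>, where \<open>p\<close> and \<open>q\<close> select a component
  of the covector. The reverse derivatives of \<open>p\<close> and \<open>q\<close> put their argument back into that component
  and zero into the other one, so the two summands do not interfere.\<close>

lemma Deriv_Pairing_at:
  assumes "f \<in> Arr C" "g \<in> Arr C" "Dom C f = Dom C g"
    and "a \<in> Arr C" "v \<in> Arr C" "Cod C a = Dom C g" "Cod C v = Dom C g" "Dom C a = Dom C v"
  shows "Deriv C \<langle>f, g\<rangle> \<bullet> \<langle>a, v\<rangle> = \<langle>Deriv C f \<bullet> \<langle>a, v\<rangle>, Deriv C g \<bullet> \<langle>a, v\<rangle>\<rangle>"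
proof -
  define X Y Z W where "X = Dom C g" and "Y = Cod C f" and "Z = Cod C g" and "W = Dom C v"
  note T = assms X_def[symmetric] Y_def[symmetric] Z_def[symmetric] W_def[symmetric]
  have O: "X \<in> Obj C" "Y \<in> Obj C" "Z \<in> Obj C" "W \<in> Obj C"
    using assms by (simp_all add: X_def Y_def Z_def W_def)
  define p where "p = \<langle>Proj0 C X (Y \<times>\<^sub>o Z), Proj0 C Y Z \<bullet> Proj1 C X (Y \<times>\<^sub>o Z)\<rangle>"
  define q where "q = \<langle>Proj0 C X (Y \<times>\<^sub>o Z), Proj1 C Y Z \<bullet> Proj1 C X (Y \<times>\<^sub>o Z)\<rangle>"
  define z where "z = \<langle>a, Zero C W (Y \<times>\<^sub>o Z)\<rangle>"
  define F where "F = Rev C (Rev C f) \<bullet> \<langle>\<langle>a, Zero C W Y\<rangle>, v\<rangle>"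
  define G where "G = Rev C (Rev C g) \<bullet> \<langle>\<langle>a, Zero C W Z\<rangle>, v\<rangle>"
  have p: "p \<in> Arr C" "Dom C p = X \<times>\<^sub>o Y \<times>\<^sub>o Z" "Cod C p = X \<times>\<^sub>o Y" "p \<bullet> z = \<langle>a, Zero C W Y\<rangle>"
    and q: "q \<in> Arr C" "Dom C q = X \<times>\<^sub>o Y \<times>\<^sub>o Z" "Cod C q = X \<times>\<^sub>o Z" "q \<bullet> z = \<langle>a, Zero C W Z\<rangle>"
    using T O by (simp_all add: p_def q_def z_def)
  have z: "z \<in> Arr C" "Dom C z = W" "Cod C z = X \<times>\<^sub>o Y \<times>\<^sub>o Z"
    using T O by (simp_all add: z_def)
  have F: "F \<in> Arr C" "Dom C F = W" "Cod C F = X \<times>\<^sub>o Y"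
    and G: "G \<in> Arr C" "Dom C G = W" "Cod C G = X \<times>\<^sub>o Z"
    using T O by (simp_all add: F_def G_def)
  have "Rev C \<langle>f, g\<rangle> = Rev C f \<bullet> p \<^bold>+ Rev C g \<bullet> q"
    using RD4_Pairing[of f X Y g Z] T O by (simp add: Hom_iff Cross_Pairing p_def q_def)
  moreover have "Rev C (Rev C f \<bullet> p \<^bold>+ Rev C g \<bullet> q) = Rev C (Rev C f \<bullet> p) \<^bold>+ Rev C (Rev C g \<bullet> q)"
    using T O p q by (intro RD1_Add[of _ "X \<times>\<^sub>o Y \<times>\<^sub>o Z" X]) (simp_all add: Hom_iff)
  ultimately have "Rev C (Rev C \<langle>f, g\<rangle>) \<bullet> \<langle>z, v\<rangle> = Rev C p \<bullet> \<langle>z, F\<rangle> \<^bold>+ Rev C q \<bullet> \<langle>z, G\<rangle>"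
    using T O p q z by (simp add: Rev_Comp_at F_def G_def)
  also have "Rev C p \<bullet> \<langle>z, F\<rangle> = \<langle>Proj0 C X Y \<bullet> F, \<langle>Proj1 C X Y \<bullet> F, Zero C W Z\<rangle>\<rangle>"
    using T O z F unfolding p_def by (simp add: Rev_Pairing_at Rev_Comp_at Pairing_Add)
  also have "Rev C q \<bullet> \<langle>z, G\<rangle> = \<langle>Proj0 C X Z \<bullet> G, \<langle>Zero C W Y, Proj1 C X Z \<bullet> G\<rangle>\<rangle>"
    using T O z G unfolding q_def by (simp add: Rev_Pairing_at Rev_Comp_at Pairing_Add)
  finally have "Proj1 C X (Y \<times>\<^sub>o Z) \<bullet> Rev C (Rev C \<langle>f, g\<rangle>) \<bullet> \<langle>z, v\<rangle> =
      \<langle>Proj1 C X Y \<bullet> F, Proj1 C X Z \<bullet> G\<rangle>"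
    using T O F G by (simp add: Pairing_Add)
  then show ?thesis
    using T O by (simp add: Deriv_at z_def F_def G_def)
qed

lemma linear_mapI:
  "\<lbrakk>f \<in> Arr C; Deriv C f \<bullet> \<langle>Proj0 C (Dom C f) (Dom C f), Proj1 C (Dom C f) (Dom C f)\<rangle> =
    f \<bullet> Proj1 C (Dom C f) (Dom C f)\<rbrakk> \<Longrightarrow> linear_map C f"
  by (simp add: linear_map_def)

lemma linear_map_Arr: "linear_map C f \<Longrightarrow> f \<in> Arr C"
  by (simp add: linear_map_def)

lemma Deriv_linear_map: "linear_map C f \<Longrightarrow> Deriv C f = f \<bullet> Proj1 C (Dom C f) (Dom C f)"
  by (simp add: linear_map_def)

lemma linear_map_Ident [simp]: "X \<in> Obj C \<Longrightarrow> linear_map C (Ident C X)"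
  by (rule linear_mapI) (simp_all del: Pairing_Proj add: Deriv_at RD3_Ident)

lemma linear_map_Proj [simp]:
  assumes "X \<in> Obj C" "Y \<in> Obj C"
  shows "linear_map C (Proj0 C X Y)" "linear_map C (Proj1 C X Y)"
  by (rule linear_mapI; use assms in \<open>simp del: Pairing_Proj
      add: Deriv_at RD3_Proj0 RD3_Proj1 inj0_def inj1_def Rev_Comp_at Rev_Pairing_at\<close>)+

lemma linear_map_Bang [simp]: "X \<in> Obj C \<Longrightarrow> linear_map C (Bang C X)"
  by (simp add: linear_map_def) (simp add: Term_ext)

lemma linear_map_Comp [simp]:
  assumes "linear_map C f" "linear_map C g" "Cod C f = Dom C g"
  shows "linear_map C (g \<bullet> f)"
  by (rule linear_mapI) (use assms in \<open>simp_all del: Pairing_Proj add: linear_map_Arr Deriv_Comp_at Deriv_linear_map\<close>)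

lemma linear_map_Pairing [simp]:
  assumes "linear_map C f" "linear_map C g" "Dom C f = Dom C g"
  shows "linear_map C \<langle>f, g\<rangle>"
  by (rule linear_mapI) (use assms in \<open>simp_all del: Pairing_Proj add: linear_map_Arr Deriv_Pairing_at Deriv_linear_map\<close>)

end

section \<open>Pullbacks of linear maps\<close>

lemma Lin_simps [simp]:
  "Obj (Lin C) = Obj C" "Arr (Lin C) = {f. linear_map C f}" "Dom (Lin C) = Dom C"
  "Cod (Lin C) = Cod C" "Ident (Lin C) = Ident C" "Comp (Lin C) = Comp C"
  by (simp_all add: Lin_def)

lemma Hom_Lin_iff: "f \<in> Hom (Lin C) X Y \<longleftrightarrow> linear_map C f \<and> Dom C f = X \<and> Cod C f = Y"
  by (simp add: Hom_def)

lemma (in category) Comp_reassoc: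
  "\<lbrakk>h \<bullet> g = k; f \<in> Arr C; g \<in> Arr C; h \<in> Arr C; Cod C f = Dom C g; Cod C g = Dom C h\<rbrakk>
    \<Longrightarrow> h \<bullet> (g \<bullet> f) = k \<bullet> f"
  by (metis Comp_assoc_Arr)

text \<open>The shape \<open>0 \<rightarrow> 2 \<leftarrow> 1\<close>. The arrows 0, 1 and 2 are the identities, and 3 and 4 start at 0 and 1.
  In a composable pair at most one arrow is not an identity.\<close>

definition cospan_shape :: "(nat, nat) category" where
  "cospan_shape = \<lparr>Obj = {0, 1, 2}, Arr = {0, 1, 2, 3, 4},
     Dom = (\<lambda>u. if u = 3 then 0 else if u = 4 then 1 else u), Cod = (\<lambda>u. if u \<ge> 2 then 2 else u),
     Ident = id, Comp = (\<lambda>v u. if u \<ge> 3 then u else v)\<rparr>"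

lemma category_cospan_shape: "category cospan_shape"
  by unfold_locales (auto simp: cospan_shape_def Hom_def)

context cartesian_reverse_derivative_category
begin

text \<open>A pullback in \<open>Lin C\<close>; its apex is the domain of \<open>b0\<close>.\<close>

definition lin_pullback :: "'b \<Rightarrow> 'b \<Rightarrow> 'b \<Rightarrow> 'b \<Rightarrow> bool" where
  "lin_pullback r l b0 b1 \<longleftrightarrow> is_pullback (Lin C) r l (Dom C b0) b0 b1"

lemma lin_pullbackD:
  assumes "lin_pullback r l b0 b1"
  shows "linear_map C r" "linear_map C l" "linear_map C b0" "linear_map C b1"
    "r \<in> Arr C" "l \<in> Arr C" "b0 \<in> Arr C" "b1 \<in> Arr C"
    "Cod C r = Cod C l" "Dom C b1 = Dom C b0" "Cod C b0 = Dom C r" "Cod C b1 = Dom C l"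
    "r \<bullet> b0 = l \<bullet> b1"
  using assms by (simp_all add: lin_pullback_def is_pullback_def Hom_Lin_iff linear_map_Arr)

lemma lin_pullback_commute_at:
  assumes "lin_pullback r l b0 b1" "h \<in> Arr C" "Cod C h = Dom C b0"
  shows "r \<bullet> b0 \<bullet> h = l \<bullet> b1 \<bullet> h"
  using lin_pullbackD[OF assms(1)] assms(2,3)
    Comp_assoc_Arr[of h b0 r] Comp_assoc_Arr[of h b1 l] by metis

lemma lin_pullback_mediate:
  assumes "lin_pullback r l b0 b1" "linear_map C c0" "linear_map C c1" "Dom C c0 = Dom C c1"
    and "Cod C c0 = Dom C r" "Cod C c1 = Dom C l" "r \<bullet> c0 = l \<bullet> c1"
  obtains h where "linear_map C h" "h \<in> Arr C" "Dom C h = Dom C c1" "Cod C h = Dom C b0"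
    "b0 \<bullet> h = c0" "b1 \<bullet> h = c1"
proof -
  have "c0 \<in> Hom (Lin C) (Dom C c1) (Dom C r) \<and> c1 \<in> Hom (Lin C) (Dom C c1) (Dom C l) \<and> r \<bullet> c0 = l \<bullet> c1"
    using assms by (simp add: Hom_Lin_iff)
  then obtain h where "h \<in> Hom (Lin C) (Dom C c1) (Dom C b0)" "b0 \<bullet> h = c0" "b1 \<bullet> h = c1"
    using assms(1) unfolding lin_pullback_def is_pullback_def by (simp add: Ex1_def) blast
  then show thesis by (intro that[of h]) (simp_all add: Hom_Lin_iff linear_map_Arr)
qed

lemma lin_pullback_ext:
  assumes "lin_pullback r l b0 b1" "linear_map C h" "linear_map C k" "Dom C h = Dom C k"
    and "Cod C h = Dom C b0" "Cod C k = Dom C b0" "b0 \<bullet> h = b0 \<bullet> k" "b1 \<bullet> h = b1 \<bullet> k"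
  shows "h = k"
proof -
  note P = lin_pullbackD[OF assms(1)]
  have A: "h \<in> Arr C" "k \<in> Arr C" using assms by (simp_all add: linear_map_Arr)
  have "b0 \<bullet> k \<in> Hom (Lin C) (Dom C k) (Dom C r) \<and> b1 \<bullet> k \<in> Hom (Lin C) (Dom C k) (Dom C l) \<and>
      r \<bullet> b0 \<bullet> k = l \<bullet> b1 \<bullet> k"
    using P A assms by (simp add: Hom_Lin_iff lin_pullback_commute_at[OF assms(1)])
  then have "\<exists>!j. j \<in> Hom (Lin C) (Dom C k) (Dom C b0) \<and> b0 \<bullet> j = b0 \<bullet> k \<and> b1 \<bullet> j = b1 \<bullet> k"
    using assms(1) unfolding lin_pullback_def is_pullback_def by simp
  then show ?thesis using assms by (auto simp: Hom_Lin_iff)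
qed

lemma lin_pullbackI:
  assumes "linear_map C r" "linear_map C l" "linear_map C b0" "linear_map C b1"
    and "Cod C r = Cod C l" "Dom C b1 = Dom C b0" "Cod C b0 = Dom C r" "Cod C b1 = Dom C l"
    and "r \<bullet> b0 = l \<bullet> b1"
    and mediate: "\<And>c0 c1. \<lbrakk>linear_map C c0; linear_map C c1; c0 \<in> Arr C; c1 \<in> Arr C; Dom C c0 = Dom C c1;
        Cod C c0 = Dom C r; Cod C c1 = Dom C l; r \<bullet> c0 = l \<bullet> c1\<rbrakk>
        \<Longrightarrow> \<exists>h. linear_map C h \<and> Dom C h = Dom C c1 \<and> Cod C h = Dom C b0 \<and> b0 \<bullet> h = c0 \<and> b1 \<bullet> h = c1"
    and ext: "\<And>h k. \<lbrakk>linear_map C h; linear_map C k; h \<in> Arr C; k \<in> Arr C; Dom C h = Dom C k;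
        Cod C h = Dom C b0; Cod C k = Dom C b0; b0 \<bullet> h = b0 \<bullet> k; b1 \<bullet> h = b1 \<bullet> k\<rbrakk> \<Longrightarrow> h = k"
  shows "lin_pullback r l b0 b1"
  unfolding lin_pullback_def is_pullback_def
proof (intro conjI allI impI)
  fix Q c0 c1
  assume "c0 \<in> Hom (Lin C) Q (Dom (Lin C) r) \<and> c1 \<in> Hom (Lin C) Q (Dom (Lin C) l) \<and>
     r \<bullet>\<^bsub>Lin C\<^esub> c0 = l \<bullet>\<^bsub>Lin C\<^esub> c1"
  then have c: "linear_map C c0" "linear_map C c1" "Dom C c0 = Q" "Dom C c1 = Q"
    "Cod C c0 = Dom C r" "Cod C c1 = Dom C l" "r \<bullet> c0 = l \<bullet> c1"
    by (simp_all add: Hom_Lin_iff)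
  then have "Dom C c0 = Dom C c1" by simp
  from mediate[OF c(1,2) linear_map_Arr linear_map_Arr this c(5-7), OF c(1,2)]
  obtain h where h: "linear_map C h" "Dom C h = Dom C c1" "Cod C h = Dom C b0" "b0 \<bullet> h = c0" "b1 \<bullet> h = c1"
    by blast
  show "\<exists>!h. h \<in> Hom (Lin C) Q (Dom C b0) \<and> b0 \<bullet>\<^bsub>Lin C\<^esub> h = c0 \<and> b1 \<bullet>\<^bsub>Lin C\<^esub> h = c1"
  proof (rule ex1I[of _ h])
    show "h \<in> Hom (Lin C) Q (Dom C b0) \<and> b0 \<bullet>\<^bsub>Lin C\<^esub> h = c0 \<and> b1 \<bullet>\<^bsub>Lin C\<^esub> h = c1"
      using c h by (simp add: Hom_Lin_iff)
    fix k assume "k \<in> Hom (Lin C) Q (Dom C b0) \<and> b0 \<bullet>\<^bsub>Lin C\<^esub> k = c0 \<and> b1 \<bullet>\<^bsub>Lin C\<^esub> k = c1"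
    then have k: "linear_map C k" "Dom C k = Q" "Cod C k = Dom C b0" "b0 \<bullet> k = c0" "b1 \<bullet> k = c1"
      by (simp_all add: Hom_Lin_iff)
    show "k = h"
      by (rule ext) (use c h k in \<open>simp_all add: linear_map_Arr\<close>)
  qed
qed (use assms(1-9) in \<open>simp_all add: Hom_Lin_iff\<close>)

lemma lin_pullback_sym: "lin_pullback r l b0 b1 \<Longrightarrow> lin_pullback l r b1 b0"
proof -
  assume P: "lin_pullback r l b0 b1"
  note D = lin_pullbackD[OF P]
  show ?thesis
  proof (rule lin_pullbackI)
    fix c0 c1
    assume c: "linear_map C c0" "linear_map C c1" "c0 \<in> Arr C" "c1 \<in> Arr C" "Dom C c0 = Dom C c1"
      "Cod C c0 = Dom C l" "Cod C c1 = Dom C r" "l \<bullet> c0 = r \<bullet> c1"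
    obtain h where "linear_map C h" "Dom C h = Dom C c0" "Cod C h = Dom C b0" "b0 \<bullet> h = c1" "b1 \<bullet> h = c0"
      using lin_pullback_mediate[OF P c(2,1) c(5)[symmetric] c(7,6) c(8)[symmetric]] by blast
    then show "\<exists>h. linear_map C h \<and> Dom C h = Dom C c1 \<and> Cod C h = Dom C b1 \<and> b1 \<bullet> h = c0 \<and> b0 \<bullet> h = c1"
      using c(5) D(10) by (intro exI[of _ h]) simp
  next
    fix h k
    assume "linear_map C h" "linear_map C k" "Dom C h = Dom C k" "Cod C h = Dom C b1" "Cod C k = Dom C b1"
      "b1 \<bullet> h = b1 \<bullet> k" "b0 \<bullet> h = b0 \<bullet> k"
    then show "h = k" using D by - (rule lin_pullback_ext[OF P]; simp)
  qed (use D in simp_all)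
qed

text \<open>The pasting law. It turns the pullback of two pullbacks into a pullback for either bracketing of
  three spans, which is why composition of spans is associative.\<close>

lemma lin_pullback_paste:
  assumes P: "lin_pullback r l c0 c1" and Q: "lin_pullback b c0 d0 d1"
  shows "lin_pullback (r \<bullet> b) l d0 (c1 \<bullet> d1)"
proof -
  note DP = lin_pullbackD[OF P] and DQ = lin_pullbackD[OF Q]
  show ?thesis
  proof (rule lin_pullbackI)
    fix e0 e1
    assume e: "linear_map C e0" "linear_map C e1" "e0 \<in> Arr C" "e1 \<in> Arr C" "Dom C e0 = Dom C e1"
      "Cod C e0 = Dom C (r \<bullet> b)" "Cod C e1 = Dom C l" "(r \<bullet> b) \<bullet> e0 = l \<bullet> e1"
    have T: "Cod C e0 = Dom C b" using e DP DQ by simp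
    obtain g where g: "linear_map C g" "g \<in> Arr C" "Dom C g = Dom C e1" "Cod C g = Dom C c0" "c0 \<bullet> g = b \<bullet> e0" "c1 \<bullet> g = e1"
      using e T DP DQ lin_pullback_mediate[OF P, of "b \<bullet> e0" e1] by simp metis
    obtain h where h: "linear_map C h" "h \<in> Arr C" "Dom C h = Dom C g" "Cod C h = Dom C d0" "d0 \<bullet> h = e0" "d1 \<bullet> h = g"
      using e T g DP DQ lin_pullback_mediate[OF Q, of e0 g] by simp metis
    show "\<exists>h. linear_map C h \<and> Dom C h = Dom C e1 \<and> Cod C h = Dom C d0 \<and> d0 \<bullet> h = e0 \<and> (c1 \<bullet> d1) \<bullet> h = e1"
      by (rule exI[of _ h]) (use e g h DP DQ in simp)
  next
    fix h k
    assume hk: "linear_map C h" "linear_map C k" "h \<in> Arr C" "k \<in> Arr C" "Dom C h = Dom C k" "Cod C h = Dom C d0" "Cod C k = Dom C d0"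
      "d0 \<bullet> h = d0 \<bullet> k" "(c1 \<bullet> d1) \<bullet> h = (c1 \<bullet> d1) \<bullet> k"
    have "c0 \<bullet> (d1 \<bullet> h) = b \<bullet> (d0 \<bullet> h)" "c0 \<bullet> (d1 \<bullet> k) = b \<bullet> (d0 \<bullet> k)"
      using hk(1-7) DQ by (simp_all add: lin_pullback_commute_at[OF Q])
    then have "d1 \<bullet> h = d1 \<bullet> k"
      using hk DP(1-12) DQ(1-12) by - (rule lin_pullback_ext[OF P]; simp)
    then show "h = k"
      using hk(1-8) by - (rule lin_pullback_ext[OF Q]; simp)
  qed (use DP DQ in \<open>simp_all add: lin_pullback_commute_at[OF P]\<close>)
qed

text \<open>Arrows into a product are equal when both components are, so a cone over the product of two
  cospans is a pair of cones, and so is its mediating arrow.\<close>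

lemma lin_pullback_Cross:
  assumes P: "lin_pullback r l b0 b1" and P': "lin_pullback r' l' b0' b1'"
  shows "lin_pullback (r \<times>\<^sub>a r') (l \<times>\<^sub>a l') (b0 \<times>\<^sub>a b0') (b1 \<times>\<^sub>a b1')"
proof -
  note D = lin_pullbackD[OF P] and D' = lin_pullbackD[OF P']
  show ?thesis
  proof (rule lin_pullbackI)
    fix c0 c1
    assume c: "linear_map C c0" "linear_map C c1" "c0 \<in> Arr C" "c1 \<in> Arr C" "Dom C c0 = Dom C c1"
      "Cod C c0 = Dom C (r \<times>\<^sub>a r')" "Cod C c1 = Dom C (l \<times>\<^sub>a l')" "(r \<times>\<^sub>a r') \<bullet> c0 = (l \<times>\<^sub>a l') \<bullet> c1"
    have T: "Cod C c0 = Dom C r \<times>\<^sub>o Dom C r'" "Cod C c1 = Dom C l \<times>\<^sub>o Dom C l'"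
      using c D D' by (simp_all add: Cross_Pairing)
    let ?c0 = "Proj0 C (Dom C r) (Dom C r') \<bullet> c0" and ?c0' = "Proj1 C (Dom C r) (Dom C r') \<bullet> c0"
    let ?c1 = "Proj0 C (Dom C l) (Dom C l') \<bullet> c1" and ?c1' = "Proj1 C (Dom C l) (Dom C l') \<bullet> c1"
    have "\<langle>r \<bullet> ?c0, r' \<bullet> ?c0'\<rangle> = \<langle>l \<bullet> ?c1, l' \<bullet> ?c1'\<rangle>"
      using c(8) c(1-5) T D D' by (simp add: Cross_Pairing)
    then have "Proj0 C (Cod C l) (Cod C l') \<bullet> \<langle>r \<bullet> ?c0, r' \<bullet> ?c0'\<rangle> = Proj0 C (Cod C l) (Cod C l') \<bullet> \<langle>l \<bullet> ?c1, l' \<bullet> ?c1'\<rangle>"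
      and "Proj1 C (Cod C l) (Cod C l') \<bullet> \<langle>r \<bullet> ?c0, r' \<bullet> ?c0'\<rangle> = Proj1 C (Cod C l) (Cod C l') \<bullet> \<langle>l \<bullet> ?c1, l' \<bullet> ?c1'\<rangle>"
      by simp_all
    then have E: "r \<bullet> ?c0 = l \<bullet> ?c1" "r' \<bullet> ?c0' = l' \<bullet> ?c1'"
      using c(1-5) T D D' by simp_all
    obtain h where h: "linear_map C h" "h \<in> Arr C" "Dom C h = Dom C c1" "Cod C h = Dom C b0" "b0 \<bullet> h = ?c0" "b1 \<bullet> h = ?c1"
      using c(1-5) T D D' E lin_pullback_mediate[OF P, of ?c0 ?c1] by simp metis
    obtain h' where h': "linear_map C h'" "h' \<in> Arr C" "Dom C h' = Dom C c1" "Cod C h' = Dom C b0'" "b0' \<bullet> h' = ?c0'" "b1' \<bullet> h' = ?c1'"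
      using c(1-5) T D D' E lin_pullback_mediate[OF P', of ?c0' ?c1'] by simp metis
    show "\<exists>h. linear_map C h \<and> Dom C h = Dom C c1 \<and> Cod C h = Dom C (b0 \<times>\<^sub>a b0') \<and>
        (b0 \<times>\<^sub>a b0') \<bullet> h = c0 \<and> (b1 \<times>\<^sub>a b1') \<bullet> h = c1"
      by (rule exI[of _ "\<langle>h, h'\<rangle>"]) (use c(1-5) T D D' h h' in \<open>simp add: Cross_Pairing\<close>)
  next
    fix h k
    assume hk: "linear_map C h" "linear_map C k" "h \<in> Arr C" "k \<in> Arr C" "Dom C h = Dom C k"
      "Cod C h = Dom C (b0 \<times>\<^sub>a b0')" "Cod C k = Dom C (b0 \<times>\<^sub>a b0')"
      "(b0 \<times>\<^sub>a b0') \<bullet> h = (b0 \<times>\<^sub>a b0') \<bullet> k" "(b1 \<times>\<^sub>a b1') \<bullet> h = (b1 \<times>\<^sub>a b1') \<bullet> k"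
    have T: "Cod C h = Dom C b0 \<times>\<^sub>o Dom C b0'" "Cod C k = Dom C b0 \<times>\<^sub>o Dom C b0'"
      using hk D D' by (simp_all add: Cross_Pairing)
    note I = hk(1-5) T D(3-12) D'(3-12)
    have "Proj0 C (Dom C r) (Dom C r') \<bullet> ((b0 \<times>\<^sub>a b0') \<bullet> h) = Proj0 C (Dom C r) (Dom C r') \<bullet> ((b0 \<times>\<^sub>a b0') \<bullet> k)"
      "Proj1 C (Dom C r) (Dom C r') \<bullet> ((b0 \<times>\<^sub>a b0') \<bullet> h) = Proj1 C (Dom C r) (Dom C r') \<bullet> ((b0 \<times>\<^sub>a b0') \<bullet> k)"
      "Proj0 C (Dom C l) (Dom C l') \<bullet> ((b1 \<times>\<^sub>a b1') \<bullet> h) = Proj0 C (Dom C l) (Dom C l') \<bullet> ((b1 \<times>\<^sub>a b1') \<bullet> k)"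
      "Proj1 C (Dom C l) (Dom C l') \<bullet> ((b1 \<times>\<^sub>a b1') \<bullet> h) = Proj1 C (Dom C l) (Dom C l') \<bullet> ((b1 \<times>\<^sub>a b1') \<bullet> k)"
      using hk(8,9) by simp_all
    then have E: "b0 \<bullet> Proj0 C (Dom C b0) (Dom C b0') \<bullet> h = b0 \<bullet> Proj0 C (Dom C b0) (Dom C b0') \<bullet> k"
      "b0' \<bullet> Proj1 C (Dom C b0) (Dom C b0') \<bullet> h = b0' \<bullet> Proj1 C (Dom C b0) (Dom C b0') \<bullet> k"
      "b1 \<bullet> Proj0 C (Dom C b0) (Dom C b0') \<bullet> h = b1 \<bullet> Proj0 C (Dom C b0) (Dom C b0') \<bullet> k"
      "b1' \<bullet> Proj1 C (Dom C b0) (Dom C b0') \<bullet> h = b1' \<bullet> Proj1 C (Dom C b0) (Dom C b0') \<bullet> k"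
      using I by (simp_all add: Cross_Pairing)
    have "Proj0 C (Dom C b0) (Dom C b0') \<bullet> h = Proj0 C (Dom C b0) (Dom C b0') \<bullet> k"
      using I E by - (rule lin_pullback_ext[OF P]; simp)
    moreover have "Proj1 C (Dom C b0) (Dom C b0') \<bullet> h = Proj1 C (Dom C b0) (Dom C b0') \<bullet> k"
      using I E by - (rule lin_pullback_ext[OF P']; simp)
    ultimately show "h = k"
      using I by - (rule Prod_ext[of h "Dom C k" "Dom C b0" "Dom C b0'"]; simp add: Hom_iff)
  qed (use D D' in \<open>simp_all add: Cross_Pairing lin_pullback_commute_at[OF P] lin_pullback_commute_at[OF P']\<close>)
qed

text \<open>A cone over the cospan has a third component at the vertex 2, which is the common composite
  of the other two; so cones are the commuting squares of a pullback.\<close>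

lemma lin_pullback_exists:
  assumes fl: "has_finite_limits (Lin C)"
    and "linear_map C r" "linear_map C l" "Cod C r = Cod C l"
  obtains b0 b1 where "lin_pullback r l b0 b1"
proof -
  let ?Fo = "\<lambda>j::nat. if j = 0 then Dom C r else if j = 1 then Dom C l else Cod C l"
  let ?Fa = "\<lambda>u::nat. if u = 3 then r else if u = 4 then l else Ident C (?Fo u)"
  have A: "r \<in> Arr C" "l \<in> Arr C" using assms by (simp_all add: linear_map_Arr)
  have "is_functor cospan_shape (Lin C) ?Fo ?Fa"
    unfolding is_functor_def using assms A
    by (auto simp: cospan_shape_def Hom_Lin_iff)
  moreover have "finite (Obj cospan_shape)" "finite (Arr cospan_shape)"
    by (simp_all add: cospan_shape_def)
  ultimately obtain L p where lim: "limit_cone cospan_shape (Lin C) ?Fo ?Fa L p"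
    using fl category_cospan_shape unfolding has_finite_limits_def by blast
  then have "cone cospan_shape (Lin C) ?Fo ?Fa L p" by (simp add: limit_cone_def)
  then have p: "linear_map C (p 0)" "Dom C (p 0) = L" "Cod C (p 0) = Dom C r"
    "linear_map C (p 1)" "Dom C (p 1) = L" "Cod C (p 1) = Dom C l" "r \<bullet> p 0 = p 2" "l \<bullet> p 1 = p 2"
    by (simp_all add: cone_def cospan_shape_def Hom_Lin_iff)
  have pA: "p 0 \<in> Arr C" "p 1 \<in> Arr C" using p by (simp_all add: linear_map_Arr)
  have "lin_pullback r l (p 0) (p 1)"
  proof (rule lin_pullbackI)
    fix c0 c1
    assume c: "linear_map C c0" "linear_map C c1" "c0 \<in> Arr C" "c1 \<in> Arr C" "Dom C c0 = Dom C c1"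
      "Cod C c0 = Dom C r" "Cod C c1 = Dom C l" "r \<bullet> c0 = l \<bullet> c1"
    let ?q = "\<lambda>j::nat. if j = 0 then c0 else if j = 1 then c1 else r \<bullet> c0"
    have "cone cospan_shape (Lin C) ?Fo ?Fa (Dom C c1) ?q"
      using c assms A by (auto simp: cone_def cospan_shape_def Hom_Lin_iff)
    then obtain h where "h \<in> Hom (Lin C) (Dom C c1) L" "\<forall>j \<in> Obj cospan_shape. p j \<bullet> h = ?q j"
      using lim unfolding limit_cone_def by (simp add: Ex1_def) blast
    then show "\<exists>h. linear_map C h \<and> Dom C h = Dom C c1 \<and> Cod C h = Dom C (p 0) \<and> p 0 \<bullet> h = c0 \<and> p 1 \<bullet> h = c1"
      using p by (intro exI[of _ h]) (auto simp: cospan_shape_def Hom_Lin_iff)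
  next
    fix h k
    assume hk: "linear_map C h" "linear_map C k" "h \<in> Arr C" "k \<in> Arr C" "Dom C h = Dom C k"
      "Cod C h = Dom C (p 0)" "Cod C k = Dom C (p 0)" "p 0 \<bullet> h = p 0 \<bullet> k" "p 1 \<bullet> h = p 1 \<bullet> k"
    let ?q = "\<lambda>j::nat. p j \<bullet> k"
    have two: "r \<bullet> (p 0 \<bullet> k) = p 2 \<bullet> k" "l \<bullet> (p 1 \<bullet> k) = p 2 \<bullet> k" "r \<bullet> (p 0 \<bullet> h) = p 2 \<bullet> h"
      using hk(3-7) p(2,3,5,6) pA A
      by (simp_all add: Comp_reassoc[OF p(7)] Comp_reassoc[OF p(8)] del: One_nat_def)
    have t: "linear_map C (p 2)" "Dom C (p 2) = L" "Cod C (p 2) = Cod C l"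
      using p(1-6) pA A assms(2-4) by (simp_all flip: p(8) del: One_nat_def)
    have "cone cospan_shape (Lin C) ?Fo ?Fa (Dom C k) ?q"
      using hk(1-7) assms(2-4) A p(1-6) pA t two(1,2)
      by (simp add: cone_def cospan_shape_def Hom_Lin_iff linear_map_Arr del: One_nat_def)
    then have "\<exists>!j. j \<in> Hom (Lin C) (Dom C k) L \<and> (\<forall>i \<in> Obj cospan_shape. p i \<bullet> j = ?q i)"
      using lim unfolding limit_cone_def by simp
    moreover have "p 2 \<bullet> h = p 2 \<bullet> k"
      using two hk(8) by metis
    then have "\<forall>i \<in> Obj cospan_shape. p i \<bullet> h = ?q i"
      using hk(8,9) by (auto simp: cospan_shape_def)
    moreover have "h \<in> Hom (Lin C) (Dom C k) L" "k \<in> Hom (Lin C) (Dom C k) L"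
      using hk(1-7) p(2) by (simp_all add: Hom_Lin_iff)
    ultimately show "h = k"
      by blast
  qed (use p assms in simp_all)
  then show thesis by (rule that)
qed

end

section \<open>Linear isomorphisms\<close>

context cartesian_reverse_derivative_category
begin

definition lin_iso :: "'b \<Rightarrow> 'b \<Rightarrow> bool" where
  "lin_iso n m \<longleftrightarrow> linear_map C n \<and> linear_map C m \<and> Dom C m = Cod C n \<and> Cod C m = Dom C n \<and>
     m \<bullet> n = Ident C (Dom C n) \<and> n \<bullet> m = Ident C (Cod C n)"

lemma lin_isoD:
  assumes "lin_iso n m"
  shows "linear_map C n" "linear_map C m" "n \<in> Arr C" "m \<in> Arr C" "Dom C m = Cod C n" "Cod C m = Dom C n"
    "m \<bullet> n = Ident C (Dom C n)" "n \<bullet> m = Ident C (Cod C n)"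
  using assms by (simp_all add: lin_iso_def linear_map_Arr)

lemma lin_iso_sym: "lin_iso n m \<Longrightarrow> lin_iso m n"
  by (simp add: lin_iso_def)

lemma lin_iso_cancel:
  "\<lbrakk>lin_iso n m; x \<in> Arr C; Cod C x = Dom C n\<rbrakk> \<Longrightarrow> m \<bullet> n \<bullet> x = x"
  using lin_isoD[of n m] Comp_reassoc[of m n "Ident C (Dom C n)" x] by simp

lemma lin_iso_transpose:
  assumes "lin_iso n m" "h \<bullet> n = k" "h \<in> Arr C" "Dom C h = Cod C n"
  shows "k \<bullet> m = h"
  using lin_isoD[OF assms(1)] assms(3,4) by (simp flip: assms(2))

lemma lin_iso_Ident: "X \<in> Obj C \<Longrightarrow> lin_iso (Ident C X) (Ident C X)"
  by (simp add: lin_iso_def)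

lemma lin_iso_Comp:
  assumes "lin_iso n m" "lin_iso n' m'" "Cod C n = Dom C n'"
  shows "lin_iso (n' \<bullet> n) (m \<bullet> m')"
  using lin_isoD[OF assms(1)] lin_isoD[OF assms(2)] assms(3)
  by (simp add: lin_iso_def lin_iso_cancel[OF assms(2)] lin_iso_cancel[OF lin_iso_sym[OF assms(1)]])

lemma lin_iso_Cross:
  assumes "lin_iso n m" "lin_iso n' m'"
  shows "lin_iso (n \<times>\<^sub>a n') (m \<times>\<^sub>a m')"
  using lin_isoD(1-6)[OF assms(1)] lin_isoD(1-6)[OF assms(2)]
  by (simp add: lin_iso_def Cross_Pairing lin_iso_cancel[OF assms(1)] lin_iso_cancel[OF assms(2)]
      lin_iso_cancel[OF lin_iso_sym[OF assms(1)]] lin_iso_cancel[OF lin_iso_sym[OF assms(2)]])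

lemma iso_arrow_Lin_iff: "iso_arrow (Lin C) X Y n \<longleftrightarrow> Dom C n = X \<and> Cod C n = Y \<and> (\<exists>m. lin_iso n m)"
  unfolding iso_arrow_def inverse_arrows_def lin_iso_def Hom_Lin_iff by auto

text \<open>Pullbacks of isomorphic cospans are isomorphic, compatibly with the projections. This is what
  makes the composite of two classes of spans independent of the representatives and of the
  pullback.\<close>

lemma lin_pullback_unique:
  assumes P: "lin_pullback r l b0 b1" and P': "lin_pullback r' l' b0' b1'"
    and n: "lin_iso n m" "Dom C n = Dom C r" "Cod C n = Dom C r'" "r' \<bullet> n = r"
    and n': "lin_iso n' m'" "Dom C n' = Dom C l" "Cod C n' = Dom C l'" "l' \<bullet> n' = l"
  obtains k k' where "lin_iso k k'" "Dom C k = Dom C b0" "Cod C k = Dom C b0'"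
    "b0' \<bullet> k = n \<bullet> b0" "b1' \<bullet> k = n' \<bullet> b1"
proof -
  note D = lin_pullbackD[OF P] and D' = lin_pullbackD[OF P']
  note N = lin_isoD(1-6)[OF n(1)] n(2,3) and N' = lin_isoD(1-6)[OF n'(1)] n'(2,3)
  have "r' \<bullet> n \<bullet> b0 = l' \<bullet> n' \<bullet> b1"
    using D D'(1-12) N N' by (simp add: Comp_reassoc[OF n(4)] Comp_reassoc[OF n'(4)])
  then obtain k where k: "linear_map C k" "k \<in> Arr C" "Dom C k = Dom C b0" "Cod C k = Dom C b0'"
    "b0' \<bullet> k = n \<bullet> b0" "b1' \<bullet> k = n' \<bullet> b1"
    using lin_pullback_mediate[OF P', of "n \<bullet> b0" "n' \<bullet> b1"] D(1-12) D'(1-12) N N' by simp metis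
  \<comment> \<open>The inverse isomorphisms give a cone in the other direction.\<close>
  have rm: "r \<bullet> m = r'" and lm: "l \<bullet> m' = l'"
    using D' N N' lin_iso_transpose[OF n(1,4)] lin_iso_transpose[OF n'(1,4)] by simp_all
  have "r \<bullet> m \<bullet> b0' = l \<bullet> m' \<bullet> b1'"
    using D(1-12) D' N N' by (simp add: Comp_reassoc[OF rm] Comp_reassoc[OF lm])
  then obtain k' where k': "linear_map C k'" "k' \<in> Arr C" "Dom C k' = Dom C b0'" "Cod C k' = Dom C b0"
    "b0 \<bullet> k' = m \<bullet> b0'" "b1 \<bullet> k' = m' \<bullet> b1'"
    using lin_pullback_mediate[OF P, of "m \<bullet> b0'" "m' \<bullet> b1'"] D(1-12) D'(1-12) N N' by simp metis
  have "k' \<bullet> k = Ident C (Dom C b0)"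
  proof (rule lin_pullback_ext[OF P])
    show "b0 \<bullet> k' \<bullet> k = b0 \<bullet> Ident C (Dom C b0)" "b1 \<bullet> k' \<bullet> k = b1 \<bullet> Ident C (Dom C b0)"
      using k k'(1-4) D(1-12) D'(1-12) N N'
      by (simp_all add: Comp_reassoc[OF k'(5)] Comp_reassoc[OF k'(6)] lin_iso_cancel[OF n(1)] lin_iso_cancel[OF n'(1)])
  qed (use k k' D D' in simp_all)
  moreover have "k \<bullet> k' = Ident C (Dom C b0')"
  proof (rule lin_pullback_ext[OF P'])
    show "b0' \<bullet> k \<bullet> k' = b0' \<bullet> Ident C (Dom C b0')" "b1' \<bullet> k \<bullet> k' = b1' \<bullet> Ident C (Dom C b0')"
      using k(1-4) k' D(1-12) D'(1-12) N N'
      by (simp_all add: Comp_reassoc[OF k(5)] Comp_reassoc[OF k(6)]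
          lin_iso_cancel[OF lin_iso_sym[OF n(1)]] lin_iso_cancel[OF lin_iso_sym[OF n'(1)]])
  qed (use k k' D D' in simp_all)
  ultimately show thesis
    using k k' by (intro that[of k k']) (simp_all add: lin_iso_def)
qed

lemma lin_pullback_iso:
  assumes "lin_iso a a'" "linear_map C l" "Cod C l = Cod C a"
  shows "lin_pullback a l (a' \<bullet> l) (Ident C (Dom C l))"
proof -
  note A = lin_isoD(1-6)[OF assms(1)]
  have L: "l \<in> Arr C" using assms(2) by (rule linear_map_Arr)
  show ?thesis
  proof (rule lin_pullbackI)
    fix c0 c1
    assume c: "linear_map C c0" "linear_map C c1" "c0 \<in> Arr C" "c1 \<in> Arr C" "Dom C c0 = Dom C c1"
      "Cod C c0 = Dom C a" "Cod C c1 = Dom C l" "a \<bullet> c0 = l \<bullet> c1"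
    show "\<exists>h. linear_map C h \<and> Dom C h = Dom C c1 \<and> Cod C h = Dom C (a' \<bullet> l) \<and>
        (a' \<bullet> l) \<bullet> h = c0 \<and> Ident C (Dom C l) \<bullet> h = c1"
      by (rule exI[of _ c1])
        (use c(1-7) A L assms in \<open>simp add: lin_iso_cancel[OF assms(1)] flip: c(8)\<close>)
  qed (use A L assms in \<open>simp_all add: lin_iso_cancel[OF lin_iso_sym[OF assms(1)]]\<close>)
qed

end

section \<open>Linear structural maps and pullbacks of diagonals\<close>

context cartesian_reverse_derivative_category
begin

lemma linear_map_Cross [simp]: "\<lbrakk>linear_map C f; linear_map C g\<rbrakk> \<Longrightarrow> linear_map C (f \<times>\<^sub>a g)"
  by (simp add: Cross_Pairing linear_map_Arr)

lemma linear_map_Diag [simp]: "X \<in> Obj C \<Longrightarrow> linear_map C (Diag C X)"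
  by (simp add: Diag_def)

lemma lin_iso_prod_assoc:
  "\<lbrakk>X \<in> Obj C; Y \<in> Obj C; Z \<in> Obj C\<rbrakk> \<Longrightarrow> lin_iso (prod_assoc C X Y Z) (prod_assoc_inv X Y Z)"
  by (simp add: lin_iso_def prod_assoc_inverse) (simp add: prod_assoc_def prod_assoc_inv_def)

lemma lin_iso_prod_swap:
  "\<lbrakk>X \<in> Obj C; Y \<in> Obj C\<rbrakk> \<Longrightarrow> lin_iso (prod_swap C X Y) (prod_swap C Y X)"
  by (simp add: lin_iso_def prod_swap_inverse) (simp add: prod_swap_def)

lemma lin_iso_prod_interchange:
  "\<lbrakk>W \<in> Obj C; X \<in> Obj C; Y \<in> Obj C; Z \<in> Obj C\<rbrakk>
    \<Longrightarrow> lin_iso (prod_interchange W X Y Z) (prod_interchange W Y X Z)"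
  by (simp add: lin_iso_def prod_interchange_inverse) (simp add: prod_interchange_def)

lemma lin_iso_Term:
  assumes "X \<in> Obj C"
  shows "lin_iso (Proj1 C (Term C) X) \<langle>Bang C X, Ident C X\<rangle>"
    and "lin_iso (Proj0 C X (Term C)) \<langle>Ident C X, Bang C X\<rangle>"
  using assms by (simp_all add: lin_iso_def Term_iso del: Pairing_Comp)

text \<open>The diagonal is monic, so its kernel pair is trivial.\<close>

lemma lin_pullback_Diag: "X \<in> Obj C \<Longrightarrow> lin_pullback (Diag C X) (Diag C X) (Ident C X) (Ident C X)"
proof -
  assume X: "X \<in> Obj C"
  show ?thesis
  proof (rule lin_pullbackI)
    fix c0 c1
    assume c: "linear_map C c0" "linear_map C c1" "c0 \<in> Arr C" "c1 \<in> Arr C" "Dom C c0 = Dom C c1"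
      "Cod C c0 = Dom C (Diag C X)" "Cod C c1 = Dom C (Diag C X)" "Diag C X \<bullet> c0 = Diag C X \<bullet> c1"
    have "\<langle>c0, c0\<rangle> = \<langle>c1, c1\<rangle>"
      using c X by (simp add: Diag_def)
    then have "c0 = c1"
      by (rule Pairing_inject) (use c X in simp_all)
    then show "\<exists>h. linear_map C h \<and> Dom C h = Dom C c1 \<and> Cod C h = Dom C (Ident C X) \<and>
        Ident C X \<bullet> h = c0 \<and> Ident C X \<bullet> h = c1"
      using c X by (intro exI[of _ c1]) simp
  qed (use X in simp_all)
qed

text \<open>A recognition principle for the Frobenius squares: two maps out of \<open>X \<times> X\<close> that agree on the
  diagonal and whose values at \<open>\<langle>a, b\<rangle>\<close> and \<open>\<langle>c, d\<rangle>\<close> agree only if \<open>a = b = c = d\<close> have \<open>X\<close>, embedded diagonally on both sides, as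
  their pullback. The mediating arrow of a cone is then any of its four components.\<close>

lemma lin_pullback_Diag_Diag:
  assumes X: "X \<in> Obj C" and "linear_map C r" "linear_map C l" "Dom C r = X \<times>\<^sub>o X" "Dom C l = X \<times>\<^sub>o X"
    and "Cod C r = Cod C l" "r \<bullet> Diag C X = l \<bullet> Diag C X"
    and eq: "\<And>a b c d. \<lbrakk>{a, b, c, d} \<subseteq> Hom C (Dom C d) X; r \<bullet> \<langle>a, b\<rangle> = l \<bullet> \<langle>c, d\<rangle>\<rbrakk>
      \<Longrightarrow> a = d \<and> b = d \<and> c = d"
  shows "lin_pullback r l (Diag C X) (Diag C X)"
proof (rule lin_pullbackI)
  fix c0 c1
  assume c: "linear_map C c0" "linear_map C c1" "c0 \<in> Arr C" "c1 \<in> Arr C" "Dom C c0 = Dom C c1"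
    "Cod C c0 = Dom C r" "Cod C c1 = Dom C l" "r \<bullet> c0 = l \<bullet> c1"
  let ?a = "Proj0 C X X \<bullet> c0" and ?b = "Proj1 C X X \<bullet> c0"
  let ?c = "Proj0 C X X \<bullet> c1" and ?d = "Proj1 C X X \<bullet> c1"
  have s: "c0 = \<langle>?a, ?b\<rangle>" "c1 = \<langle>?c, ?d\<rangle>"
    using c X assms(4,5) by simp_all
  have "r \<bullet> \<langle>?a, ?b\<rangle> = l \<bullet> \<langle>?c, ?d\<rangle>"
    using c(8) s by metis
  then have "?a = ?d \<and> ?b = ?d \<and> ?c = ?d"
    by (intro eq) (use c X assms(4,5) in \<open>simp_all add: Hom_iff\<close>)
  then have s': "c0 = \<langle>?d, ?d\<rangle>" "c1 = \<langle>?d, ?d\<rangle>"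
    using s by metis+
  have "Diag C X \<bullet> ?d = \<langle>?d, ?d\<rangle>" "linear_map C ?d" "Dom C ?d = Dom C c1" "Cod C ?d = Dom C (Diag C X)"
    using c(2,4,7) X assms(5) by (simp_all add: Diag_def)
  then show "\<exists>h. linear_map C h \<and> Dom C h = Dom C c1 \<and> Cod C h = Dom C (Diag C X) \<and>
      Diag C X \<bullet> h = c0 \<and> Diag C X \<bullet> h = c1"
    using s' by metis
next
  fix h k
  assume h: "h \<in> Arr C" "k \<in> Arr C" "Dom C h = Dom C k" "Cod C h = Dom C (Diag C X)" "Cod C k = Dom C (Diag C X)"
    and e: "Diag C X \<bullet> h = Diag C X \<bullet> k"
  have "\<langle>h, h\<rangle> = \<langle>k, k\<rangle>"
    using h e X by (simp add: Diag_def)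
  then show "h = k"
    by (rule Pairing_inject) (use h X in simp_all)
qed (use assms(1-7) in simp_all)

text \<open>On elements the first square compares \<open>\<langle>a, \<langle>a, b\<rangle>\<rangle>\<close> with \<open>\<langle>c, \<langle>d, d\<rangle>\<rangle>\<close> and the second one compares
  \<open>\<langle>\<langle>a, b\<rangle>, b\<rangle>\<close> with \<open>\<langle>\<langle>c, c\<rangle>, d\<rangle>\<close>; either equation forces all four entries to coincide.\<close>

lemma lin_pullback_Frobenius:
  assumes X: "X \<in> Obj C"
  shows "lin_pullback (prod_assoc C X X X \<bullet> (Diag C X \<times>\<^sub>a Ident C X)) (Ident C X \<times>\<^sub>a Diag C X) (Diag C X) (Diag C X)"
    and "lin_pullback (prod_assoc_inv X X X \<bullet> (Ident C X \<times>\<^sub>a Diag C X)) (Diag C X \<times>\<^sub>a Ident C X) (Diag C X) (Diag C X)"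
proof -
  have A: "linear_map C (prod_assoc C X X X)" "linear_map C (prod_assoc_inv X X X)"
    using lin_isoD(1,2)[OF lin_iso_prod_assoc[OF X X X]] .
  show "lin_pullback (prod_assoc C X X X \<bullet> (Diag C X \<times>\<^sub>a Ident C X)) (Ident C X \<times>\<^sub>a Diag C X) (Diag C X) (Diag C X)"
  proof (rule lin_pullback_Diag_Diag[OF X])
    fix a b c d
    assume t: "{a, b, c, d} \<subseteq> Hom C (Dom C d) X"
      and e: "(prod_assoc C X X X \<bullet> (Diag C X \<times>\<^sub>a Ident C X)) \<bullet> \<langle>a, b\<rangle> = (Ident C X \<times>\<^sub>a Diag C X) \<bullet> \<langle>c, d\<rangle>"
    from t have T: "a \<in> Arr C" "b \<in> Arr C" "c \<in> Arr C" "d \<in> Arr C" "Dom C a = Dom C d" "Dom C b = Dom C d"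
      "Dom C c = Dom C d" "Cod C a = X" "Cod C b = X" "Cod C c = X" "Cod C d = X"
      by (simp_all add: Hom_iff)
    have "\<langle>a, \<langle>a, b\<rangle>\<rangle> = \<langle>c, \<langle>d, d\<rangle>\<rangle>"
      using e T X by (simp add: prod_assoc_def Diag_def Cross_Pairing)
    then have "a = c" "\<langle>a, b\<rangle> = \<langle>d, d\<rangle>"
      by (rule Pairing_inject; use T in simp)+
    moreover from this(2) have "a = d" "b = d"
      by (rule Pairing_inject; use T in simp)+
    ultimately show "a = d \<and> b = d \<and> c = d" by simp
  qed (use X A in \<open>simp_all add: Diag_coassoc\<close>)
  show "lin_pullback (prod_assoc_inv X X X \<bullet> (Ident C X \<times>\<^sub>a Diag C X)) (Diag C X \<times>\<^sub>a Ident C X) (Diag C X) (Diag C X)"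
  proof (rule lin_pullback_Diag_Diag[OF X])
    fix a b c d
    assume t: "{a, b, c, d} \<subseteq> Hom C (Dom C d) X"
      and e: "(prod_assoc_inv X X X \<bullet> (Ident C X \<times>\<^sub>a Diag C X)) \<bullet> \<langle>a, b\<rangle> = (Diag C X \<times>\<^sub>a Ident C X) \<bullet> \<langle>c, d\<rangle>"
    from t have T: "a \<in> Arr C" "b \<in> Arr C" "c \<in> Arr C" "d \<in> Arr C" "Dom C a = Dom C d" "Dom C b = Dom C d"
      "Dom C c = Dom C d" "Cod C a = X" "Cod C b = X" "Cod C c = X" "Cod C d = X"
      by (simp_all add: Hom_iff)
    have "\<langle>\<langle>a, b\<rangle>, b\<rangle> = \<langle>\<langle>c, c\<rangle>, d\<rangle>"
      using e T X by (simp add: prod_assoc_inv_def Diag_def Cross_Pairing)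
    then have "\<langle>a, b\<rangle> = \<langle>c, c\<rangle>" "b = d"
      by (rule Pairing_inject; use T in simp)+
    moreover from this(1) have "a = c" "b = c"
      by (rule Pairing_inject; use T in simp)+
    ultimately show "a = d \<and> b = d \<and> c = d" by simp
  qed (use X A in \<open>simp_all add: Diag_coassoc_inv\<close>)
qed

end

section \<open>Decorated spans up to isomorphism\<close>

context optimization_domain
begin

lemma R_Obj [simp]: "R \<in> Obj C"
  by (rule R_in_Obj)

text \<open>An open objective is determined by its legs and its objective, because the apex and the boundaries
  are the domain and the codomains of the legs. It is therefore handled as a triple \<open>l\<close>, \<open>r\<close>, \<open>f\<close>.\<close>

definition dec_span :: "'b \<Rightarrow> 'b \<Rightarrow> 'b \<Rightarrow> bool" where
  "dec_span l r f \<longleftrightarrow> linear_map C l \<and> linear_map C r \<and> l \<in> Arr C \<and> r \<in> Arr C \<and> f \<in> Arr C \<and>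
     Dom C r = Dom C l \<and> Dom C f = Dom C l \<and> Cod C f = R"

definition dspan :: "'b \<Rightarrow> 'b \<Rightarrow> 'b \<Rightarrow> ('a, 'b) open_objective set" where
  "dspan l r f = objective_class C R (Cod C l) (Cod C r)
     \<lparr>apex = Dom C l, lleg = l, rleg = r, objective = f\<rparr>"

lemma open_objectives_iff:
  "s \<in> open_objectives C R X Y \<longleftrightarrow>
     dec_span (lleg s) (rleg s) (objective s) \<and> Dom C (lleg s) = apex s \<and> Cod C (lleg s) = X \<and> Cod C (rleg s) = Y"
  using Dom_Obj[of "lleg s"]
  by (auto simp: open_objectives_def dec_span_def Hom_Lin_iff O_obj_def Hom_iff linear_map_Arr simp del: Dom_Obj)

lemma objective_iso_iff:
  "(s, t) \<in> objective_iso C R X Y \<longleftrightarrow> s \<in> open_objectives C R X Y \<and> t \<in> open_objectives C R X Y \<and>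
     (\<exists>n m. lin_iso n m \<and> Dom C n = apex s \<and> Cod C n = apex t \<and>
        lleg t \<bullet> n = lleg s \<and> rleg t \<bullet> n = rleg s \<and> objective t \<bullet> n = objective s)"
  unfolding objective_iso_def iso_arrow_Lin_iff O_map_def by auto

lemma equiv_objective_iso: "equiv (open_objectives C R X Y) (objective_iso C R X Y)"
proof (rule equivI)
  show "objective_iso C R X Y \<subseteq> open_objectives C R X Y \<times> open_objectives C R X Y"
    by (auto simp: objective_iso_iff)
  show "refl_on (open_objectives C R X Y) (objective_iso C R X Y)"
  proof (rule refl_onI)
    fix s assume s: "s \<in> open_objectives C R X Y"
    have "apex s \<in> Obj C"
      using s by (simp add: open_objectives_def)
    moreover have "dec_span (lleg s) (rleg s) (objective s)" "Dom C (lleg s) = apex s"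
      using s by (simp_all add: open_objectives_iff)
    ultimately show "(s, s) \<in> objective_iso C R X Y"
      using s unfolding objective_iso_iff
      by (intro conjI exI[of _ "Ident C (apex s)"]) (simp_all add: lin_iso_Ident dec_span_def)
  qed
  show "sym (objective_iso C R X Y)"
  proof (rule symI)
    fix s t assume "(s, t) \<in> objective_iso C R X Y"
    then obtain n m where *: "s \<in> open_objectives C R X Y" "t \<in> open_objectives C R X Y"
      and n: "lin_iso n m" "Dom C n = apex s" "Cod C n = apex t"
        "lleg t \<bullet> n = lleg s" "rleg t \<bullet> n = rleg s" "objective t \<bullet> n = objective s"
      unfolding objective_iso_iff by blast
    note N = lin_isoD[OF n(1)] n(2,3)
    have T: "dec_span (lleg t) (rleg t) (objective t)" "Dom C (lleg t) = apex t"
      using *(2) by (simp_all add: open_objectives_iff)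
    have "lleg s \<bullet> m = lleg t" "rleg s \<bullet> m = rleg t" "objective s \<bullet> m = objective t"
      using N T by (simp_all add: dec_span_def flip: n(4-6))
    then show "(t, s) \<in> objective_iso C R X Y"
      unfolding objective_iso_iff using * N lin_iso_sym[OF n(1)] by auto
  qed
  show "trans (objective_iso C R X Y)"
  proof (rule transI)
    fix s t u assume "(s, t) \<in> objective_iso C R X Y" "(t, u) \<in> objective_iso C R X Y"
    then obtain n m n' m' where *: "s \<in> open_objectives C R X Y" "u \<in> open_objectives C R X Y"
      and n: "lin_iso n m" "Dom C n = apex s" "Cod C n = apex t"
        "lleg t \<bullet> n = lleg s" "rleg t \<bullet> n = rleg s" "objective t \<bullet> n = objective s"
      and n': "lin_iso n' m'" "Dom C n' = apex t" "Cod C n' = apex u"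
        "lleg u \<bullet> n' = lleg t" "rleg u \<bullet> n' = rleg t" "objective u \<bullet> n' = objective t"
      unfolding objective_iso_iff by blast
    note N = lin_isoD(1-6)[OF n(1)] n(2,3) and N' = lin_isoD(1-6)[OF n'(1)] n'(2,3)
    have U: "dec_span (lleg u) (rleg u) (objective u)" "Dom C (lleg u) = apex u"
      using *(2) by (simp_all add: open_objectives_iff)
    have "lin_iso (n' \<bullet> n) (m \<bullet> m')"
      using N N' by (intro lin_iso_Comp n(1) n'(1)) simp
    moreover have "lleg u \<bullet> n' \<bullet> n = lleg s" "rleg u \<bullet> n' \<bullet> n = rleg s" "objective u \<bullet> n' \<bullet> n = objective s"
      using N N' U by (simp_all add: dec_span_def Comp_reassoc[OF n'(4)] Comp_reassoc[OF n'(5)]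
          Comp_reassoc[OF n'(6)] n(4-6))
    ultimately show "(s, u) \<in> objective_iso C R X Y"
      unfolding objective_iso_iff using * N N' by (intro conjI exI[of _ "n' \<bullet> n"] exI[of _ "m \<bullet> m'"]) auto
  qed
qed

lemma dspan_eqI:
  assumes "dec_span l r f" "lin_iso n m" "Cod C n = Dom C l"
    and "l \<bullet> n = l'" "r \<bullet> n = r'" "f \<bullet> n = f'"
  shows "dspan l' r' f' = dspan l r f"
proof -
  note N = lin_isoD(1-6)[OF assms(2)]
  have S: "dec_span l' r' f'" "Dom C l' = Dom C n" "Cod C l' = Cod C l" "Cod C r' = Cod C r"
    using assms(1,3) N unfolding assms(4-6)[symmetric] dec_span_def by simp_all
  have "(\<lparr>apex = Dom C l', lleg = l', rleg = r', objective = f'\<rparr>,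
         \<lparr>apex = Dom C l, lleg = l, rleg = r, objective = f\<rparr>) \<in> objective_iso C R (Cod C l) (Cod C r)"
    unfolding objective_iso_iff open_objectives_iff using assms S by auto
  from equiv_class_eq[OF equiv_objective_iso this] show ?thesis
    by (simp add: dspan_def objective_class_def S)
qed

lemma objective_class_eq_dspan:
  assumes "s \<in> open_objectives C R X Y"
  shows "objective_class C R X Y s = dspan (lleg s) (rleg s) (objective s)"
  using assms by (cases s) (simp add: open_objectives_iff dspan_def)

definition some_rep :: "('a, 'b) open_objective set \<Rightarrow> ('a, 'b) open_objective" where
  "some_rep c = (SOME s. s \<in> c)"

lemma some_rep_dspan:
  assumes "dec_span l r f"
  obtains n m where "lin_iso n m" "Dom C n = Dom C l"
    "Cod C n = Dom C (lleg (some_rep (dspan l r f)))"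
    "lleg (some_rep (dspan l r f)) \<bullet> n = l" "rleg (some_rep (dspan l r f)) \<bullet> n = r"
    "objective (some_rep (dspan l r f)) \<bullet> n = f"
    "dec_span (lleg (some_rep (dspan l r f))) (rleg (some_rep (dspan l r f))) (objective (some_rep (dspan l r f)))"
    "Cod C (lleg (some_rep (dspan l r f))) = Cod C l" "Cod C (rleg (some_rep (dspan l r f))) = Cod C r"
proof -
  let ?s = "\<lparr>apex = Dom C l, lleg = l, rleg = r, objective = f\<rparr>"
  have "?s \<in> open_objectives C R (Cod C l) (Cod C r)"
    using assms by (simp add: open_objectives_iff)
  then have "?s \<in> dspan l r f"
    unfolding dspan_def objective_class_def by (rule equiv_class_self[OF equiv_objective_iso])
  then have "some_rep (dspan l r f) \<in> dspan l r f"
    unfolding some_rep_def by (rule someI)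
  then have "(?s, some_rep (dspan l r f)) \<in> objective_iso C R (Cod C l) (Cod C r)"
    by (simp add: dspan_def objective_class_def)
  then show thesis
    unfolding objective_iso_iff open_objectives_iff by (auto intro: that)
qed

end

section \<open>Composition and tensor of decorated spans\<close>

locale optimization_domain_with_limits = optimization_domain +
  assumes finite_limits: "has_finite_limits (Lin C)"
begin

text \<open>Representatives and a pullback are chosen here; \<open>span_comp_dspan\<close> shows that every other choice
  gives the same class.\<close>

definition span_comp :: "('a, 'b) open_objective set \<Rightarrow> ('a, 'b) open_objective set
    \<Rightarrow> ('a, 'b) open_objective set" (infixr "\<odot>" 75) where
  "d \<odot> c = (let s = some_rep c; t = some_rep d;
     (b0, b1) = (SOME (b0, b1). lin_pullback (rleg s) (lleg t) b0 b1)
     in dspan (lleg s \<bullet> b0) (rleg t \<bullet> b1) (objective s \<bullet> b0 \<^bold>+ objective t \<bullet> b1))"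

definition span_tensor :: "('a, 'b) open_objective set \<Rightarrow> ('a, 'b) open_objective set
    \<Rightarrow> ('a, 'b) open_objective set" (infixr "\<boxtimes>" 80) where
  "c \<boxtimes> d = (let s = some_rep c; t = some_rep d; N = Dom C (lleg s); M = Dom C (lleg t)
     in dspan (lleg s \<times>\<^sub>a lleg t) (rleg s \<times>\<^sub>a rleg t)
          (objective s \<bullet> Proj0 C N M \<^bold>+ objective t \<bullet> Proj1 C N M))"

lemma dec_span_comp:
  assumes "dec_span l r f" "dec_span l' r' f'" "lin_pullback r l' b0 b1"
  shows "dec_span (l \<bullet> b0) (r' \<bullet> b1) (f \<bullet> b0 \<^bold>+ f' \<bullet> b1)"
  using assms(1,2) lin_pullbackD(3-12)[OF assms(3)] by (simp add: dec_span_def)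

text \<open>The pullback of the chosen representatives is isomorphic to the given one by \<open>lin_pullback_unique\<close>,
  and that isomorphism carries the legs and the objective of one composite to those of the other.\<close>

lemma span_comp_dspan:
  assumes "dec_span l r f" "dec_span l' r' f'" "lin_pullback r l' b0 b1"
  shows "dspan l' r' f' \<odot> dspan l r f = dspan (l \<bullet> b0) (r' \<bullet> b1) (f \<bullet> b0 \<^bold>+ f' \<bullet> b1)"
proof -
  define s where "s = some_rep (dspan l r f)"
  define t where "t = some_rep (dspan l' r' f')"
  define c where "c = (SOME (b0, b1). lin_pullback (rleg s) (lleg t) b0 b1)"
  obtain n m where n: "lin_iso n m" "Dom C n = Dom C l" "Cod C n = Dom C (lleg s)"
    "lleg s \<bullet> n = l" "rleg s \<bullet> n = r" "objective s \<bullet> n = f"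
    "dec_span (lleg s) (rleg s) (objective s)" "Cod C (rleg s) = Cod C r"
    using some_rep_dspan[OF assms(1)] unfolding s_def by metis
  obtain n' m' where n': "lin_iso n' m'" "Dom C n' = Dom C l'" "Cod C n' = Dom C (lleg t)"
    "lleg t \<bullet> n' = l'" "rleg t \<bullet> n' = r'" "objective t \<bullet> n' = f'"
    "dec_span (lleg t) (rleg t) (objective t)" "Cod C (lleg t) = Cod C l'"
    using some_rep_dspan[OF assms(2)] unfolding t_def by metis
  note D = lin_pullbackD(3-12)[OF assms(3)]
  note N = lin_isoD(1-6)[OF n(1)] n(2,3) and N' = lin_isoD(1-6)[OF n'(1)] n'(2,3)
  have "Cod C (rleg s) = Cod C (lleg t)"
    using n(8) n'(8) lin_pullbackD(9)[OF assms(3)] assms(1) by simp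
  then have "\<exists>b0 b1. lin_pullback (rleg s) (lleg t) b0 b1"
    using lin_pullback_exists[OF finite_limits, of "rleg s" "lleg t"] n(7) n'(7)
    unfolding dec_span_def by metis
  then have "lin_pullback (rleg s) (lleg t) (fst c) (snd c)"
    unfolding c_def by (metis (mono_tags, lifting) case_prod_conv case_prod_unfold someI)
  then obtain c0 c1 where c: "c = (c0, c1)" "lin_pullback (rleg s) (lleg t) c0 c1"
    by (metis prod.collapse)
  note E = lin_pullbackD(3-12)[OF c(2)]
  obtain k k' where k: "lin_iso k k'" "Dom C k = Dom C b0" "Cod C k = Dom C c0" "c0 \<bullet> k = n \<bullet> b0" "c1 \<bullet> k = n' \<bullet> b1"
    using lin_pullback_unique[OF assms(3) c(2) n(1) _ _ n(5) n'(1) _ _ n'(4)] N N' assms(1,2) n(7) n'(7)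
    unfolding dec_span_def by metis
  note K = lin_isoD(1-6)[OF k(1)] k(2,3)
  have S: "dec_span (lleg s \<bullet> c0) (rleg t \<bullet> c1) (objective s \<bullet> c0 \<^bold>+ objective t \<bullet> c1)"
    by (rule dec_span_comp[OF n(7) n'(7) c(2)])
  have "dspan (l \<bullet> b0) (r' \<bullet> b1) (f \<bullet> b0 \<^bold>+ f' \<bullet> b1) =
      dspan (lleg s \<bullet> c0) (rleg t \<bullet> c1) (objective s \<bullet> c0 \<^bold>+ objective t \<bullet> c1)"
    by (rule dspan_eqI[OF S k(1)])
      (use K N N' D E n(7) n'(7) assms(1,2) in \<open>simp_all add: dec_span_def k(4,5) Comp_reassoc[OF n(4)]
        Comp_reassoc[OF n(6)] Comp_reassoc[OF n'(5)] Comp_reassoc[OF n'(6)]\<close>)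
  then show ?thesis
    by (simp add: span_comp_def c(1) flip: s_def t_def c_def)
qed

lemma dec_span_tensor:
  assumes "dec_span l r f" "dec_span l' r' f'"
  shows "dec_span (l \<times>\<^sub>a l') (r \<times>\<^sub>a r') (f \<bullet> Proj0 C (Dom C l) (Dom C l') \<^bold>+ f' \<bullet> Proj1 C (Dom C l) (Dom C l'))"
  using assms by (simp add: dec_span_def Cross_Pairing)

lemma span_tensor_dspan:
  assumes "dec_span l r f" "dec_span l' r' f'"
  shows "dspan l r f \<boxtimes> dspan l' r' f' =
    dspan (l \<times>\<^sub>a l') (r \<times>\<^sub>a r') (f \<bullet> Proj0 C (Dom C l) (Dom C l') \<^bold>+ f' \<bullet> Proj1 C (Dom C l) (Dom C l'))"
proof -
  define s where "s = some_rep (dspan l r f)"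
  define t where "t = some_rep (dspan l' r' f')"
  obtain n m where n: "lin_iso n m" "Dom C n = Dom C l" "Cod C n = Dom C (lleg s)"
    "lleg s \<bullet> n = l" "rleg s \<bullet> n = r" "objective s \<bullet> n = f"
    "dec_span (lleg s) (rleg s) (objective s)"
    using some_rep_dspan[OF assms(1)] unfolding s_def by metis
  obtain n' m' where n': "lin_iso n' m'" "Dom C n' = Dom C l'" "Cod C n' = Dom C (lleg t)"
    "lleg t \<bullet> n' = l'" "rleg t \<bullet> n' = r'" "objective t \<bullet> n' = f'"
    "dec_span (lleg t) (rleg t) (objective t)"
    using some_rep_dspan[OF assms(2)] unfolding t_def by metis
  note N = lin_isoD(1-6)[OF n(1)] n(2,3) and N' = lin_isoD(1-6)[OF n'(1)] n'(2,3)
  have K: "lin_iso (n \<times>\<^sub>a n') (m \<times>\<^sub>a m')" by (rule lin_iso_Cross[OF n(1) n'(1)])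
  have "dspan (l \<times>\<^sub>a l') (r \<times>\<^sub>a r') (f \<bullet> Proj0 C (Dom C l) (Dom C l') \<^bold>+ f' \<bullet> Proj1 C (Dom C l) (Dom C l')) =
      dspan (lleg s \<times>\<^sub>a lleg t) (rleg s \<times>\<^sub>a rleg t)
        (objective s \<bullet> Proj0 C (Dom C (lleg s)) (Dom C (lleg t)) \<^bold>+ objective t \<bullet> Proj1 C (Dom C (lleg s)) (Dom C (lleg t)))"
    by (rule dspan_eqI[OF dec_span_tensor[OF n(7) n'(7)] K])
      (use N N' n(7) n'(7) assms in \<open>simp_all add: dec_span_def Cross_Pairing Comp_reassoc[OF n(4)] Comp_reassoc[OF n(5)]
        Comp_reassoc[OF n(6)] Comp_reassoc[OF n'(4)] Comp_reassoc[OF n'(5)] Comp_reassoc[OF n'(6)]\<close>)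
  then show ?thesis
    by (simp add: span_tensor_def Let_def flip: s_def t_def)
qed

text \<open>A span with the identity decoration, which is the zero objective. The graph of a linear map \<open>a\<close> on
  \<open>X\<close> is \<open>sspan (Ident C X) a\<close>, and its cograph is \<open>sspan a (Ident C X)\<close>.\<close>

definition sspan :: "'b \<Rightarrow> 'b \<Rightarrow> ('a, 'b) open_objective set" where
  "sspan l r = dspan l r (Zero C (Dom C l) R)"

lemma dec_span_Zero:
  "\<lbrakk>linear_map C l; linear_map C r; Dom C r = Dom C l\<rbrakk> \<Longrightarrow> dec_span l r (Zero C (Dom C l) R)"
  by (simp add: dec_span_def linear_map_Arr)

lemma span_class_eq_sspan:
  "\<lbrakk>l \<in> Arr C; Dom C l = N; Cod C l = X; Cod C r = Y\<rbrakk> \<Longrightarrow> span_class C R X Y N l r = sspan l r"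
  by (auto simp: span_class_def sspan_def dspan_def id_decoration_def O_map_def O_unit_def)

lemma graph_comp:
  assumes "dec_span l r f" "linear_map C a" "Dom C a = Cod C r" "X = Cod C r"
  shows "sspan (Ident C X) a \<odot> dspan l r f = dspan l (a \<bullet> r) f"
proof -
  have T: "l \<in> Arr C" "r \<in> Arr C" "f \<in> Arr C" "a \<in> Arr C" "linear_map C r" "Dom C r = Dom C l" "Dom C f = Dom C l" "Cod C f = R"
    using assms by (simp_all add: dec_span_def linear_map_Arr)
  have "lin_pullback r (Ident C X) (Ident C (Dom C r)) (Ident C X \<bullet> r)"
    using T assms by (intro lin_pullback_sym[OF lin_pullback_iso] lin_iso_Ident) simp_all
  then show ?thesis
    using span_comp_dspan[OF assms(1) dec_span_Zero[of "Ident C X" a]] T assms(2-4)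
    by (simp add: sspan_def)
qed

text \<open>Pulling a leg \<open>l\<close> back along an isomorphism \<open>a\<close> replaces it by \<open>a' \<bullet> l\<close>, where \<open>a'\<close> is the inverse
  of \<open>a\<close>.\<close>

lemma comp_graph_iso:
  assumes "dec_span l r f" "lin_iso a a'" "Cod C a = Cod C l" "X = Dom C a"
  shows "dspan l r f \<odot> sspan (Ident C X) a = dspan (a' \<bullet> l) r f"
proof -
  have T: "l \<in> Arr C" "r \<in> Arr C" "f \<in> Arr C" "linear_map C l" "Dom C r = Dom C l" "Dom C f = Dom C l" "Cod C f = R"
    using assms(1) by (simp_all add: dec_span_def)
  note A = lin_isoD(1-6)[OF assms(2)]
  have P: "lin_pullback a l (a' \<bullet> l) (Ident C (Dom C l))"
    using lin_pullback_iso[OF assms(2) T(4)] assms(3) by simp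
  have S: "dec_span (Ident C X) a (Zero C (Dom C (Ident C X)) R)"
    by (rule dec_span_Zero) (use A assms(4) in simp_all)
  show ?thesis
    unfolding sspan_def span_comp_dspan[OF S assms(1) P]
    using T A assms(3,4) by simp
qed

lemma comp_cograph:
  assumes "dec_span l r f" "linear_map C a" "Dom C a = Cod C l" "X = Cod C l"
  shows "dspan l r f \<odot> sspan a (Ident C X) = dspan (a \<bullet> l) r f"
proof -
  have T: "l \<in> Arr C" "r \<in> Arr C" "f \<in> Arr C" "a \<in> Arr C" "linear_map C l" "Dom C r = Dom C l" "Dom C f = Dom C l" "Cod C f = R"
    using assms by (simp_all add: dec_span_def linear_map_Arr)
  have P: "lin_pullback (Ident C X) l (Ident C X \<bullet> l) (Ident C (Dom C l))"
    using T assms by (intro lin_pullback_iso lin_iso_Ident) simp_all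
  have S: "dec_span a (Ident C X) (Zero C (Dom C a) R)"
    by (rule dec_span_Zero) (use T assms in simp_all)
  show ?thesis
    unfolding sspan_def span_comp_dspan[OF S assms(1) P]
    using T assms(3,4) by simp
qed

lemma sspan_comp:
  assumes "linear_map C l" "linear_map C r" "Dom C r = Dom C l"
    and "linear_map C l'" "linear_map C r'" "Dom C r' = Dom C l'" "lin_pullback r l' b0 b1"
  shows "sspan l' r' \<odot> sspan l r = sspan (l \<bullet> b0) (r' \<bullet> b1)"
  using span_comp_dspan[OF dec_span_Zero[OF assms(1-3)] dec_span_Zero[OF assms(4-6)] assms(7)]
    lin_pullbackD(3-12)[OF assms(7)] assms(1-6)
  by (simp add: sspan_def linear_map_Arr)

lemma graph_comp_sspan:
  "\<lbrakk>linear_map C l; linear_map C r; Dom C r = Dom C l; linear_map C a; Dom C a = Cod C r; X = Cod C r\<rbrakk>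
    \<Longrightarrow> sspan (Ident C X) a \<odot> sspan l r = sspan l (a \<bullet> r)"
  using graph_comp[OF dec_span_Zero] by (simp add: sspan_def)

lemma sspan_comp_graph_iso:
  "\<lbrakk>linear_map C l; linear_map C r; Dom C r = Dom C l; lin_iso a a'; Cod C a = Cod C l; X = Dom C a\<rbrakk>
    \<Longrightarrow> sspan l r \<odot> sspan (Ident C X) a = sspan (a' \<bullet> l) r"
  using comp_graph_iso[OF dec_span_Zero, of l r a a' X] lin_isoD(1-6)[of a a']
  by (simp add: sspan_def linear_map_Arr)

lemma sspan_comp_cograph:
  "\<lbrakk>linear_map C l; linear_map C r; Dom C r = Dom C l; linear_map C a; Dom C a = Cod C l; X = Cod C l\<rbrakk>
    \<Longrightarrow> sspan l r \<odot> sspan a (Ident C X) = sspan (a \<bullet> l) r"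
  using comp_cograph[OF dec_span_Zero] by (simp add: sspan_def linear_map_Arr)

lemma sspan_tensor:
  "\<lbrakk>linear_map C l; linear_map C r; Dom C r = Dom C l; linear_map C l'; linear_map C r'; Dom C r' = Dom C l'\<rbrakk>
    \<Longrightarrow> sspan l r \<boxtimes> sspan l' r' = sspan (l \<times>\<^sub>a l') (r \<times>\<^sub>a r')"
  using span_tensor_dspan[OF dec_span_Zero dec_span_Zero, of l r l' r']
  by (simp add: sspan_def linear_map_Arr)

text \<open>Both bracketings are computed on one apex, the pullback \<open>d0, d1\<close> of the two inner pullbacks. The
  objectives then agree because addition is associative and \<open>b1 \<bullet> d0 = c0 \<bullet> d1\<close>.\<close>

lemma span_comp_assoc:
  assumes "dec_span l1 r1 f1" "dec_span l2 r2 f2" "dec_span l3 r3 f3" "Cod C r1 = Cod C l2" "Cod C r2 = Cod C l3"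
  shows "(dspan l3 r3 f3 \<odot> dspan l2 r2 f2) \<odot> dspan l1 r1 f1 = dspan l3 r3 f3 \<odot> (dspan l2 r2 f2 \<odot> dspan l1 r1 f1)"
proof -
  have L: "linear_map C r1" "linear_map C l2" "linear_map C r2" "linear_map C l3"
    using assms by (simp_all add: dec_span_def)
  obtain b0 b1 where P: "lin_pullback r1 l2 b0 b1"
    using lin_pullback_exists[OF finite_limits L(1,2) assms(4)] .
  obtain c0 c1 where Q: "lin_pullback r2 l3 c0 c1"
    using lin_pullback_exists[OF finite_limits L(3,4) assms(5)] .
  note DP = lin_pullbackD[OF P] and DQ = lin_pullbackD[OF Q]
  obtain d0 d1 where S: "lin_pullback b1 c0 d0 d1"
    using lin_pullback_exists[OF finite_limits DP(4) DQ(3)] DP(12) DQ(11) assms(2)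
    unfolding dec_span_def by metis
  note DS = lin_pullbackD[OF S]
  have U: "lin_pullback (r2 \<bullet> b1) l3 d0 (c1 \<bullet> d1)"
    by (rule lin_pullback_paste[OF Q S])
  have V: "lin_pullback r1 (l2 \<bullet> c0) (b0 \<bullet> d0) d1"
    by (rule lin_pullback_sym[OF lin_pullback_paste[OF lin_pullback_sym[OF P] lin_pullback_sym[OF S]]])
  have T: "f1 \<bullet> b0 \<bullet> d0 \<in> Hom C (Dom C d0) R" "f2 \<bullet> b1 \<bullet> d0 \<in> Hom C (Dom C d0) R" "f3 \<bullet> c1 \<bullet> d1 \<in> Hom C (Dom C d0) R"
    using assms(1-3) DP(1-12) DQ(1-12) DS(1-12) by (simp_all add: dec_span_def Hom_iff)
  have "(dspan l3 r3 f3 \<odot> dspan l2 r2 f2) \<odot> dspan l1 r1 f1 =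
      dspan (l1 \<bullet> (b0 \<bullet> d0)) ((r3 \<bullet> c1) \<bullet> d1) (f1 \<bullet> (b0 \<bullet> d0) \<^bold>+ (f2 \<bullet> c0 \<^bold>+ f3 \<bullet> c1) \<bullet> d1)"
    by (simp only: span_comp_dspan[OF assms(2,3) Q] span_comp_dspan[OF assms(1) dec_span_comp[OF assms(2,3) Q] V])
  also have "(r3 \<bullet> c1) \<bullet> d1 = r3 \<bullet> (c1 \<bullet> d1)"
    using assms(1-3) DP(1-12) DQ(1-12) DS(1-12) by (simp add: dec_span_def)
  also have "l1 \<bullet> (b0 \<bullet> d0) = (l1 \<bullet> b0) \<bullet> d0"
    using assms(1-3) DP(1-12) DQ(1-12) DS(1-12) by (simp add: dec_span_def)
  also have "f1 \<bullet> (b0 \<bullet> d0) \<^bold>+ (f2 \<bullet> c0 \<^bold>+ f3 \<bullet> c1) \<bullet> d1 = f1 \<bullet> (b0 \<bullet> d0) \<^bold>+ (f2 \<bullet> b1 \<bullet> d0 \<^bold>+ f3 \<bullet> c1 \<bullet> d1)"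
    using assms(1-3) DP(1-12) DQ(1-12) DS by (simp add: dec_span_def)
  also have "\<dots> = (f1 \<bullet> b0 \<^bold>+ f2 \<bullet> b1) \<bullet> d0 \<^bold>+ f3 \<bullet> (c1 \<bullet> d1)"
    unfolding Add_assoc[OF T, symmetric]
    using assms(1-3) DP(1-12) DQ(1-12) DS(1-12) by (simp add: dec_span_def)
  also have "dspan ((l1 \<bullet> b0) \<bullet> d0) (r3 \<bullet> (c1 \<bullet> d1)) ((f1 \<bullet> b0 \<^bold>+ f2 \<bullet> b1) \<bullet> d0 \<^bold>+ f3 \<bullet> (c1 \<bullet> d1)) =
      dspan l3 r3 f3 \<odot> (dspan l2 r2 f2 \<odot> dspan l1 r1 f1)"
    by (simp only: span_comp_dspan[OF assms(1,2) P] span_comp_dspan[OF dec_span_comp[OF assms(1,2) P] assms(3) U])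
  finally show ?thesis .
qed

text \<open>On the product of the two pullbacks both sides have the same legs, and their objectives are the
  same sum of four terms in a different order.\<close>

lemma span_interchange:
  assumes "dec_span l1 r1 f1" "dec_span l2 r2 f2" "dec_span l1' r1' f1'" "dec_span l2' r2' f2'"
    and "Cod C r1 = Cod C l2" "Cod C r1' = Cod C l2'"
  shows "(dspan l2 r2 f2 \<odot> dspan l1 r1 f1) \<boxtimes> (dspan l2' r2' f2' \<odot> dspan l1' r1' f1') =
    (dspan l2 r2 f2 \<boxtimes> dspan l2' r2' f2') \<odot> (dspan l1 r1 f1 \<boxtimes> dspan l1' r1' f1')"
proof -
  have L: "linear_map C r1" "linear_map C l2" "linear_map C r1'" "linear_map C l2'"
    using assms by (simp_all add: dec_span_def)
  obtain b0 b1 where P: "lin_pullback r1 l2 b0 b1"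
    using lin_pullback_exists[OF finite_limits L(1,2) assms(5)] .
  obtain b0' b1' where P': "lin_pullback r1' l2' b0' b1'"
    using lin_pullback_exists[OF finite_limits L(3,4) assms(6)] .
  note D = lin_pullbackD(1-12)[OF P] and D' = lin_pullbackD(1-12)[OF P']
  note A = assms(1-4)[unfolded dec_span_def]
  define p q where "p = Proj0 C (Dom C b0) (Dom C b0')" and "q = Proj1 C (Dom C b0) (Dom C b0')"
  have pq: "p \<in> Arr C" "q \<in> Arr C" "Dom C p = Dom C b0 \<times>\<^sub>o Dom C b0'" "Dom C q = Dom C b0 \<times>\<^sub>o Dom C b0'"
    "Cod C p = Dom C b0" "Cod C q = Dom C b0'"
    using D D' by (simp_all add: p_def q_def)
  have T: "f1 \<bullet> b0 \<bullet> p \<in> Hom C (Dom C p) R" "f2 \<bullet> b1 \<bullet> p \<in> Hom C (Dom C p) R"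
    "f1' \<bullet> b0' \<bullet> q \<in> Hom C (Dom C p) R" "f2' \<bullet> b1' \<bullet> q \<in> Hom C (Dom C p) R"
    using A D D' pq by (simp_all add: Hom_iff)
  have "(l1 \<times>\<^sub>a l1') \<bullet> (b0 \<times>\<^sub>a b0') = (l1 \<bullet> b0) \<times>\<^sub>a (l1' \<bullet> b0')"
    "(r2 \<times>\<^sub>a r2') \<bullet> (b1 \<times>\<^sub>a b1') = (r2 \<bullet> b1) \<times>\<^sub>a (r2' \<bullet> b1')"
    using A D D' by (simp_all add: Cross_Pairing)
  moreover have "(f1 \<bullet> Proj0 C (Dom C l1) (Dom C l1') \<^bold>+ f1' \<bullet> Proj1 C (Dom C l1) (Dom C l1')) \<bullet> (b0 \<times>\<^sub>a b0') \<^bold>+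
      (f2 \<bullet> Proj0 C (Dom C l2) (Dom C l2') \<^bold>+ f2' \<bullet> Proj1 C (Dom C l2) (Dom C l2')) \<bullet> (b1 \<times>\<^sub>a b1') =
      (f1 \<bullet> b0 \<^bold>+ f2 \<bullet> b1) \<bullet> p \<^bold>+ (f1' \<bullet> b0' \<^bold>+ f2' \<bullet> b1') \<bullet> q"
    using A D D' pq Add_interchange[OF T] by (simp add: Cross_Pairing flip: p_def q_def)
  ultimately show ?thesis
    using A D D'
    by (simp add: span_comp_dspan[OF assms(1,2) P] span_comp_dspan[OF assms(3,4) P']
      span_tensor_dspan[OF assms(1,3)] span_tensor_dspan[OF assms(2,4)]
      span_tensor_dspan[OF dec_span_comp[OF assms(1,2) P] dec_span_comp[OF assms(3,4) P']]
      span_comp_dspan[OF dec_span_tensor[OF assms(1,3)] dec_span_tensor[OF assms(2,4)] lin_pullback_Cross[OF P P']]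
      flip: p_def q_def del: Add_Comp)
qed

text \<open>The form in which all naturality axioms are proved. An isomorphism \<open>n\<close> of apexes that carries
  one objective to the other and lies over \<open>a\<close> on the left and over \<open>b\<close> on the right identifies the first span, followed by the graph of
  \<open>b\<close>, with the second span, preceded by the graph of \<open>a\<close>.\<close>

lemma span_natural:
  assumes "dec_span l r f" "dec_span l' r' f'" "lin_iso n m" "Cod C n = Dom C l'"
    and "lin_iso a a'" "Dom C a = Cod C l" "Cod C a = Cod C l'" "linear_map C b" "Dom C b = Cod C r"
    and "l' \<bullet> n = a \<bullet> l" "r' \<bullet> n = b \<bullet> r" "f' \<bullet> n = f" "X = Cod C l" "Y = Cod C r"
  shows "sspan (Ident C Y) b \<odot> dspan l r f = dspan l' r' f' \<odot> sspan (Ident C X) a"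
proof -
  note N = lin_isoD(1-6)[OF assms(3)] and A = lin_isoD(1-6)[OF assms(5)]
  note S = assms(1,2)[unfolded dec_span_def]
  have "dec_span (a' \<bullet> l') r' f'"
    using S A assms(7) by (simp add: dec_span_def)
  moreover have "(a' \<bullet> l') \<bullet> n = l"
    using S N A assms(4,6,7) by (simp add: assms(10) lin_iso_cancel[OF assms(5)])
  ultimately have "dspan l (b \<bullet> r) f = dspan (a' \<bullet> l') r' f'"
    using S A assms(4,7,11,12) by (intro dspan_eqI[OF _ assms(3)]) simp_all
  then show ?thesis
    using graph_comp[OF assms(1,8)] comp_graph_iso[OF assms(2,5)] assms(6,7,9,13,14) by simp
qed

end

section \<open>The hypergraph category of open objectives\<close>

context optimization_domain_with_limits
begin

text \<open>All representatives of a class have the same boundaries, so domain and codomain may be read off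
  from any of them.\<close>

definition Opt :: "('a, ('a, 'b) open_objective set) hypergraph_category" where
  "Opt = \<lparr>Obj = Obj C, Arr = {dspan l r f |l r f. dec_span l r f},
     Dom = (\<lambda>c. Cod C (lleg (some_rep c))), Cod = (\<lambda>c. Cod C (rleg (some_rep c))),
     Ident = (\<lambda>X. sspan (Ident C X) (Ident C X)), Comp = (\<odot>),
     MUnit = Term C, TObj = Prod C, TArr = (\<boxtimes>),
     Assoc = (\<lambda>X Y Z. sspan (Ident C ((X \<times>\<^sub>o Y) \<times>\<^sub>o Z)) (prod_assoc C X Y Z)),
     LUnit = (\<lambda>X. sspan (Ident C (Term C \<times>\<^sub>o X)) (Proj1 C (Term C) X)),
     RUnit = (\<lambda>X. sspan (Ident C (X \<times>\<^sub>o Term C)) (Proj0 C X (Term C))),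
     Braid = (\<lambda>X Y. sspan (Ident C (X \<times>\<^sub>o Y)) (prod_swap C X Y)),
     Mu = (\<lambda>X. sspan (Diag C X) (Ident C X)), Eta = (\<lambda>X. sspan (Bang C X) (Ident C X)),
     Delta = (\<lambda>X. sspan (Ident C X) (Diag C X)), Epsilon = (\<lambda>X. sspan (Ident C X) (Bang C X))\<rparr>"

lemma Opt_simps [simp]:
  "Obj Opt = Obj C" "Ident Opt X = sspan (Ident C X) (Ident C X)" "Comp Opt = (\<odot>)"
  "MUnit Opt = Term C" "TObj Opt = Prod C" "TArr Opt = (\<boxtimes>)"
  "Assoc Opt X Y Z = sspan (Ident C ((X \<times>\<^sub>o Y) \<times>\<^sub>o Z)) (prod_assoc C X Y Z)"
  "LUnit Opt X = sspan (Ident C (Term C \<times>\<^sub>o X)) (Proj1 C (Term C) X)"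
  "RUnit Opt X = sspan (Ident C (X \<times>\<^sub>o Term C)) (Proj0 C X (Term C))"
  "Braid Opt X Y = sspan (Ident C (X \<times>\<^sub>o Y)) (prod_swap C X Y)"
  "Mu Opt X = sspan (Diag C X) (Ident C X)" "Eta Opt X = sspan (Bang C X) (Ident C X)"
  "Delta Opt X = sspan (Ident C X) (Diag C X)" "Epsilon Opt X = sspan (Ident C X) (Bang C X)"
  by (simp_all add: Opt_def)

lemma dspan_in_Hom_Opt:
  assumes "dec_span l r f"
  shows "dspan l r f \<in> Hom Opt (Cod C l) (Cod C r)"
proof -
  have "Cod C (lleg (some_rep (dspan l r f))) = Cod C l" "Cod C (rleg (some_rep (dspan l r f))) = Cod C r"
    using some_rep_dspan[OF assms] by metis+
  then show ?thesis using assms by (auto simp: Hom_iff Opt_def)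
qed

lemma Hom_OptE:
  assumes "c \<in> Hom Opt X Y"
  obtains l r f where "c = dspan l r f" "dec_span l r f" "Cod C l = X" "Cod C r = Y"
    "linear_map C l" "linear_map C r" "l \<in> Arr C" "r \<in> Arr C" "f \<in> Arr C"
    "Dom C r = Dom C l" "Dom C f = Dom C l" "Cod C f = R"
proof -
  obtain l r f where c: "c = dspan l r f" "dec_span l r f"
    using assms by (auto simp: Hom_iff Opt_def)
  moreover have "Cod C l = X" "Cod C r = Y"
    using dspan_in_Hom_Opt[OF c(2)] assms c(1) by (simp_all add: Hom_iff)
  ultimately show thesis
    using that by (simp add: dec_span_def)
qed

lemma dspan_in_Hom_OptI:
  "\<lbrakk>dec_span l r f; Cod C l = X; Cod C r = Y\<rbrakk> \<Longrightarrow> dspan l r f \<in> Hom Opt X Y"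
  using dspan_in_Hom_Opt by blast

lemma sspan_in_Hom_OptI:
  "\<lbrakk>linear_map C l; linear_map C r; Dom C r = Dom C l; Cod C l = X; Cod C r = Y\<rbrakk>
    \<Longrightarrow> sspan l r \<in> Hom Opt X Y"
  unfolding sspan_def by (intro dspan_in_Hom_OptI dec_span_Zero)

lemma Hom_Opt_eq:
  "Hom Opt X Y = open_objectives C R X Y // objective_iso C R X Y"
proof (intro equalityI subsetI)
  fix c assume "c \<in> Hom Opt X Y"
  then obtain l r f where c: "c = dspan l r f" "dec_span l r f" "Cod C l = X" "Cod C r = Y"
    by (rule Hom_OptE)
  then have "\<lparr>apex = Dom C l, lleg = l, rleg = r, objective = f\<rparr> \<in> open_objectives C R X Y"
    by (simp add: open_objectives_iff)
  then show "c \<in> open_objectives C R X Y // objective_iso C R X Y"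
    using c by (auto simp: dspan_def objective_class_def intro: quotientI)
next
  fix c assume "c \<in> open_objectives C R X Y // objective_iso C R X Y"
  then obtain s where s: "s \<in> open_objectives C R X Y" "c = objective_class C R X Y s"
    by (auto simp: quotient_def objective_class_def)
  then have "c = dspan (lleg s) (rleg s) (objective s)"
    using objective_class_eq_dspan by simp
  then show "c \<in> Hom Opt X Y"
    using s(1) by (auto simp: open_objectives_iff intro: dspan_in_Hom_OptI)
qed

lemma category_Opt: "category Opt"
proof
  fix c assume "c \<in> Arr Opt"
  then have "c \<in> Hom Opt (Dom Opt c) (Cod Opt c)"
    by (simp add: Hom_iff)
  then obtain l r f where "Cod C l = Dom Opt c" "Cod C r = Cod Opt c" "l \<in> Arr C" "r \<in> Arr C"
    by (rule Hom_OptE)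
  then show "Dom Opt c \<in> Obj Opt" "Cod Opt c \<in> Obj Opt"
    using Cod_Obj by (metis Opt_simps(1))+
next
  fix X assume "X \<in> Obj Opt"
  then show "Ident Opt X \<in> Hom Opt X X"
    by (simp add: sspan_in_Hom_OptI)
next
  fix c d X Y Z assume "c \<in> Hom Opt X Y" "d \<in> Hom Opt Y Z"
  then obtain l r f l' r' f' where c: "c = dspan l r f" "dec_span l r f" "Cod C l = X" "Cod C r = Y"
    "linear_map C r" and d: "d = dspan l' r' f'" "dec_span l' r' f'" "Cod C l' = Y" "Cod C r' = Z" "linear_map C l'"
    by (elim Hom_OptE) blast
  obtain b0 b1 where P: "lin_pullback r l' b0 b1"
    using lin_pullback_exists[OF finite_limits c(5) d(5)] c d by metis
  note D = lin_pullbackD(3-12)[OF P]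
  have "dspan (l \<bullet> b0) (r' \<bullet> b1) (f \<bullet> b0 \<^bold>+ f' \<bullet> b1) \<in> Hom Opt X Z"
    by (rule dspan_in_Hom_OptI[OF dec_span_comp[OF c(2) d(2) P]])
      (use D c d in \<open>simp_all add: dec_span_def\<close>)
  then show "d \<bullet>\<^bsub>Opt\<^esub> c \<in> Hom Opt X Z"
    using span_comp_dspan[OF c(2) d(2) P] by (simp add: c(1) d(1))
next
  fix c d e W X Y Z assume "c \<in> Hom Opt W X" "d \<in> Hom Opt X Y" "e \<in> Hom Opt Y Z"
  then show "(e \<bullet>\<^bsub>Opt\<^esub> d) \<bullet>\<^bsub>Opt\<^esub> c = e \<bullet>\<^bsub>Opt\<^esub> (d \<bullet>\<^bsub>Opt\<^esub> c)"
    by (elim Hom_OptE) (simp add: span_comp_assoc)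
next
  fix c X Y assume "c \<in> Hom Opt X Y"
  then obtain l r f where c: "c = dspan l r f" "dec_span l r f" "Cod C l = X" "Cod C r = Y" "l \<in> Arr C" "r \<in> Arr C"
    by (elim Hom_OptE) blast
  have "X \<in> Obj C" "Y \<in> Obj C"
    using c Cod_Obj by metis+
  then show "Ident Opt Y \<bullet>\<^bsub>Opt\<^esub> c = c" "c \<bullet>\<^bsub>Opt\<^esub> Ident Opt X = c"
    using c by (simp_all add: graph_comp comp_cograph)
qed

lemma inverse_arrows_graph:
  assumes "lin_iso a a'" "X = Dom C a" "Y = Cod C a"
  shows "inverse_arrows Opt X Y (sspan (Ident C X) a) (sspan (Ident C Y) a')"
  using lin_isoD[OF assms(1)] assms(2,3)
  by (simp add: inverse_arrows_def sspan_in_Hom_OptI graph_comp_sspan)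

lemma Inverse_graph:
  "\<lbrakk>lin_iso a a'; X = Dom C a; Y = Cod C a\<rbrakk> \<Longrightarrow> Inverse Opt (sspan (Ident C X) a) = sspan (Ident C Y) a'"
  by (rule category.Inverse_eq[OF category_Opt inverse_arrows_graph])

lemma iso_arrow_graph:
  "\<lbrakk>lin_iso a a'; X = Dom C a; Y = Cod C a\<rbrakk> \<Longrightarrow> iso_arrow Opt X Y (sspan (Ident C X) a)"
  using inverse_arrows_graph unfolding iso_arrow_def by blast

text \<open>The map \<open>a\<close> itself is an isomorphism from the first span to the second.\<close>

lemma graph_eq_cograph_inverse:
  assumes "lin_iso a a'" "X = Dom C a" "Y = Cod C a"
  shows "sspan (Ident C X) a = sspan a' (Ident C Y)"
proof -
  note A = lin_isoD[OF assms(1)]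
  have S: "dec_span a' (Ident C Y) (Zero C (Dom C a') R)"
    by (rule dec_span_Zero) (use A assms(3) in simp_all)
  show ?thesis
    unfolding sspan_def by (rule dspan_eqI[OF S assms(1)]) (use A assms(2,3) in simp_all)
qed

lemma linear_map_structural [simp]:
  "\<lbrakk>X \<in> Obj C; Y \<in> Obj C; Z \<in> Obj C\<rbrakk> \<Longrightarrow> linear_map C (prod_assoc C X Y Z)"
  "\<lbrakk>X \<in> Obj C; Y \<in> Obj C; Z \<in> Obj C\<rbrakk> \<Longrightarrow> linear_map C (prod_assoc_inv X Y Z)"
  "\<lbrakk>X \<in> Obj C; Y \<in> Obj C\<rbrakk> \<Longrightarrow> linear_map C (prod_swap C X Y)"
  "\<lbrakk>W \<in> Obj C; X \<in> Obj C; Y \<in> Obj C; Z \<in> Obj C\<rbrakk> \<Longrightarrow> linear_map C (prod_interchange W X Y Z)"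
  using lin_isoD(1,2)[OF lin_iso_prod_assoc] lin_isoD(1)[OF lin_iso_prod_swap]
    lin_isoD(1)[OF lin_iso_prod_interchange] by auto

lemmas graph_calculus = graph_comp_sspan sspan_comp_cograph sspan_tensor

text \<open>Coherence is inherited from the products of \<open>C\<close> through the graph calculus. For naturality the
  isomorphism of apexes required by \<open>span_natural\<close> is the same structural isomorphism, taken at the
  apexes instead of the boundaries; on objectives it uses that addition is associative, unital and
  commutative.\<close>

lemma symmetric_monoidal_category_Opt: "symmetric_monoidal_category Opt"
proof (intro symmetric_monoidal_category.intro category_Opt symmetric_monoidal_category_axioms.intro)
  show "MUnit Opt \<in> Obj Opt" by simp
next
  fix X Y assume "X \<in> Obj Opt" "Y \<in> Obj Opt"
  then show "X \<otimes>\<^sub>o\<^bsub>Opt\<^esub> Y \<in> Obj Opt" by simp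
next
  fix c d X X' Y Y' assume "c \<in> Hom Opt X X'" "d \<in> Hom Opt Y Y'"
  then show "c \<otimes>\<^sub>a\<^bsub>Opt\<^esub> d \<in> Hom Opt (X \<otimes>\<^sub>o\<^bsub>Opt\<^esub> Y) (X' \<otimes>\<^sub>o\<^bsub>Opt\<^esub> Y')"
    by (elim Hom_OptE) (simp add: span_tensor_dspan, intro dspan_in_Hom_OptI dec_span_tensor, simp_all)
next
  fix X Y assume "X \<in> Obj Opt" "Y \<in> Obj Opt"
  then show "Ident Opt X \<otimes>\<^sub>a\<^bsub>Opt\<^esub> Ident Opt Y = Ident Opt (X \<otimes>\<^sub>o\<^bsub>Opt\<^esub> Y)"
    by (simp add: graph_calculus)
next
  fix c c' d d' X X' X'' Y Y' Y''
  assume "c \<in> Hom Opt X X'" "c' \<in> Hom Opt X' X''" "d \<in> Hom Opt Y Y'" "d' \<in> Hom Opt Y' Y''"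
  then show "(c' \<bullet>\<^bsub>Opt\<^esub> c) \<otimes>\<^sub>a\<^bsub>Opt\<^esub> (d' \<bullet>\<^bsub>Opt\<^esub> d) = (c' \<otimes>\<^sub>a\<^bsub>Opt\<^esub> d') \<bullet>\<^bsub>Opt\<^esub> (c \<otimes>\<^sub>a\<^bsub>Opt\<^esub> d)"
    by (elim Hom_OptE) (simp add: span_interchange)
next
  fix X Y Z assume "X \<in> Obj Opt" "Y \<in> Obj Opt" "Z \<in> Obj Opt"
  then show "iso_arrow Opt ((X \<otimes>\<^sub>o\<^bsub>Opt\<^esub> Y) \<otimes>\<^sub>o\<^bsub>Opt\<^esub> Z) (X \<otimes>\<^sub>o\<^bsub>Opt\<^esub> (Y \<otimes>\<^sub>o\<^bsub>Opt\<^esub> Z)) (Assoc Opt X Y Z)"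
    by (simp add: iso_arrow_graph[OF lin_iso_prod_assoc])
next
  fix c d e X X' Y Y' Z Z'
  assume "c \<in> Hom Opt X X'" "d \<in> Hom Opt Y Y'" "e \<in> Hom Opt Z Z'"
  then obtain l1 r1 f1 l2 r2 f2 l3 r3 f3
    where c: "c = dspan l1 r1 f1" "dec_span l1 r1 f1" "Cod C l1 = X" "Cod C r1 = X'"
      "l1 \<in> Arr C" "r1 \<in> Arr C" "f1 \<in> Arr C" "Dom C r1 = Dom C l1" "Dom C f1 = Dom C l1" "Cod C f1 = R"
    and d: "d = dspan l2 r2 f2" "dec_span l2 r2 f2" "Cod C l2 = Y" "Cod C r2 = Y'"
      "l2 \<in> Arr C" "r2 \<in> Arr C" "f2 \<in> Arr C" "Dom C r2 = Dom C l2" "Dom C f2 = Dom C l2" "Cod C f2 = R"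
    and e: "e = dspan l3 r3 f3" "dec_span l3 r3 f3" "Cod C l3 = Z" "Cod C r3 = Z'"
      "l3 \<in> Arr C" "r3 \<in> Arr C" "f3 \<in> Arr C" "Dom C r3 = Dom C l3" "Dom C f3 = Dom C l3" "Cod C f3 = R"
    by (elim Hom_OptE) blast
  note T = c(3-) d(3-) e(3-)
  have O: "X \<in> Obj C" "Y \<in> Obj C" "Z \<in> Obj C" "X' \<in> Obj C" "Y' \<in> Obj C" "Z' \<in> Obj C"
    using T Cod_Obj by metis+
  \<comment> \<open>Associativity of addition, along the projections of the threefold product of the apexes.\<close>
  have "((f1 \<bullet> Proj0 C (Dom C l1) (Dom C l2)) \<bullet> p \<^bold>+ (f2 \<bullet> Proj1 C (Dom C l1) (Dom C l2)) \<bullet> p) \<^bold>+ f3 \<bullet> q =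
     f1 \<bullet> (Proj0 C (Dom C l1) (Dom C l2) \<bullet> p) \<^bold>+ (f2 \<bullet> (Proj1 C (Dom C l1) (Dom C l2) \<bullet> p) \<^bold>+ f3 \<bullet> q)"
    if "p \<in> Hom C ((Dom C l1 \<times>\<^sub>o Dom C l2) \<times>\<^sub>o Dom C l3) (Dom C l1 \<times>\<^sub>o Dom C l2)"
      "q \<in> Hom C ((Dom C l1 \<times>\<^sub>o Dom C l2) \<times>\<^sub>o Dom C l3) (Dom C l3)" for p q
    using that T Add_assoc[of "f1 \<bullet> Proj0 C (Dom C l1) (Dom C l2) \<bullet> p" "(Dom C l1 \<times>\<^sub>o Dom C l2) \<times>\<^sub>o Dom C l3" R
        "f2 \<bullet> Proj1 C (Dom C l1) (Dom C l2) \<bullet> p" "f3 \<bullet> q"]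
    by (simp add: Hom_iff)
  note assoc = this[of "Proj0 C (Dom C l1 \<times>\<^sub>o Dom C l2) (Dom C l3)" "Proj1 C (Dom C l1 \<times>\<^sub>o Dom C l2) (Dom C l3)"]
  have "sspan (Ident C ((X' \<times>\<^sub>o Y') \<times>\<^sub>o Z')) (prod_assoc C X' Y' Z') \<odot> ((c \<boxtimes> d) \<boxtimes> e) =
      (c \<boxtimes> (d \<boxtimes> e)) \<odot> sspan (Ident C ((X \<times>\<^sub>o Y) \<times>\<^sub>o Z)) (prod_assoc C X Y Z)"
    unfolding c(1) d(1) e(1)
      span_tensor_dspan[OF c(2) d(2)] span_tensor_dspan[OF dec_span_tensor[OF c(2) d(2)] e(2)]
      span_tensor_dspan[OF d(2) e(2)] span_tensor_dspan[OF c(2) dec_span_tensor[OF d(2) e(2)]]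
  proof (rule span_natural[OF dec_span_tensor[OF dec_span_tensor[OF c(2) d(2)] e(2)]
        dec_span_tensor[OF c(2) dec_span_tensor[OF d(2) e(2)]]
        lin_iso_prod_assoc[of "Dom C l1" "Dom C l2" "Dom C l3"] _ lin_iso_prod_assoc[of X Y Z]])
    show "(l1 \<times>\<^sub>a (l2 \<times>\<^sub>a l3)) \<bullet> prod_assoc C (Dom C l1) (Dom C l2) (Dom C l3) =
        prod_assoc C X Y Z \<bullet> ((l1 \<times>\<^sub>a l2) \<times>\<^sub>a l3)"
      using prod_assoc_natural[of l1 l2 l3] T by simp
    show "(r1 \<times>\<^sub>a (r2 \<times>\<^sub>a r3)) \<bullet> prod_assoc C (Dom C l1) (Dom C l2) (Dom C l3) =
        prod_assoc C X' Y' Z' \<bullet> ((r1 \<times>\<^sub>a r2) \<times>\<^sub>a r3)"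
      using prod_assoc_natural[of r1 r2 r3] T by simp
    show "(f1 \<bullet> Proj0 C (Dom C l1) (Dom C (l2 \<times>\<^sub>a l3)) \<^bold>+
        (f2 \<bullet> Proj0 C (Dom C l2) (Dom C l3) \<^bold>+ f3 \<bullet> Proj1 C (Dom C l2) (Dom C l3)) \<bullet> Proj1 C (Dom C l1) (Dom C (l2 \<times>\<^sub>a l3))) \<bullet>
        prod_assoc C (Dom C l1) (Dom C l2) (Dom C l3) =
      (f1 \<bullet> Proj0 C (Dom C l1) (Dom C l2) \<^bold>+ f2 \<bullet> Proj1 C (Dom C l1) (Dom C l2)) \<bullet> Proj0 C (Dom C (l1 \<times>\<^sub>a l2)) (Dom C l3) \<^bold>+
        f3 \<bullet> Proj1 C (Dom C (l1 \<times>\<^sub>a l2)) (Dom C l3)"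
      using T assoc by (simp add: prod_assoc_def Hom_iff)
  qed (use T O in simp_all)
  then show "Assoc Opt X' Y' Z' \<bullet>\<^bsub>Opt\<^esub> ((c \<otimes>\<^sub>a\<^bsub>Opt\<^esub> d) \<otimes>\<^sub>a\<^bsub>Opt\<^esub> e) = (c \<otimes>\<^sub>a\<^bsub>Opt\<^esub> (d \<otimes>\<^sub>a\<^bsub>Opt\<^esub> e)) \<bullet>\<^bsub>Opt\<^esub> Assoc Opt X Y Z"
    by simp
next
  fix X assume "X \<in> Obj Opt"
  then show "iso_arrow Opt (MUnit Opt \<otimes>\<^sub>o\<^bsub>Opt\<^esub> X) X (LUnit Opt X)"
    "iso_arrow Opt (X \<otimes>\<^sub>o\<^bsub>Opt\<^esub> MUnit Opt) X (RUnit Opt X)"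
    by (simp_all add: iso_arrow_graph[OF lin_iso_Term(1)] iso_arrow_graph[OF lin_iso_Term(2)])
next
  fix c X Y assume "c \<in> Hom Opt X Y"
  then obtain l r f where c: "c = dspan l r f" "dec_span l r f" "Cod C l = X" "Cod C r = Y"
      "linear_map C r" "l \<in> Arr C" "r \<in> Arr C" "f \<in> Arr C" "Dom C r = Dom C l" "Dom C f = Dom C l" "Cod C f = R"
    by (elim Hom_OptE) blast
  have O: "X \<in> Obj C" "Y \<in> Obj C"
    using c Cod_Obj by metis+
  have I: "dec_span (Ident C (Term C)) (Ident C (Term C)) (Zero C (Dom C (Ident C (Term C))) R)"
    by (rule dec_span_Zero) simp_all
  show "LUnit Opt Y \<bullet>\<^bsub>Opt\<^esub> (Ident Opt (MUnit Opt) \<otimes>\<^sub>a\<^bsub>Opt\<^esub> c) = c \<bullet>\<^bsub>Opt\<^esub> LUnit Opt X"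
    unfolding Opt_simps sspan_def[of "Ident C (Term C)"] c(1) span_tensor_dspan[OF I c(2)]
    by (rule span_natural[OF dec_span_tensor[OF I c(2)] c(2) lin_iso_Term(1)[of "Dom C l"] _ lin_iso_Term(1)[of X]])
      (use c O in \<open>simp_all add: Cross_Pairing\<close>)
  show "RUnit Opt Y \<bullet>\<^bsub>Opt\<^esub> (c \<otimes>\<^sub>a\<^bsub>Opt\<^esub> Ident Opt (MUnit Opt)) = c \<bullet>\<^bsub>Opt\<^esub> RUnit Opt X"
    unfolding Opt_simps sspan_def[of "Ident C (Term C)"] c(1) span_tensor_dspan[OF c(2) I]
    by (rule span_natural[OF dec_span_tensor[OF c(2) I] c(2) lin_iso_Term(2)[of "Dom C l"] _ lin_iso_Term(2)[of X]])
      (use c O in \<open>simp_all add: Cross_Pairing\<close>)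
next
  fix W X Y Z assume "W \<in> Obj Opt" "X \<in> Obj Opt" "Y \<in> Obj Opt" "Z \<in> Obj Opt"
  then show "Assoc Opt W X (Y \<otimes>\<^sub>o\<^bsub>Opt\<^esub> Z) \<bullet>\<^bsub>Opt\<^esub> Assoc Opt (W \<otimes>\<^sub>o\<^bsub>Opt\<^esub> X) Y Z =
      (Ident Opt W \<otimes>\<^sub>a\<^bsub>Opt\<^esub> Assoc Opt X Y Z) \<bullet>\<^bsub>Opt\<^esub> Assoc Opt W (X \<otimes>\<^sub>o\<^bsub>Opt\<^esub> Y) Z \<bullet>\<^bsub>Opt\<^esub> (Assoc Opt W X Y \<otimes>\<^sub>a\<^bsub>Opt\<^esub> Ident Opt Z)"
    by (simp add: graph_calculus prod_pentagon)
next
  fix X Y assume "X \<in> Obj Opt" "Y \<in> Obj Opt"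
  then show "(Ident Opt X \<otimes>\<^sub>a\<^bsub>Opt\<^esub> LUnit Opt Y) \<bullet>\<^bsub>Opt\<^esub> Assoc Opt X (MUnit Opt) Y = RUnit Opt X \<otimes>\<^sub>a\<^bsub>Opt\<^esub> Ident Opt Y"
    and "Braid Opt X Y \<in> Hom Opt (X \<otimes>\<^sub>o\<^bsub>Opt\<^esub> Y) (Y \<otimes>\<^sub>o\<^bsub>Opt\<^esub> X)"
    and "Braid Opt Y X \<bullet>\<^bsub>Opt\<^esub> Braid Opt X Y = Ident Opt (X \<otimes>\<^sub>o\<^bsub>Opt\<^esub> Y)"
    by (simp_all add: graph_calculus prod_triangle prod_swap_inverse sspan_in_Hom_OptI)
next
  fix c d X X' Y Y' assume "c \<in> Hom Opt X X'" "d \<in> Hom Opt Y Y'"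
  then obtain l1 r1 f1 l2 r2 f2
    where c: "c = dspan l1 r1 f1" "dec_span l1 r1 f1" "Cod C l1 = X" "Cod C r1 = X'"
      "l1 \<in> Arr C" "r1 \<in> Arr C" "f1 \<in> Arr C" "Dom C r1 = Dom C l1" "Dom C f1 = Dom C l1" "Cod C f1 = R"
    and d: "d = dspan l2 r2 f2" "dec_span l2 r2 f2" "Cod C l2 = Y" "Cod C r2 = Y'"
      "l2 \<in> Arr C" "r2 \<in> Arr C" "f2 \<in> Arr C" "Dom C r2 = Dom C l2" "Dom C f2 = Dom C l2" "Cod C f2 = R"
    by (elim Hom_OptE) blast
  note T = c(3-) d(3-)
  have O: "X \<in> Obj C" "Y \<in> Obj C" "X' \<in> Obj C" "Y' \<in> Obj C"
    using T Cod_Obj by metis+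
  have comm: "f2 \<bullet> Proj1 C (Dom C l1) (Dom C l2) \<^bold>+ f1 \<bullet> Proj0 C (Dom C l1) (Dom C l2) =
      f1 \<bullet> Proj0 C (Dom C l1) (Dom C l2) \<^bold>+ f2 \<bullet> Proj1 C (Dom C l1) (Dom C l2)"
    by (rule Add_commute[of _ "Dom C l1 \<times>\<^sub>o Dom C l2" R]) (use T in \<open>simp_all add: Hom_iff\<close>)
  have "sspan (Ident C (X' \<times>\<^sub>o Y')) (prod_swap C X' Y') \<odot> (c \<boxtimes> d) =
      (d \<boxtimes> c) \<odot> sspan (Ident C (X \<times>\<^sub>o Y)) (prod_swap C X Y)"
    unfolding c(1) d(1) span_tensor_dspan[OF c(2) d(2)] span_tensor_dspan[OF d(2) c(2)]
  proof (rule span_natural[OF dec_span_tensor[OF c(2) d(2)] dec_span_tensor[OF d(2) c(2)]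
        lin_iso_prod_swap[of "Dom C l1" "Dom C l2"] _ lin_iso_prod_swap[of X Y]])
    show "(l2 \<times>\<^sub>a l1) \<bullet> prod_swap C (Dom C l1) (Dom C l2) = prod_swap C X Y \<bullet> (l1 \<times>\<^sub>a l2)"
      using prod_swap_natural[of l1 l2] T by simp
    show "(r2 \<times>\<^sub>a r1) \<bullet> prod_swap C (Dom C l1) (Dom C l2) = prod_swap C X' Y' \<bullet> (r1 \<times>\<^sub>a r2)"
      using prod_swap_natural[of r1 r2] T by simp
    show "(f2 \<bullet> Proj0 C (Dom C l2) (Dom C l1) \<^bold>+ f1 \<bullet> Proj1 C (Dom C l2) (Dom C l1)) \<bullet> prod_swap C (Dom C l1) (Dom C l2) =
        f1 \<bullet> Proj0 C (Dom C l1) (Dom C l2) \<^bold>+ f2 \<bullet> Proj1 C (Dom C l1) (Dom C l2)"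
      using T comm by (simp add: prod_swap_def)
  qed (use T O in simp_all)
  then show "Braid Opt X' Y' \<bullet>\<^bsub>Opt\<^esub> (c \<otimes>\<^sub>a\<^bsub>Opt\<^esub> d) = (d \<otimes>\<^sub>a\<^bsub>Opt\<^esub> c) \<bullet>\<^bsub>Opt\<^esub> Braid Opt X Y"
    by simp
next
  fix X Y Z assume "X \<in> Obj Opt" "Y \<in> Obj Opt" "Z \<in> Obj Opt"
  then show "Assoc Opt Y Z X \<bullet>\<^bsub>Opt\<^esub> Braid Opt X (Y \<otimes>\<^sub>o\<^bsub>Opt\<^esub> Z) \<bullet>\<^bsub>Opt\<^esub> Assoc Opt X Y Z =
      (Ident Opt Y \<otimes>\<^sub>a\<^bsub>Opt\<^esub> Braid Opt X Z) \<bullet>\<^bsub>Opt\<^esub> Assoc Opt Y X Z \<bullet>\<^bsub>Opt\<^esub> (Braid Opt X Y \<otimes>\<^sub>a\<^bsub>Opt\<^esub> Ident Opt Z)"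
    by (simp add: graph_calculus prod_hexagon)
qed

lemma interchange_Opt:
  assumes "W \<in> Obj C" "X \<in> Obj C" "Y \<in> Obj C" "Z \<in> Obj C"
  shows "interchange Opt W X Y Z = sspan (Ident C ((W \<times>\<^sub>o X) \<times>\<^sub>o (Y \<times>\<^sub>o Z))) (prod_interchange W X Y Z)"
proof -
  have "Inverse Opt (Assoc Opt X' Y' Z') = sspan (Ident C (X' \<times>\<^sub>o (Y' \<times>\<^sub>o Z'))) (prod_assoc_inv X' Y' Z')"
    if "X' \<in> Obj C" "Y' \<in> Obj C" "Z' \<in> Obj C" for X' Y' Z'
    using that by (simp add: Inverse_graph[OF lin_iso_prod_assoc])
  then show ?thesis
    using assms by (simp add: interchange_def graph_calculus prod_interchange_eq del: Opt_simps(7)) (simp add: graph_calculus prod_interchange_eq)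
qed

text \<open>The comonoid axioms are equations between graphs, and the monoid axioms are the corresponding
  equations between cographs, once the associators, unitors and braidings in them are turned into
  cographs of their inverses. The special and Frobenius laws use the pullbacks of diagonals.\<close>

lemma hypergraph_category_Opt: "hypergraph_category Opt"
proof (intro hypergraph_category.intro symmetric_monoidal_category_Opt hypergraph_category_axioms.intro)
  fix X assume "X \<in> Obj Opt"
  then have X: "X \<in> Obj C" by simp
  note Inv = Inverse_graph[OF lin_iso_prod_assoc]
  show "Mu Opt X \<in> Hom Opt (X \<otimes>\<^sub>o\<^bsub>Opt\<^esub> X) X" "Eta Opt X \<in> Hom Opt (MUnit Opt) X"
    "Delta Opt X \<in> Hom Opt X (X \<otimes>\<^sub>o\<^bsub>Opt\<^esub> X)" "Epsilon Opt X \<in> Hom Opt X (MUnit Opt)"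
    using X by (simp_all add: sspan_in_Hom_OptI)
  show "Mu Opt X \<bullet>\<^bsub>Opt\<^esub> (Mu Opt X \<otimes>\<^sub>a\<^bsub>Opt\<^esub> Ident Opt X) =
      Mu Opt X \<bullet>\<^bsub>Opt\<^esub> (Ident Opt X \<otimes>\<^sub>a\<^bsub>Opt\<^esub> Mu Opt X) \<bullet>\<^bsub>Opt\<^esub> Assoc Opt X X X"
    using X by (simp add: graph_calculus sspan_comp_graph_iso[OF _ _ _ lin_iso_prod_assoc] flip: Diag_coassoc_inv)
  show "Mu Opt X \<bullet>\<^bsub>Opt\<^esub> (Eta Opt X \<otimes>\<^sub>a\<^bsub>Opt\<^esub> Ident Opt X) = LUnit Opt X"
    using X by (simp add: graph_calculus Diag_counit graph_eq_cograph_inverse[OF lin_iso_Term(1)])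
  show "Mu Opt X \<bullet>\<^bsub>Opt\<^esub> (Ident Opt X \<otimes>\<^sub>a\<^bsub>Opt\<^esub> Eta Opt X) = RUnit Opt X"
    using X by (simp add: graph_calculus Diag_counit graph_eq_cograph_inverse[OF lin_iso_Term(2)])
  show "Mu Opt X \<bullet>\<^bsub>Opt\<^esub> Braid Opt X X = Mu Opt X"
    using X by (simp add: sspan_comp_graph_iso[OF _ _ _ lin_iso_prod_swap] Diag_cocomm)
  show "Assoc Opt X X X \<bullet>\<^bsub>Opt\<^esub> (Delta Opt X \<otimes>\<^sub>a\<^bsub>Opt\<^esub> Ident Opt X) \<bullet>\<^bsub>Opt\<^esub> Delta Opt X =
      (Ident Opt X \<otimes>\<^sub>a\<^bsub>Opt\<^esub> Delta Opt X) \<bullet>\<^bsub>Opt\<^esub> Delta Opt X"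
    "Braid Opt X X \<bullet>\<^bsub>Opt\<^esub> Delta Opt X = Delta Opt X"
    "LUnit Opt X \<bullet>\<^bsub>Opt\<^esub> (Epsilon Opt X \<otimes>\<^sub>a\<^bsub>Opt\<^esub> Ident Opt X) \<bullet>\<^bsub>Opt\<^esub> Delta Opt X = Ident Opt X"
    "RUnit Opt X \<bullet>\<^bsub>Opt\<^esub> (Ident Opt X \<otimes>\<^sub>a\<^bsub>Opt\<^esub> Epsilon Opt X) \<bullet>\<^bsub>Opt\<^esub> Delta Opt X = Ident Opt X"
    using X by (simp_all add: graph_calculus Diag_coassoc Diag_cocomm Diag_counit)
  show "(Ident Opt X \<otimes>\<^sub>a\<^bsub>Opt\<^esub> Mu Opt X) \<bullet>\<^bsub>Opt\<^esub> Assoc Opt X X X \<bullet>\<^bsub>Opt\<^esub> (Delta Opt X \<otimes>\<^sub>a\<^bsub>Opt\<^esub> Ident Opt X) =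
      Delta Opt X \<bullet>\<^bsub>Opt\<^esub> Mu Opt X"
    using X by (simp add: graph_calculus sspan_comp[OF _ _ _ _ _ _ lin_pullback_Frobenius(1)])
  show "(Mu Opt X \<otimes>\<^sub>a\<^bsub>Opt\<^esub> Ident Opt X) \<bullet>\<^bsub>Opt\<^esub> Inverse Opt (Assoc Opt X X X) \<bullet>\<^bsub>Opt\<^esub> (Ident Opt X \<otimes>\<^sub>a\<^bsub>Opt\<^esub> Delta Opt X) =
      Delta Opt X \<bullet>\<^bsub>Opt\<^esub> Mu Opt X"
    using X by (simp add: Inv graph_calculus sspan_comp[OF _ _ _ _ _ _ lin_pullback_Frobenius(2)])
  show "Mu Opt X \<bullet>\<^bsub>Opt\<^esub> Delta Opt X = Ident Opt X"
    using X by (simp add: sspan_comp[OF _ _ _ _ _ _ lin_pullback_Diag])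
next
  fix X Y assume "X \<in> Obj Opt" "Y \<in> Obj Opt"
  then have XY: "X \<in> Obj C" "Y \<in> Obj C" by simp_all
  show "Mu Opt (X \<otimes>\<^sub>o\<^bsub>Opt\<^esub> Y) = (Mu Opt X \<otimes>\<^sub>a\<^bsub>Opt\<^esub> Mu Opt Y) \<bullet>\<^bsub>Opt\<^esub> interchange Opt X Y X Y"
    using XY by (simp add: interchange_Opt graph_calculus sspan_comp_graph_iso[OF _ _ _ lin_iso_prod_interchange] Diag_Prod)
  show "Delta Opt (X \<otimes>\<^sub>o\<^bsub>Opt\<^esub> Y) = interchange Opt X X Y Y \<bullet>\<^bsub>Opt\<^esub> (Delta Opt X \<otimes>\<^sub>a\<^bsub>Opt\<^esub> Delta Opt Y)"
    using XY by (simp add: interchange_Opt graph_calculus Diag_Prod)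
  show "Eta Opt (X \<otimes>\<^sub>o\<^bsub>Opt\<^esub> Y) = (Eta Opt X \<otimes>\<^sub>a\<^bsub>Opt\<^esub> Eta Opt Y) \<bullet>\<^bsub>Opt\<^esub> Inverse Opt (LUnit Opt (MUnit Opt))"
    using XY by (simp add: Inverse_graph[OF lin_iso_Term(1)] graph_calculus Cross_Pairing
        sspan_comp_graph_iso[OF _ _ _ lin_iso_sym[OF lin_iso_Term(1)]])
  show "Epsilon Opt (X \<otimes>\<^sub>o\<^bsub>Opt\<^esub> Y) = LUnit Opt (MUnit Opt) \<bullet>\<^bsub>Opt\<^esub> (Epsilon Opt X \<otimes>\<^sub>a\<^bsub>Opt\<^esub> Epsilon Opt Y)"
    using XY by (simp add: graph_calculus Cross_Pairing)
next
  have B: "Bang C (Term C) = Ident C (Term C)"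
    by (rule Term_ext) simp_all
  show "Mu Opt (MUnit Opt) = LUnit Opt (MUnit Opt)"
    by (simp add: graph_eq_cograph_inverse[OF lin_iso_Term(1)] Diag_def B)
  show "Eta Opt (MUnit Opt) = Ident Opt (MUnit Opt)" "Epsilon Opt (MUnit Opt) = Ident Opt (MUnit Opt)"
    by (simp_all add: B)
  show "Delta Opt (MUnit Opt) = Inverse Opt (LUnit Opt (MUnit Opt))"
    by (simp add: Inverse_graph[OF lin_iso_Term(1)] Diag_def B)
qed

text \<open>Composing the copairing \<open>f \<bullet> \<pi>\<^sub>0 + g \<bullet> \<pi>\<^sub>1\<close> of two objectives with \<open>\<langle>b0, b1\<rangle>\<close> gives the sum
  \<open>f \<bullet> b0 + g \<bullet> b1\<close> by which \<open>span_comp\<close> is defined.\<close>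

lemma objective_comp_eq:
  assumes "s \<in> open_objectives C R X Y" "t \<in> open_objectives C R Y Z"
    and "is_pullback (Lin C) (rleg s) (lleg t) P b0 b1"
  shows "objective_class C R Y Z t \<odot> objective_class C R X Y s = objective_class C R X Z (objective_comp C s t P b0 b1)"
proof -
  have S: "dec_span (lleg s) (rleg s) (objective s)" "Dom C (lleg s) = apex s" "Cod C (lleg s) = X" "Cod C (rleg s) = Y"
    and T: "dec_span (lleg t) (rleg t) (objective t)" "Dom C (lleg t) = apex t" "Cod C (lleg t) = Y" "Cod C (rleg t) = Z"
    using assms(1,2) by (simp_all add: open_objectives_iff)
  have apex: "apex s \<in> Obj C" "apex t \<in> Obj C"
    using assms(1,2) by (simp_all add: open_objectives_def)
  have P: "Dom C b0 = P"
    using assms(3) by (simp add: is_pullback_def Hom_Lin_iff)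
  then have pb: "lin_pullback (rleg s) (lleg t) b0 b1"
    using assms(3) by (simp add: lin_pullback_def)
  note D = lin_pullbackD(3-12)[OF pb]
  have o: "objective_comp C s t P b0 b1 = \<lparr>apex = P, lleg = lleg s \<bullet> b0, rleg = rleg t \<bullet> b1,
      objective = objective s \<bullet> b0 \<^bold>+ objective t \<bullet> b1\<rparr>"
    using S T D apex by (simp add: objective_comp_def O_map_def O_lax_def dec_span_def)
  have typing: "Dom C (lleg s \<bullet> b0) = P" "Cod C (lleg s \<bullet> b0) = X" "Cod C (rleg t \<bullet> b1) = Z"
    using S T D P by (simp_all add: dec_span_def)
  have "objective_comp C s t P b0 b1 \<in> open_objectives C R X Z"
    using dec_span_comp[OF S(1) T(1) pb] typing unfolding o open_objectives_iff by simp
  then show ?thesis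
    unfolding objective_class_eq_dspan[OF assms(1)] objective_class_eq_dspan[OF assms(2)]
      span_comp_dspan[OF S(1) T(1) pb]
    by (simp add: objective_class_eq_dspan) (simp add: o)
qed

lemma objective_tensor_eq:
  assumes "s \<in> open_objectives C R X Y" "t \<in> open_objectives C R W Z"
  shows "objective_class C R X Y s \<boxtimes> objective_class C R W Z t =
    objective_class C R (X \<times>\<^sub>o W) (Y \<times>\<^sub>o Z) (objective_tensor C s t)"
proof -
  have S: "dec_span (lleg s) (rleg s) (objective s)" "Dom C (lleg s) = apex s" "Cod C (lleg s) = X" "Cod C (rleg s) = Y"
    and T: "dec_span (lleg t) (rleg t) (objective t)" "Dom C (lleg t) = apex t" "Cod C (lleg t) = W" "Cod C (rleg t) = Z"
    using assms by (simp_all add: open_objectives_iff)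
  have "objective_tensor C s t \<in> open_objectives C R (X \<times>\<^sub>o W) (Y \<times>\<^sub>o Z)"
    using dec_span_tensor[OF S(1) T(1)] S T unfolding open_objectives_iff
    by (simp add: objective_tensor_def O_lax_def dec_span_def)
  then show ?thesis
    unfolding objective_class_eq_dspan[OF assms(1)] objective_class_eq_dspan[OF assms(2)]
      span_tensor_dspan[OF S(1) T(1)]
    by (simp add: objective_class_eq_dspan) (simp add: objective_tensor_def O_lax_def S T)
qed

end

theorem corollary3p2p1:
  fixes C :: "('o, 'm, 'z) optimization_domain_scheme" and R :: 'o
  assumes "optimization_domain C R"
    and "has_finite_limits (Lin C)"
  shows "\<exists>Opt :: ('o, ('o, 'm) open_objective set) hypergraph_category.
    hypergraph_category Opt \<and>
    Obj Opt = Obj C \<and>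
    (\<forall>X \<in> Obj C. \<forall>Y \<in> Obj C. Hom Opt X Y = open_objectives C R X Y // objective_iso C R X Y) \<and>
    (\<forall>X \<in> Obj C. \<forall>Y \<in> Obj C. \<forall>Z \<in> Obj C.
       \<forall>s \<in> open_objectives C R X Y. \<forall>t \<in> open_objectives C R Y Z. \<forall>P b0 b1.
         is_pullback (Lin C) (rleg s) (lleg t) P b0 b1 \<longrightarrow>
         objective_class C R Y Z t \<bullet>\<^bsub>Opt\<^esub> objective_class C R X Y s =
         objective_class C R X Z (objective_comp C s t P b0 b1)) \<and>
    (\<forall>X \<in> Obj C. Ident Opt X = span_class C R X X X (Ident C X) (Ident C X)) \<and>
    MUnit Opt = Term C \<and>
    (\<forall>X \<in> Obj C. \<forall>Y \<in> Obj C. X \<otimes>\<^sub>o\<^bsub>Opt\<^esub> Y = X \<times>\<^sub>o\<^bsub>C\<^esub> Y) \<and>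
    (\<forall>X \<in> Obj C. \<forall>Y \<in> Obj C. \<forall>W \<in> Obj C. \<forall>Z \<in> Obj C.
       \<forall>s \<in> open_objectives C R X Y. \<forall>t \<in> open_objectives C R W Z.
         objective_class C R X Y s \<otimes>\<^sub>a\<^bsub>Opt\<^esub> objective_class C R W Z t =
         objective_class C R (X \<times>\<^sub>o\<^bsub>C\<^esub> W) (Y \<times>\<^sub>o\<^bsub>C\<^esub> Z) (objective_tensor C s t)) \<and>
    (\<forall>X \<in> Obj C. \<forall>Y \<in> Obj C. \<forall>Z \<in> Obj C.
       Assoc Opt X Y Z =
       span_class C R ((X \<times>\<^sub>o\<^bsub>C\<^esub> Y) \<times>\<^sub>o\<^bsub>C\<^esub> Z) (X \<times>\<^sub>o\<^bsub>C\<^esub> (Y \<times>\<^sub>o\<^bsub>C\<^esub> Z)) ((X \<times>\<^sub>o\<^bsub>C\<^esub> Y) \<times>\<^sub>o\<^bsub>C\<^esub> Z)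
         (Ident C ((X \<times>\<^sub>o\<^bsub>C\<^esub> Y) \<times>\<^sub>o\<^bsub>C\<^esub> Z)) (prod_assoc C X Y Z)) \<and>
    (\<forall>X \<in> Obj C.
       LUnit Opt X = span_class C R (Term C \<times>\<^sub>o\<^bsub>C\<^esub> X) X (Term C \<times>\<^sub>o\<^bsub>C\<^esub> X)
         (Ident C (Term C \<times>\<^sub>o\<^bsub>C\<^esub> X)) (Proj1 C (Term C) X) \<and>
       RUnit Opt X = span_class C R (X \<times>\<^sub>o\<^bsub>C\<^esub> Term C) X (X \<times>\<^sub>o\<^bsub>C\<^esub> Term C)
         (Ident C (X \<times>\<^sub>o\<^bsub>C\<^esub> Term C)) (Proj0 C X (Term C))) \<and>
    (\<forall>X \<in> Obj C. \<forall>Y \<in> Obj C.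
       Braid Opt X Y = span_class C R (X \<times>\<^sub>o\<^bsub>C\<^esub> Y) (Y \<times>\<^sub>o\<^bsub>C\<^esub> X) (X \<times>\<^sub>o\<^bsub>C\<^esub> Y)
         (Ident C (X \<times>\<^sub>o\<^bsub>C\<^esub> Y)) (prod_swap C X Y)) \<and>
    (\<forall>X \<in> Obj C.
       Mu Opt X = span_class C R (X \<times>\<^sub>o\<^bsub>C\<^esub> X) X X (Diag C X) (Ident C X) \<and>
       Eta Opt X = span_class C R (Term C) X X (Bang C X) (Ident C X) \<and>
       Delta Opt X = span_class C R X (X \<times>\<^sub>o\<^bsub>C\<^esub> X) X (Ident C X) (Diag C X) \<and>
       Epsilon Opt X = span_class C R X (Term C) X (Ident C X) (Bang C X))"
proof -
  interpret optimization_domain_with_limits C R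
    using assms by (intro optimization_domain_with_limits.intro optimization_domain_with_limits_axioms.intro)
  show ?thesis
    by (rule exI[of _ Opt])
      (simp add: hypergraph_category_Opt Hom_Opt_eq objective_comp_eq objective_tensor_eq span_class_eq_sspan)
qed

end
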